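(* Let $(\mathcal{M},g)$ be a paracompact, connected, pseudo-Riemannian manifold of dimension $n$ and signature $(p,q)$, and let $U\subseteq\mathcal{M}$ be an open set with a local orthonormal coframe $\{e^1,\dots,e^n\}$ of $T^{*}\mathcal{M}$. If $n$ is odd and $p-q\equiv 0,1,4,5\pmod 8$, then, for each choice of sign, $(\Gamma_L,\bullet_\pm)\cong(\Gamma_\pm,\diamond)$ as algebras.
   Context: The constant function $1$ on $U$, viewed as a $0$-form, is denoted $1_\Gamma$. Let $\{e_1,\dots,e_n\}$ be the frame of $T\mathcal{M}$ over $U$ dual to $\{e^i\}$, so $e^i(e_j)=\delta^i_j$. Let $g^{*}$ be the metric induced by $g$ on $T^{*}\mathcal{M}$ and $g^{ij}=g^{*}(e^i,e^j)$; orthonormal means $g^{ij}=0$ for $i\ne j$, $g^{ii}=1$ for $1\le i\le p$ and $g^{ii}=-1$ for $p+1\le i\le n$. $e_i\rfloor$ denotes contraction (interior product) on forms: the linear map of degree $-1$ vanishing on $0$-forms with $e_i\rfloor e^j=\delta_i^j 1_\Gamma$ and $e_i\rfloor(\alpha\wedge\beta)=(e_i\rfloor\alpha)\wedge\beta+(-1)^{\deg\alpha}\alpha\wedge(e_i\rfloor\beta)$. The contracted wedge product of order $l\ge 0$ on $\Gamma(U,\bigwedge(T^{*}\mathcal{M}))$ is defined iteratively by $f_1\wedge_0 f_2=f_1\wedge f_2$ and $f_1\wedge_l f_2=\sum_{i,j=1}^n g^{ij}(e_i\rfloor f_1)\wedge_{l-1}(e_j\rfloor f_2)$ for $l\ge1$.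 The Graf product $\diamond$ is the bilinear product on $\Gamma(U,\bigwedge(T^{*}\mathcal{M}))$ defined for an $r$-form $f_1$ and an $s$-form $f_2$ with $r\le s$ by $$f_1\diamond f_2=\sum_{l=0}^r\frac{(-1)^{l(r-l)+[l/2]}}{l!}f_1\wedge_l f_2,\qquad f_2\diamond f_1=(-1)^{rs}\sum_{l=0}^r\frac{(-1)^{l(r-l+1)+[l/2]}}{l!}f_1\wedge_l f_2,$$ where $[x]$ is the integer part of $x$. Let $\mathbf{v}=e^1\wedge\cdots\wedge e^n$ be the volume element. The Hodge operator is the linear map $\star f=f\diamond\mathbf{v}$ on $\Gamma(U,\bigwedge(T^{*}\mathcal{M}))$. Put $p_\pm=\frac12(1_\Gamma\pm\mathbf{v})$, $P_\pm(f)=f\diamond p_\pm=\frac12(f\pm\star f)$, and $\Gamma_\pm=P_\pm\big(\Gamma(U,\bigwedge(T^{*}\mathcal{M}))\big)$. Let $\Gamma_L=\bigoplus_{k=0}^{[n/2]}\Gamma(U,\bigwedge^k(T^{*}\mathcal{M}))$ and let $P_L:\Gamma(U,\bigwedge(T^{*}\mathcal{M}))\to\Gamma_L$ be the lower truncation, i.e. the projection that keeps the homogeneous components of degree at most $[n/2]$ and kills those of higher degree. The truncated Graf product is $$f_1\,\bullet_\pm\, f_2=2P_L\big(P_\pm(f_1)\diamond P_\pm(f_2)\big)\in\Gamma_L,\qquad f_1,f_2\in\Gamma(U,\textstyle\bigwedge(T^{*}\mathcal{M})).$$ *)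

theory Defs
  imports "HOL-Analysis.Analysis" "HOL-Algebra.Module" "HOL-Algebra.QuotRing"
begin

section \<open>Smooth manifolds\<close>

text \<open>
  Charts are pairs of a domain and a coordinate map; the values of the coordinate map outside the
  domain are irrelevant. The dimension of the manifold is \<open>CARD('n)\<close>.
\<close>

type_synonym ('m, 'n) chart = "'m set \<times> ('m \<Rightarrow> real ^ 'n)"

primrec Ck_on :: "nat \<Rightarrow> (real ^ 'n::finite) set \<Rightarrow> (real ^ 'n \<Rightarrow> real) \<Rightarrow> bool" where
  "Ck_on 0 S f \<longleftrightarrow> continuous_on S f"
| "Ck_on (Suc k) S f \<longleftrightarrow> (\<forall>x\<in>S. f differentiable (at x)) \<and>
     (\<forall>j. Ck_on k S (\<lambda>x. frechet_derivative f (at x) (axis j 1)))"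

definition smooth_on :: "(real ^ 'n::finite) set \<Rightarrow> (real ^ 'n \<Rightarrow> real) \<Rightarrow> bool" where
  "smooth_on S f \<longleftrightarrow> (\<forall>k. Ck_on k S f)"

definition chart_inv :: "('m, 'n) chart \<Rightarrow> real ^ 'n \<Rightarrow> 'm" where
  "chart_inv c = inv_into (fst c) (snd c)"

definition transition :: "('m, 'n) chart \<Rightarrow> ('m, 'n) chart \<Rightarrow> real ^ 'n \<Rightarrow> real ^ 'n" where
  "transition c d = snd d \<circ> chart_inv c"

definition is_chart :: "'m topology \<Rightarrow> ('m, 'n::finite) chart \<Rightarrow> bool" where
  "is_chart X c \<longleftrightarrow> openin X (fst c) \<and> open (snd c ` fst c) \<and>
     homeomorphic_map (subtopology X (fst c)) (top_of_set (snd c ` fst c)) (snd c)"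

definition smooth_manifold :: "'m topology \<Rightarrow> ('m, 'n::finite) chart set \<Rightarrow> bool" where
  "smooth_manifold X A \<longleftrightarrow> Hausdorff_space X \<and> (\<forall>c\<in>A. is_chart X c) \<and>
     (\<Union>c\<in>A. fst c) = topspace X \<and>
     (\<forall>c\<in>A. \<forall>d\<in>A. \<forall>i. smooth_on (snd c ` (fst c \<inter> fst d)) (\<lambda>y. transition c d y $ i))"

text \<open>The Hausdorff property is part of \<open>smooth_manifold\<close>.\<close>

definition paracompact_space :: "'m topology \<Rightarrow> bool" where
  "paracompact_space X \<longleftrightarrow>
     (\<forall>\<C>. (\<forall>C\<in>\<C>. openin X C) \<and> \<Union>\<C> = topspace X \<longrightarrow>
       (\<exists>\<D>. (\<forall>D\<in>\<D>. openin X D \<and> (\<exists>C\<in>\<C>. D \<subseteq> C)) \<and> \<Union>\<D> = topspace X \<and>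
         locally_finite_in X \<D>))"


section \<open>Tangent spaces\<close>

text \<open>
  A tangent vector at \<open>x\<close> is the family of its coordinate vectors in all charts of the atlas
  around \<open>x\<close>, related by the derivatives of the transition maps; the value at all other charts is 0.
\<close>

type_synonym ('m, 'n) tvec = "('m, 'n) chart \<Rightarrow> real ^ 'n"

definition charts_at :: "('m, 'n) chart set \<Rightarrow> 'm \<Rightarrow> ('m, 'n) chart set" where
  "charts_at A x = {c \<in> A. x \<in> fst c}"

definition tangent_space :: "('m, 'n::finite) chart set \<Rightarrow> 'm \<Rightarrow> ('m, 'n) tvec set" where
  "tangent_space A x = {v. (\<forall>c. c \<notin> charts_at A x \<longrightarrow> v c = 0) \<and>
     (\<forall>c\<in>charts_at A x. \<forall>d\<in>charts_at A x.
        v d = frechet_derivative (transition c d) (at (snd c x)) (v c))}"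

text \<open>The coordinate vector \<open>\<partial>/\<partial>x\<^sup>j\<close> at \<open>x\<close> of the chart \<open>c\<close>.\<close>

definition coord_vec :: "('m, 'n::finite) chart set \<Rightarrow> ('m, 'n) chart \<Rightarrow> 'm \<Rightarrow> 'n \<Rightarrow> ('m, 'n) tvec" where
  "coord_vec A c x j = (\<lambda>d. if d \<in> charts_at A x
     then frechet_derivative (transition c d) (at (snd c x)) (axis j 1) else 0)"

definition lincomb :: "real \<Rightarrow> ('a \<Rightarrow> 'b::real_vector) \<Rightarrow> real \<Rightarrow> ('a \<Rightarrow> 'b) \<Rightarrow> 'a \<Rightarrow> 'b" where
  "lincomb a v b w = (\<lambda>t. a *\<^sub>R v t + b *\<^sub>R w t)"

text \<open>
  \<open>b 1, \<dots>, b n\<close> is a basis of the linear subspace \<open>T\<close> of a function space. The coefficient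
  function is required to vanish off \<open>{1..n}\<close> only to make it unique.
\<close>

definition is_basis :: "('a \<Rightarrow> 'b::real_vector) set \<Rightarrow> nat \<Rightarrow> (nat \<Rightarrow> 'a \<Rightarrow> 'b) \<Rightarrow> bool" where
  "is_basis T n b \<longleftrightarrow> (\<forall>i\<in>{1..n}. b i \<in> T) \<and>
     (\<forall>v\<in>T. \<exists>!a :: nat \<Rightarrow> real. (\<forall>i. i \<notin> {1..n} \<longrightarrow> a i = 0) \<and> v = (\<lambda>t. \<Sum>i=1..n. a i *\<^sub>R b i t))"


section \<open>Pseudo-Riemannian metrics\<close>

type_synonym ('m, 'n) metric = "'m \<Rightarrow> ('m, 'n) tvec \<Rightarrow> ('m, 'n) tvec \<Rightarrow> real"

definition eta :: "nat \<Rightarrow> nat \<Rightarrow> nat \<Rightarrow> real" where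
  "eta p i j = (if i \<noteq> j then 0 else if i \<le> p then 1 else -1)"

definition pseudo_riemannian_metric ::
    "('m, 'n::finite) chart set \<Rightarrow> ('m, 'n) metric \<Rightarrow> 'm set \<Rightarrow> nat \<Rightarrow> nat \<Rightarrow> bool" where
  "pseudo_riemannian_metric A g M p q \<longleftrightarrow> p + q = CARD('n) \<and>
     (\<forall>x\<in>M. let T = tangent_space A x in
        (\<forall>v\<in>T. \<forall>w\<in>T. g x v w = g x w v) \<and>
        (\<forall>u\<in>T. \<forall>v\<in>T. \<forall>w\<in>T. \<forall>a b. g x (lincomb a u b v) w = a * g x u w + b * g x v w) \<and>
        (\<forall>v\<in>T. (\<forall>w\<in>T. g x v w = 0) \<longrightarrow> v = (\<lambda>_. 0)) \<and>
        (\<exists>b. is_basis T (p + q) b \<and>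
           (\<forall>i\<in>{1..p + q}. \<forall>j\<in>{1..p + q}. g x (b i) (b j) = eta p i j))) \<and>
     (\<forall>c\<in>A. \<forall>i j. smooth_on (snd c ` fst c)
        (\<lambda>y. let x = chart_inv c y in g x (coord_vec A c x i) (coord_vec A c x j)))"

definition pseudo_riemannian_manifold ::
    "'m topology \<Rightarrow> ('m, 'n::finite) chart set \<Rightarrow> ('m, 'n) metric \<Rightarrow> nat \<Rightarrow> nat \<Rightarrow> bool" where
  "pseudo_riemannian_manifold X A g p q \<longleftrightarrow>
     smooth_manifold X A \<and> pseudo_riemannian_metric A g (topspace X) p q"


section \<open>Differential forms\<close>

text \<open>
  An element of the exterior algebra of the dual of a vector space \<open>T\<close>, not necessarily homogeneous,
  is a function on lists of vectors: its degree-\<open>k\<close> component is its restriction to lists of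
  length \<open>k\<close>, an alternating multilinear form. Outside of \<open>T\<close> the function is 0. Likewise a
  differential form on \<open>U\<close> is 0 at points outside of \<open>U\<close>.
\<close>

definition exterior :: "('a \<Rightarrow> 'b::real_vector) set \<Rightarrow> (('a \<Rightarrow> 'b) list \<Rightarrow> real) set" where
  "exterior T = {\<alpha>.
     (\<forall>vs. \<not> set vs \<subseteq> T \<longrightarrow> \<alpha> vs = 0) \<and>
     (\<forall>vs i. set vs \<subseteq> T \<longrightarrow> i < length vs \<longrightarrow> (\<forall>v\<in>T. \<forall>w\<in>T. \<forall>a b.
        \<alpha> (vs[i := lincomb a v b w]) = a * \<alpha> (vs[i := v]) + b * \<alpha> (vs[i := w]))) \<and>
     (\<forall>vs. set vs \<subseteq> T \<longrightarrow> \<not> distinct vs \<longrightarrow> \<alpha> vs = 0)}"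

type_synonym ('m, 'n) form = "'m \<Rightarrow> ('m, 'n) tvec list \<Rightarrow> real"

text \<open>Smooth sections over \<open>U\<close> of the exterior bundle: all components in charts are smooth.\<close>

definition forms :: "('m, 'n::finite) chart set \<Rightarrow> 'm set \<Rightarrow> ('m, 'n) form set" where
  "forms A U = {f.
     (\<forall>x. x \<notin> U \<longrightarrow> f x = (\<lambda>_. 0)) \<and>
     (\<forall>x\<in>U. f x \<in> exterior (tangent_space A x)) \<and>
     (\<forall>c\<in>A. \<forall>js. smooth_on (snd c ` (fst c \<inter> U))
        (\<lambda>y. let x = chart_inv c y in f x (map (coord_vec A c x) js)))}"

definition degree_part :: "nat \<Rightarrow> ('m, 'n) form \<Rightarrow> ('m, 'n) form" where
  "degree_part k f = (\<lambda>x vs. if length vs = k then f x vs else 0)"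

text \<open>
  The sign of the shuffle of \<open>{..<k}\<close> which moves \<open>S\<close> to the front. With the normalisation below,
  \<open>e\<^sup>1 \<and> \<dots> \<and> e\<^sup>n\<close> applied to \<open>v\<^sub>1, \<dots>, v\<^sub>n\<close> is the determinant of the matrix
  \<open>e\<^sup>i(v\<^sub>j)\<close>.
\<close>

definition shuffle_sign :: "nat \<Rightarrow> nat set \<Rightarrow> real" where
  "shuffle_sign k S = (-1) ^ card {(i, j). i < j \<and> j < k \<and> i \<notin> S \<and> j \<in> S}"

definition wedge :: "('m, 'n) form \<Rightarrow> ('m, 'n) form \<Rightarrow> ('m, 'n) form" where
  "wedge f1 f2 = (\<lambda>x vs. \<Sum>S\<in>Pow {..<length vs}.
     shuffle_sign (length vs) S * f1 x (nths vs S) * f2 x (nths vs (- S)))"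

definition unit_form :: "'m set \<Rightarrow> ('m, 'n) form" where
  "unit_form U = (\<lambda>x vs. if x \<in> U \<and> vs = [] then 1 else 0)"

definition contraction :: "('m \<Rightarrow> ('m, 'n) tvec) \<Rightarrow> ('m, 'n) form \<Rightarrow> ('m, 'n) form" where
  "contraction E f = (\<lambda>x vs. f x (E x # vs))"

text \<open>
  The defining properties of the contraction: it lowers degrees by one (and so vanishes on 0-forms),
  and it is a graded derivation of the wedge product. Its value on coframe elements is computed
  after the definition of the dual frame.
\<close>

lemma contraction_degree:
  "contraction E (degree_part (Suc k) f) = degree_part k (contraction E f)"
  "contraction E (degree_part 0 f) = (\<lambda>_ _. 0)"
  by (auto simp: contraction_def degree_part_def fun_eq_iff)

lemma sum_Pow_lessThan_Suc:
  fixes h :: "nat set \<Rightarrow> real"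
  shows "sum h (Pow {..<Suc k}) = (\<Sum>S\<in>Pow {..<k}. h (insert 0 (Suc ` S))) + (\<Sum>S\<in>Pow {..<k}. h (Suc ` S))"
proof -
  let ?P = "image Suc ` Pow {..<k}"
  have P: "Pow (Suc ` {..<k}) = ?P"
    by (simp add: image_Pow_surj)
  have eq: "Pow {..<Suc k} = insert 0 ` ?P \<union> ?P"
    by (simp only: lessThan_Suc_eq_insert_0 Pow_insert P Un_commute)
  have inj: "inj_on (image Suc) (Pow {..<k})"
    by (simp add: inj_on_image)
  have inj0: "inj_on (insert 0) ?P"
  proof (rule inj_onI)
    fix S T :: "nat set"
    assume a: "S \<in> ?P" "T \<in> ?P" "insert 0 S = insert 0 T"
    have "0 \<notin> S" "0 \<notin> T" using a(1,2) by auto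
    with a(3) show "S = T" by (metis Diff_insert_absorb)
  qed
  have "sum h (Pow {..<Suc k}) = sum h (insert 0 ` ?P) + sum h ?P"
    unfolding eq by (rule sum.union_disjoint) auto
  also have "sum h (insert 0 ` ?P) = (\<Sum>S\<in>?P. h (insert 0 S))"
    by (simp add: sum.reindex[OF inj0])
  also have "\<dots> = (\<Sum>S\<in>Pow {..<k}. h (insert 0 (Suc ` S)))"
    by (simp add: sum.reindex[OF inj])
  also have "sum h ?P = (\<Sum>S\<in>Pow {..<k}. h (Suc ` S))"
    by (simp add: sum.reindex[OF inj])
  finally show ?thesis .
qed

lemma shuffle_sign_insert_0: "shuffle_sign (Suc k) (insert 0 (Suc ` S)) = shuffle_sign k S"
proof -
  have "{(i, j). i < j \<and> j < Suc k \<and> i \<notin> insert 0 (Suc ` S) \<and> j \<in> insert 0 (Suc ` S)} =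
      map_prod Suc Suc ` {(i, j). i < j \<and> j < k \<and> i \<notin> S \<and> j \<in> S}" (is "?L = ?R")
  proof
    show "?L \<subseteq> ?R"
    proof
      fix z assume "z \<in> ?L"
      then obtain i j where z: "z = (i, j)" "i < j" "j < Suc k"
        "i \<notin> insert 0 (Suc ` S)" "j \<in> insert 0 (Suc ` S)" by auto
      then obtain i' j' where "i = Suc i'" "j = Suc j'"
        by (metis gr0_implies_Suc insertCI less_nat_zero_code not_gr_zero)
      with z show "z \<in> ?R" by (auto intro!: image_eqI[of _ _ "(i', j')"])
    qed
  qed auto
  moreover have "inj_on (map_prod Suc Suc) B" for B by (auto simp: inj_on_def)
  ultimately show ?thesis by (simp add: shuffle_sign_def card_image)
qed

lemma shuffle_sign_Suc:
  assumes "S \<subseteq> {..<k}"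
  shows "shuffle_sign (Suc k) (Suc ` S) = (-1) ^ card S * shuffle_sign k S"
proof -
  let ?B = "{(i, j). i < j \<and> j < k \<and> i \<notin> S \<and> j \<in> S}"
  have fin: "finite S" using assms finite_subset by blast
  have "?B \<subseteq> {..<k} \<times> {..<k}" by auto
  then have finB: "finite ?B" by (rule finite_subset) auto
  have "{(i, j). i < j \<and> j < Suc k \<and> i \<notin> Suc ` S \<and> j \<in> Suc ` S} =
      (\<lambda>j. (0, Suc j)) ` S \<union> map_prod Suc Suc ` ?B" (is "?L = ?R")
  proof
    show "?L \<subseteq> ?R"
    proof
      fix z assume "z \<in> ?L"
      then obtain i j where z: "z = (i, Suc j)" "i < Suc j" "j < k" "i \<notin> Suc ` S" "j \<in> S" by auto
      then show "z \<in> ?R" by (cases i) (auto intro!: image_eqI[of _ "map_prod Suc Suc" "(i - 1, j)"])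
    qed
    show "?R \<subseteq> ?L" using assms by auto
  qed
  moreover have "card ?R = card ((\<lambda>j. (0::nat, Suc j)) ` S) + card (map_prod Suc Suc ` ?B)"
    by (rule card_Un_disjoint) (use fin finB in auto)
  moreover have "card ((\<lambda>j. (0::nat, Suc j)) ` S) = card S"
    by (rule card_image) (auto simp: inj_on_def)
  moreover have "card (map_prod Suc Suc ` ?B) = card ?B"
    by (rule card_image) (auto simp: inj_on_def)
  ultimately show ?thesis by (simp add: shuffle_sign_def power_add)
qed

lemma length_nths_eq_card:
  assumes "S \<subseteq> {..<length vs}" shows "length (nths vs S) = card S"
proof -
  have "{i. i < length vs \<and> i \<in> S} = S" using assms by auto
  then show ?thesis by (simp add: length_nths)
qed

lemma contraction_wedge:
  fixes f1 f2 :: "('m, 'n) form"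
  shows "contraction E (wedge (degree_part r f1) f2) =
     (\<lambda>x vs. wedge (contraction E (degree_part r f1)) f2 x vs
        + (-1) ^ r * wedge (degree_part r f1) (contraction E f2) x vs)"
proof (intro ext)
  fix x :: 'm and vs :: "('m, 'n) tvec list"
  let ?f = "degree_part r f1" and ?k = "length vs"
  define h where "h S = shuffle_sign (Suc ?k) S * ?f x (nths (E x # vs) S) * f2 x (nths (E x # vs) (- S))" for S
  have "contraction E (wedge ?f f2) x vs = sum h (Pow {..<Suc ?k})"
    by (simp add: contraction_def wedge_def h_def)
  also have "\<dots> = (\<Sum>S\<in>Pow {..<?k}. h (insert 0 (Suc ` S))) + (\<Sum>S\<in>Pow {..<?k}. h (Suc ` S))"
    by (rule sum_Pow_lessThan_Suc)
  also have "(\<Sum>S\<in>Pow {..<?k}. h (insert 0 (Suc ` S))) = wedge (contraction E ?f) f2 x vs"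
  proof -
    have "{j. Suc j \<in> insert 0 (Suc ` S)} = S" "{j. Suc j \<in> - insert 0 (Suc ` S)} = - S" for S
      by auto
    then show ?thesis
      unfolding wedge_def h_def shuffle_sign_insert_0 contraction_def by (simp add: nths_Cons)
  qed
  also have "(\<Sum>S\<in>Pow {..<?k}. h (Suc ` S)) = (-1) ^ r * wedge ?f (contraction E f2) x vs"
  proof -
    have "h (Suc ` S) = (-1) ^ r * (shuffle_sign ?k S * ?f x (nths vs S) * contraction E f2 x (nths vs (- S)))"
      if "S \<in> Pow {..<?k}" for S
    proof -
      have "{j. Suc j \<in> Suc ` S} = S" "{j. Suc j \<in> - (Suc ` S)} = - S" by auto
      then have "h (Suc ` S) = (-1) ^ card S * shuffle_sign ?k S * ?f x (nths vs S) * contraction E f2 x (nths vs (- S))"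
        using that unfolding h_def contraction_def by (simp add: nths_Cons shuffle_sign_Suc image_iff)
      moreover have "?f x (nths vs S) = 0" if "card S \<noteq> r"
        using \<open>S \<in> Pow {..<?k}\<close> that by (simp add: degree_part_def length_nths_eq_card)
      ultimately show ?thesis by (cases "card S = r") simp_all
    qed
    then show ?thesis by (simp add: wedge_def sum_distrib_left)
  qed
  finally show "contraction E (wedge ?f f2) x vs =
    wedge (contraction E ?f) f2 x vs + (-1) ^ r * wedge ?f (contraction E f2) x vs" .
qed


section \<open>Orthonormal coframes and the induced metric\<close>

definition cotangent_space :: "('m, 'n::finite) chart set \<Rightarrow> 'm \<Rightarrow> (('m, 'n) tvec list \<Rightarrow> real) set" where
  "cotangent_space A x = {\<alpha> \<in> exterior (tangent_space A x). \<forall>vs. length vs \<noteq> 1 \<longrightarrow> \<alpha> vs = 0}"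

definition sharp ::
    "('m, 'n::finite) chart set \<Rightarrow> ('m, 'n) metric \<Rightarrow> 'm \<Rightarrow> (('m, 'n) tvec list \<Rightarrow> real) \<Rightarrow> ('m, 'n) tvec" where
  "sharp A g x \<alpha> =
     (THE v. v \<in> tangent_space A x \<and> (\<forall>w\<in>tangent_space A x. g x v w = \<alpha> [w]))"

definition cometric :: "('m, 'n::finite) chart set \<Rightarrow> ('m, 'n) metric \<Rightarrow> 'm \<Rightarrow>
    (('m, 'n) tvec list \<Rightarrow> real) \<Rightarrow> (('m, 'n) tvec list \<Rightarrow> real) \<Rightarrow> real" where
  "cometric A g x \<alpha> \<beta> = g x (sharp A g x \<alpha>) (sharp A g x \<beta>)"

text \<open>Frames and coframes are indexed by \<open>{1..n}\<close>; other indices are irrelevant.\<close>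

definition coframe :: "('m, 'n::finite) chart set \<Rightarrow> 'm set \<Rightarrow> (nat \<Rightarrow> ('m, 'n) form) \<Rightarrow> bool" where
  "coframe A U e \<longleftrightarrow> (\<forall>i\<in>{1..CARD('n)}. e i \<in> forms A U) \<and>
     (\<forall>x\<in>U. is_basis (cotangent_space A x) CARD('n) (\<lambda>i. e i x))"

definition orthonormal_coframe ::
    "('m, 'n::finite) chart set \<Rightarrow> ('m, 'n) metric \<Rightarrow> nat \<Rightarrow> 'm set \<Rightarrow> (nat \<Rightarrow> ('m, 'n) form) \<Rightarrow> bool" where
  "orthonormal_coframe A g p U e \<longleftrightarrow> coframe A U e \<and>
     (\<forall>x\<in>U. \<forall>i\<in>{1..CARD('n)}. \<forall>j\<in>{1..CARD('n)}. cometric A g x (e i x) (e j x) = eta p i j)"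

definition dual_frame ::
    "('m, 'n::finite) chart set \<Rightarrow> (nat \<Rightarrow> ('m, 'n) form) \<Rightarrow> nat \<Rightarrow> 'm \<Rightarrow> ('m, 'n) tvec" where
  "dual_frame A e i x = (THE v. v \<in> tangent_space A x \<and>
     (\<forall>j\<in>{1..CARD('n)}. e j x [v] = (if i = j then 1 else 0)))"

lemma contraction_coframe:
  fixes e :: "nat \<Rightarrow> ('m, 'n::finite) form"
  assumes e: "coframe A U e" "j \<in> {1..CARD('n)}"
    and dual: "\<And>x. x \<in> U \<Longrightarrow> e j x [dual_frame A e i x] = (if i = j then 1 else 0)"
  shows "contraction (dual_frame A e i) (e j) = (\<lambda>x vs. (if i = j then 1 else 0) * unit_form U x vs)"
proof (intro ext)
  fix x :: 'm and vs :: "('m, 'n) tvec list"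
  show "contraction (dual_frame A e i) (e j) x vs = (if i = j then 1 else 0) * unit_form U x vs"
  proof (cases "x \<in> U")
    case True
    then have "e j x \<in> cotangent_space A x"
      using e unfolding coframe_def is_basis_def by blast
    then show ?thesis
      using dual[OF True] True by (cases vs) (auto simp: contraction_def unit_form_def cotangent_space_def)
  next
    case False
    then have "e j x = (\<lambda>_. 0)" using e unfolding coframe_def forms_def by blast
    then show ?thesis using False by (simp add: contraction_def unit_form_def)
  qed
qed


section \<open>The Graf product and its truncation\<close>

primrec contracted_wedge :: "('m, 'n::finite) chart set \<Rightarrow> ('m, 'n) metric \<Rightarrow> (nat \<Rightarrow> ('m, 'n) form) \<Rightarrow>
    nat \<Rightarrow> ('m, 'n) form \<Rightarrow> ('m, 'n) form \<Rightarrow> ('m, 'n) form" where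
  "contracted_wedge A g e 0 = wedge"
| "contracted_wedge A g e (Suc l) = (\<lambda>f1 f2 x vs. \<Sum>i=1..CARD('n). \<Sum>j=1..CARD('n).
     cometric A g x (e i x) (e j x) *
     contracted_wedge A g e l (contraction (dual_frame A e i) f1) (contraction (dual_frame A e j) f2) x vs)"

text \<open>The product of a form \<open>f1\<close> of degree \<open>r\<close> and a form \<open>f2\<close> of degree \<open>s\<close>.\<close>

definition graf_homogeneous :: "('m, 'n::finite) chart set \<Rightarrow> ('m, 'n) metric \<Rightarrow> (nat \<Rightarrow> ('m, 'n) form) \<Rightarrow>
    nat \<Rightarrow> nat \<Rightarrow> ('m, 'n) form \<Rightarrow> ('m, 'n) form \<Rightarrow> ('m, 'n) form" where
  "graf_homogeneous A g e r s f1 f2 = (\<lambda>x vs.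
     if r \<le> s then
       (\<Sum>l=0..r. (-1) ^ (l * (r - l) + l div 2) / fact l * contracted_wedge A g e l f1 f2 x vs)
     else
       (-1) ^ (s * r) *
       (\<Sum>l=0..s. (-1) ^ (l * (s - l + 1) + l div 2) / fact l * contracted_wedge A g e l f2 f1 x vs))"

definition graf :: "('m, 'n::finite) chart set \<Rightarrow> ('m, 'n) metric \<Rightarrow> (nat \<Rightarrow> ('m, 'n) form) \<Rightarrow>
    ('m, 'n) form \<Rightarrow> ('m, 'n) form \<Rightarrow> ('m, 'n) form" where
  "graf A g e f1 f2 = (\<lambda>x vs. \<Sum>r=0..CARD('n). \<Sum>s=0..CARD('n).
     graf_homogeneous A g e r s (degree_part r f1) (degree_part s f2) x vs)"

definition volume :: "'m set \<Rightarrow> (nat \<Rightarrow> ('m, 'n::finite) form) \<Rightarrow> ('m, 'n) form" where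
  "volume U e = foldr wedge (map e [1..<Suc CARD('n)]) (unit_form U)"

text \<open>In the following, \<open>\<epsilon> = 1\<close> and \<open>\<epsilon> = -1\<close> give the two choices of sign.\<close>

definition p_sgn :: "'m set \<Rightarrow> (nat \<Rightarrow> ('m, 'n::finite) form) \<Rightarrow> real \<Rightarrow> ('m, 'n) form" where
  "p_sgn U e \<epsilon> = (\<lambda>x vs. 1/2 * (unit_form U x vs + \<epsilon> * volume U e x vs))"

definition P_sgn :: "('m, 'n::finite) chart set \<Rightarrow> ('m, 'n) metric \<Rightarrow> 'm set \<Rightarrow> (nat \<Rightarrow> ('m, 'n) form) \<Rightarrow>
    real \<Rightarrow> ('m, 'n) form \<Rightarrow> ('m, 'n) form" where
  "P_sgn A g U e \<epsilon> f = graf A g e f (p_sgn U e \<epsilon>)"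

definition P_low :: "('m, 'n::finite) form \<Rightarrow> ('m, 'n) form" where
  "P_low f = (\<lambda>x vs. if length vs \<le> CARD('n) div 2 then f x vs else 0)"

definition truncated_graf :: "('m, 'n::finite) chart set \<Rightarrow> ('m, 'n) metric \<Rightarrow> 'm set \<Rightarrow>
    (nat \<Rightarrow> ('m, 'n) form) \<Rightarrow> real \<Rightarrow> ('m, 'n) form \<Rightarrow> ('m, 'n) form \<Rightarrow> ('m, 'n) form" where
  "truncated_graf A g U e \<epsilon> f1 f2 =
     (\<lambda>x vs. 2 * P_low (graf A g e (P_sgn A g U e \<epsilon> f1) (P_sgn A g U e \<epsilon> f2)) x vs)"

definition Gamma_low :: "('m, 'n::finite) chart set \<Rightarrow> 'm set \<Rightarrow> ('m, 'n) form set" where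
  "Gamma_low A U = {f \<in> forms A U. \<forall>k > CARD('n) div 2. degree_part k f = (\<lambda>_ _. 0)}"

definition Gamma_sgn :: "('m, 'n::finite) chart set \<Rightarrow> ('m, 'n) metric \<Rightarrow> 'm set \<Rightarrow>
    (nat \<Rightarrow> ('m, 'n) form) \<Rightarrow> real \<Rightarrow> ('m, 'n) form set" where
  "Gamma_sgn A g U e \<epsilon> = P_sgn A g U e \<epsilon> ` forms A U"


section \<open>Algebras over the ring of smooth functions\<close>

definition smooth_functions :: "('m, 'n::finite) chart set \<Rightarrow> 'm set \<Rightarrow> ('m \<Rightarrow> real) ring" where
  "smooth_functions A U =
     \<lparr>carrier = {a. (\<forall>x. x \<notin> U \<longrightarrow> a x = 0) \<and>
                   (\<forall>c\<in>A. smooth_on (snd c ` (fst c \<inter> U)) (a \<circ> chart_inv c))},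
      mult = (\<lambda>a b x. a x * b x), one = (\<lambda>x. if x \<in> U then 1 else 0),
      zero = (\<lambda>x. 0), add = (\<lambda>a b x. a x + b x)\<rparr>"

definition form_algebra :: "('m, 'n) form set \<Rightarrow> (('m, 'n) form \<Rightarrow> ('m, 'n) form \<Rightarrow> ('m, 'n) form) \<Rightarrow>
    ('m, 'n) form \<Rightarrow> ('m \<Rightarrow> real, ('m, 'n) form) module" where
  "form_algebra C prd u =
     \<lparr>carrier = C, mult = prd, one = u, zero = (\<lambda>x vs. 0), add = (\<lambda>f h x vs. f x vs + h x vs),
      smult = (\<lambda>a f x vs. a x * f x vs)\<rparr>"

text \<open>The locale \<open>algebra\<close> of HOL-Algebra is restricted to commutative algebras.\<close>

definition assoc_algebra :: "('a, 'r) ring_scheme \<Rightarrow> ('a, 'b, 's) module_scheme \<Rightarrow> bool" where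
  "assoc_algebra R M \<longleftrightarrow> Module.module R M \<and> Ring.ring M \<and>
     (\<forall>a\<in>carrier R. \<forall>x\<in>carrier M. \<forall>y\<in>carrier M.
        (a \<odot>\<^bsub>M\<^esub> x) \<otimes>\<^bsub>M\<^esub> y = a \<odot>\<^bsub>M\<^esub> (x \<otimes>\<^bsub>M\<^esub> y) \<and>
        x \<otimes>\<^bsub>M\<^esub> (a \<odot>\<^bsub>M\<^esub> y) = a \<odot>\<^bsub>M\<^esub> (x \<otimes>\<^bsub>M\<^esub> y))"

definition algebra_isomorphic ::
    "('a, 'r) ring_scheme \<Rightarrow> ('a, 'b, 's) module_scheme \<Rightarrow> ('a, 'c, 't) module_scheme \<Rightarrow> bool" where
  "algebra_isomorphic R M N \<longleftrightarrow> assoc_algebra R M \<and> assoc_algebra R N \<and>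
     (\<exists>h \<in> ring_iso M N. \<forall>a\<in>carrier R. \<forall>x\<in>carrier M. h (a \<odot>\<^bsub>M\<^esub> x) = a \<odot>\<^bsub>N\<^esub> h x)"

text \<open>
  The unit of the truncated algebra is \<open>1\<^sub>\<Gamma>\<close>, that of the other one is the idempotent
  \<open>p\<^sub>\<plusminus>\<close>.
\<close>

definition truncated_algebra :: "('m, 'n::finite) chart set \<Rightarrow> ('m, 'n) metric \<Rightarrow> 'm set \<Rightarrow>
    (nat \<Rightarrow> ('m, 'n) form) \<Rightarrow> real \<Rightarrow> ('m \<Rightarrow> real, ('m, 'n) form) module" where
  "truncated_algebra A g U e \<epsilon> =
     form_algebra (Gamma_low A U) (truncated_graf A g U e \<epsilon>) (unit_form U)"

definition graf_sgn_algebra :: "('m, 'n::finite) chart set \<Rightarrow> ('m, 'n) metric \<Rightarrow> 'm set \<Rightarrow>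
    (nat \<Rightarrow> ('m, 'n) form) \<Rightarrow> real \<Rightarrow> ('m \<Rightarrow> real, ('m, 'n) form) module" where
  "graf_sgn_algebra A g U e \<epsilon> =
     form_algebra (Gamma_sgn A g U e \<epsilon>) (graf A g e) (p_sgn U e \<epsilon>)"

end

theory Submission
  imports Defs "HOL-Library.Function_Algebras"
begin

text \<open>
  The Graf product is the Clifford product of the cotangent bundle, written in the exterior algebra.
  In odd dimension the volume element is central, and for the given signatures it squares to the unit.
  Hence \<open>p\<^sub>\<plusminus>\<close> are central idempotents and \<open>P\<^sub>\<plusminus>\<close> are multiplicative projections onto \<open>\<Gamma>\<^sub>\<plusminus>\<close>.
  Multiplication by the volume element (the Hodge operator) maps degree \<open>k\<close> to degree \<open>n - k\<close>, so
  for odd \<open>n\<close> it exchanges the lower and the upper half of the degrees. An element of \<open>\<Gamma>\<^sub>\<plusminus>\<close>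
  is therefore determined by its lower half, and \<open>P\<^sub>\<plusminus>\<close> restricted to \<open>\<Gamma>\<^sub>L\<close> is a
  bijection onto \<open>\<Gamma>\<^sub>\<plusminus>\<close> with inverse \<open>2 P\<^sub>L\<close> (\<open>low_hproj\<close>, \<open>hproj_low\<close>). The
  truncated product is the Graf product transported along this bijection, so it is associative, with
  unit \<open>2 P\<^sub>L(p\<^sub>\<plusminus>) = 1\<^sub>\<Gamma>\<close>.

  The main work is to derive the laws of a Clifford product from the defining formula with contracted
  wedge products. This is done at a point, for functions on lists of vectors. After absorbing the sign
  \<open>(-1) ^ (l * (r - l) + l div 2)\<close> into grade involutions, the formula becomes
  \<open>(\<curlywedge>) \<circ> exp D\<close> with \<open>D = (\<Sum>i. \<eta> i *\<^sub>R ((grinv \<circ> \<iota> i) \<otimes> \<iota> i))\<close>, and the case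
  distinction between \<open>r \<le> s\<close> and \<open>r > s\<close> disappears (\<open>sum_graf_deg_eq_clifford\<close>). Commuting
  \<open>D\<close> with exterior multiplications and contractions gives
  \<open>(e\<^sup>i \<diamondop> f) \<diamondop> h = e\<^sup>i \<diamondop> (f \<diamondop> h)\<close> (\<open>th_clifford_assoc\<close>). As the coframe generates the
  algebra by Euler's formula (\<open>ext_induct\<close>), associativity and the centrality of the volume element
  need to be checked on generators only. The degree shift by the volume element comes from the fact
  that exterior multiplication and contraction are, up to a factor, the sum and the difference of left
  Clifford multiplication and of right Clifford multiplication twisted by the grade involution, which
  a central element of odd degree interchanges (\<open>th_shuf_clifford_vol\<close>).

  For smooth sections it remains to see that the operations preserve smoothness. The point is the
  smoothness of the dual frame, which follows from Cramer's rule (\<open>dual_frame_smooth\<close>).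
\<close>

section \<open>Function spaces as real vector spaces\<close>

text \<open>
  Tangent vectors and forms are functions. With the pointwise operations they become elements of a
  \<open>real_vector\<close>, which makes the library of linear maps and subspaces available for them.
\<close>

instantiation "fun" :: (type, real_vector) real_vector
begin
definition scaleR_fun_def: "scaleR r f = (\<lambda>x. r *\<^sub>R f x)"
instance by standard (simp_all add: fun_eq_iff scaleR_fun_def algebra_simps)
end

lemma scaleR_fun_apply [simp]: "(r *\<^sub>R f) x = r *\<^sub>R f x"
  by (simp add: scaleR_fun_def)

lemma sum_fun_apply: "(sum f I) x = (\<Sum>i\<in>I. f i x)"
  by (induction I rule: infinite_finite_induct) auto

lemma lincomb_eq: "lincomb a v b w = a *\<^sub>R v + b *\<^sub>R w"
  by (simp add: lincomb_def fun_eq_iff)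

section \<open>The signed shuffle product of functions on lists\<close>

definition contr :: "'v \<Rightarrow> ('v list \<Rightarrow> real) \<Rightarrow> 'v list \<Rightarrow> real" where
  "contr v f = (\<lambda>vs. f (v # vs))"

definition grinv :: "('v list \<Rightarrow> real) \<Rightarrow> 'v list \<Rightarrow> real" where
  "grinv f = (\<lambda>vs. (-1) ^ length vs * f vs)"

definition one_form :: "'v list \<Rightarrow> real" where
  "one_form vs = (if vs = [] then 1 else 0)"

definition homog :: "nat \<Rightarrow> ('v list \<Rightarrow> real) \<Rightarrow> bool" where
  "homog k f \<longleftrightarrow> (\<forall>vs. length vs \<noteq> k \<longrightarrow> f vs = 0)"

definition dpart :: "nat \<Rightarrow> ('v list \<Rightarrow> real) \<Rightarrow> 'v list \<Rightarrow> real" where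
  "dpart k f = (\<lambda>vs. if length vs = k then f vs else 0)"

text \<open>
  The wedge product at a point. The graded Leibniz rule for the contraction with the head of the
  list, read as a recursion, determines a product of arbitrary functions on lists. Algebraic laws of
  the wedge product then follow by induction on the list, without sums over shuffles.
\<close>

fun shuf :: "('v list \<Rightarrow> real) \<Rightarrow> ('v list \<Rightarrow> real) \<Rightarrow> 'v list \<Rightarrow> real" (infixr "\<curlywedge>" 72) where
  "(f \<curlywedge> h) [] = f [] * h []"
| "(f \<curlywedge> h) (v # vs) = (contr v f \<curlywedge> h) vs + (grinv f \<curlywedge> contr v h) vs"

lemma contr_apply: "contr v f vs = f (v # vs)" by (simp add: contr_def)

lemma linear_contr: "linear (contr v)"
  by (rule linearI) (simp_all add: contr_def fun_eq_iff)

lemma linear_grinv: "linear grinv"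
  by (rule linearI) (simp_all add: grinv_def fun_eq_iff algebra_simps)

lemma linear_dpart: "linear (dpart k)"
  by (rule linearI) (simp_all add: dpart_def fun_eq_iff)

lemmas contr_linear [simp] = linear_add[OF linear_contr] linear_diff[OF linear_contr] linear_cmul[OF linear_contr]
  linear_neg[OF linear_contr] linear_0[OF linear_contr] linear_sum[OF linear_contr]

lemmas grinv_linear [simp] = linear_add[OF linear_grinv] linear_diff[OF linear_grinv] linear_cmul[OF linear_grinv]
  linear_neg[OF linear_grinv] linear_0[OF linear_grinv] linear_sum[OF linear_grinv]

lemma grinv_grinv [simp]: "grinv (grinv f) = f"
  by (simp add: grinv_def fun_eq_iff flip: power_add mult.assoc)

lemma contr_grinv: "contr v (grinv f) = - grinv (contr v f)"
  by (simp add: grinv_def contr_def fun_eq_iff)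

lemma shuf_bilin:
  "((a *\<^sub>R f1 + b *\<^sub>R f2) \<curlywedge> h) vs = a * (f1 \<curlywedge> h) vs + b * (f2 \<curlywedge> h) vs"
  "(h \<curlywedge> (a *\<^sub>R f1 + b *\<^sub>R f2)) vs = a * (h \<curlywedge> f1) vs + b * (h \<curlywedge> f2) vs"
  by (induction vs arbitrary: f1 f2 h) (simp_all add: algebra_simps)

lemma bilinear_shuf: "bilinear (\<curlywedge>)"
proof -
  have 1: "(f1 + f2) \<curlywedge> h = f1 \<curlywedge> h + f2 \<curlywedge> h" "h \<curlywedge> (f1 + f2) = h \<curlywedge> f1 + h \<curlywedge> f2"
    for f1 f2 h :: "'a list \<Rightarrow> real"
    using shuf_bilin(1)[of 1 f1 1 f2 h] shuf_bilin(2)[of h 1 f1 1 f2] by (simp_all add: fun_eq_iff)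
  have 2: "(a *\<^sub>R f) \<curlywedge> h = a *\<^sub>R (f \<curlywedge> h)" "h \<curlywedge> (a *\<^sub>R f) = a *\<^sub>R (h \<curlywedge> f)"
    for a and f h :: "'a list \<Rightarrow> real"
    using shuf_bilin(1)[of a f 0 f h] shuf_bilin(2)[of h a f 0 f] by (simp_all add: fun_eq_iff)
  show ?thesis unfolding bilinear_def by (auto intro!: linearI simp: 1 2)
qed

lemma linear_shuf: "linear (\<lambda>f. f \<curlywedge> h)" "linear ((\<curlywedge>) f)"
  using bilinear_shuf by (auto simp: bilinear_def)

lemmas shuf_linear [simp] =
  linear_add[OF linear_shuf(1)] linear_diff[OF linear_shuf(1)] linear_cmul[OF linear_shuf(1)]
  linear_neg[OF linear_shuf(1)] linear_0[OF linear_shuf(1)] linear_sum[OF linear_shuf(1)]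
  linear_add[OF linear_shuf(2)] linear_diff[OF linear_shuf(2)] linear_cmul[OF linear_shuf(2)]
  linear_neg[OF linear_shuf(2)] linear_0[OF linear_shuf(2)] linear_sum[OF linear_shuf(2)]

lemma contr_shuf: "contr v (f \<curlywedge> h) = contr v f \<curlywedge> h + grinv f \<curlywedge> contr v h"
  by (simp add: fun_eq_iff contr_def)

lemma grinv_shuf: "grinv (f \<curlywedge> h) = grinv f \<curlywedge> grinv h"
proof
  fix vs show "grinv (f \<curlywedge> h) vs = (grinv f \<curlywedge> grinv h) vs"
  proof (induction vs arbitrary: f h)
    case Nil
    show ?case by (simp add: grinv_def)
  next
    case (Cons v vs)
    have "grinv (f \<curlywedge> h) (v # vs) = - grinv (contr v (f \<curlywedge> h)) vs"
      by (simp add: grinv_def contr_def)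
    also have "\<dots> = - (grinv (contr v f) \<curlywedge> grinv h) vs - (f \<curlywedge> grinv (contr v h)) vs"
      by (simp add: contr_shuf Cons)
    also have "\<dots> = (grinv f \<curlywedge> grinv h) (v # vs)"
      by (simp add: contr_grinv)
    finally show ?case .
  qed
qed

lemma shuf_assoc: "(f \<curlywedge> h) \<curlywedge> k = f \<curlywedge> (h \<curlywedge> k)"
proof
  fix vs show "((f \<curlywedge> h) \<curlywedge> k) vs = (f \<curlywedge> (h \<curlywedge> k)) vs"
    by (induction vs arbitrary: f h k) (simp_all add: contr_shuf grinv_shuf)
qed

lemma contr_one [simp]: "contr v one_form = 0"
  by (simp add: contr_def one_form_def fun_eq_iff)

lemma grinv_one [simp]: "grinv one_form = one_form"
  by (simp add: grinv_def one_form_def fun_eq_iff)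

lemma shuf_one [simp]: "one_form \<curlywedge> f = f" "f \<curlywedge> one_form = f"
proof -
  have "(one_form \<curlywedge> f) vs = f vs" "(f \<curlywedge> one_form) vs = f vs" for vs
    by (induction vs arbitrary: f) (simp_all add: one_form_def, simp_all add: contr_def)
  then show "one_form \<curlywedge> f = f" "f \<curlywedge> one_form = f" by auto
qed

lemma homog_contr: "homog (Suc k) f \<Longrightarrow> homog k (contr v f)"
  by (simp add: homog_def contr_def)

lemma homog_0_contr: "homog 0 f \<Longrightarrow> contr v f = 0"
  by (simp add: homog_def contr_def fun_eq_iff)

lemma homog_0_eq: "homog 0 f \<Longrightarrow> f = f [] *\<^sub>R one_form"
  by (auto simp: homog_def fun_eq_iff one_form_def)

lemma homog_grinv_eq: "homog k f \<Longrightarrow> grinv f = (-1) ^ k *\<^sub>R f"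
  by (auto simp: homog_def grinv_def fun_eq_iff)

lemma homog_zero [simp]: "homog k 0" by (simp add: homog_def)

lemma homog_one [simp]: "homog 0 one_form" by (simp add: homog_def one_form_def)

lemma homog_lin: "homog k f \<Longrightarrow> homog k h \<Longrightarrow> homog k (f + h)" "homog k f \<Longrightarrow> homog k (a *\<^sub>R f)"
  by (simp_all add: homog_def)

lemma homog_sum: "(\<And>i. i \<in> I \<Longrightarrow> homog k (f i)) \<Longrightarrow> homog k (sum f I)"
  by (induction I rule: infinite_finite_induct) (auto simp: homog_lin)

lemma homog_grinv: "homog k f \<Longrightarrow> homog k (grinv f)"
  by (simp add: homog_def grinv_def)

lemma homog_dpart [simp]: "homog k (dpart k f)"
  by (simp add: homog_def dpart_def)

lemma homog_shuf: "homog r f \<Longrightarrow> homog s h \<Longrightarrow> homog (r + s) (f \<curlywedge> h)"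
proof -
  have "(f \<curlywedge> h) vs = 0" if "homog r f" "homog s h" "length vs \<noteq> r + s" for vs
    using that
  proof (induction vs arbitrary: f h r s)
    case Nil
    then show ?case by (cases r; cases s) (auto simp: homog_def)
  next
    case (Cons v vs)
    have "(contr v f \<curlywedge> h) vs = 0"
      using Cons.prems Cons.IH[of "r - 1" "contr v f" s h]
      by (cases r) (simp_all add: homog_contr homog_0_contr)
    moreover have "(grinv f \<curlywedge> contr v h) vs = 0"
      using Cons.prems Cons.IH[of r "grinv f" "s - 1" "contr v h"]
      by (cases s) (simp_all add: homog_contr homog_0_contr homog_grinv)
    ultimately show ?case by simp
  qed
  then show "homog r f \<Longrightarrow> homog s h \<Longrightarrow> homog (r + s) (f \<curlywedge> h)" by (simp add: homog_def)
qed

text \<open>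
  Moving the sign through both terms of the Leibniz rule exchanges them: the term in which \<open>f\<close> is
  contracted becomes the one in which the second factor is contracted, and vice versa.
\<close>

lemma shuf_commute: "homog r f \<Longrightarrow> homog s h \<Longrightarrow> f \<curlywedge> h = (-1) ^ (r * s) *\<^sub>R (h \<curlywedge> f)"
proof -
  have "(f \<curlywedge> h) vs = (-1) ^ (r * s) * (h \<curlywedge> f) vs" if "homog r f" "homog s h" for vs
    using that
  proof (induction vs arbitrary: f h r s)
    case Nil
    show ?case
      using Nil by (cases r; cases s) (auto simp: homog_def)
  next
    case (Cons v vs)
    have 1: "(contr v f \<curlywedge> h) vs = (-1) ^ (r * s) * (grinv h \<curlywedge> contr v f) vs"
    proof (cases r)
      case 0
      then show ?thesis using Cons.prems by (simp add: homog_0_contr)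
    next
      case (Suc r')
      then have "(contr v f \<curlywedge> h) vs = (-1) ^ (r' * s) * (h \<curlywedge> contr v f) vs"
        using Cons.prems by (intro Cons.IH) (auto intro: homog_contr)
      then show ?thesis
        using Cons.prems(2) Suc by (simp add: homog_grinv_eq minus_one_power_iff)
    qed
    have 2: "(grinv f \<curlywedge> contr v h) vs = (-1) ^ (r * s) * (contr v h \<curlywedge> f) vs"
    proof (cases s)
      case 0
      then show ?thesis using Cons.prems by (simp add: homog_0_contr)
    next
      case (Suc s')
      then have "(f \<curlywedge> contr v h) vs = (-1) ^ (r * s') * (contr v h \<curlywedge> f) vs"
        using Cons.prems by (intro Cons.IH) (auto intro: homog_contr)
      then show ?thesis
        using Cons.prems(1) Suc by (simp add: homog_grinv_eq minus_one_power_iff)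
    qed
    show ?case by (simp add: 1 2 algebra_simps)
  qed
  then show "homog r f \<Longrightarrow> homog s h \<Longrightarrow> f \<curlywedge> h = (-1) ^ (r * s) *\<^sub>R (h \<curlywedge> f)" by (auto simp: fun_eq_iff)
qed

section \<open>The exterior algebra of a vector space\<close>

lemma exterior_outside: "f \<in> exterior V \<Longrightarrow> \<not> set vs \<subseteq> V \<Longrightarrow> f vs = 0"
  by (simp add: exterior_def)

lemma exterior_multilinear:
  "f \<in> exterior V \<Longrightarrow> set vs \<subseteq> V \<Longrightarrow> i < length vs \<Longrightarrow> v \<in> V \<Longrightarrow> w \<in> V \<Longrightarrow>
    f (vs[i := lincomb a v b w]) = a * f (vs[i := v]) + b * f (vs[i := w])"
  by (simp add: exterior_def)

lemma exterior_alternating: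
  "f \<in> exterior V \<Longrightarrow> \<not> distinct vs \<Longrightarrow> f vs = 0"
  by (cases "set vs \<subseteq> V") (simp_all add: exterior_def)

lemma exteriorI:
  assumes "\<And>vs. \<not> set vs \<subseteq> V \<Longrightarrow> f vs = 0"
    and "\<And>vs i v w a b. set vs \<subseteq> V \<Longrightarrow> i < length vs \<Longrightarrow> v \<in> V \<Longrightarrow> w \<in> V \<Longrightarrow>
      f (vs[i := lincomb a v b w]) = a * f (vs[i := v]) + b * f (vs[i := w])"
    and "\<And>vs. set vs \<subseteq> V \<Longrightarrow> \<not> distinct vs \<Longrightarrow> f vs = 0"
  shows "f \<in> exterior V"
  using assms by (simp add: exterior_def)

lemma subspace_exterior: "subspace (exterior V)"
  unfolding subspace_def by (auto simp: exterior_def algebra_simps)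

lemmas exterior_add [intro] = subspace_add[OF subspace_exterior]
lemmas exterior_scale [intro] = subspace_scale[OF subspace_exterior]
lemmas exterior_sum [intro] = subspace_sum[OF subspace_exterior]
lemmas exterior_0 [intro, simp] = subspace_0[OF subspace_exterior]

lemma exterior_contr [intro]: 
  assumes "f \<in> exterior V" shows "contr v f \<in> exterior V"
proof (cases "v \<in> V")
  case True
  show ?thesis
  proof (rule exteriorI)
    fix vs i u w and a b :: real
    assume "set vs \<subseteq> V" "i < length vs" "u \<in> V" "w \<in> V"
    then show "contr v f (vs[i := lincomb a u b w]) = a * contr v f (vs[i := u]) + b * contr v f (vs[i := w])"
      using exterior_multilinear[of f V "v # vs" "Suc i" u w a b] assms True by (simp add: contr_def)
  qed (use assms in \<open>auto simp: contr_def exterior_outside exterior_alternating\<close>)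
next
  case False
  then have "contr v f = 0" using assms by (auto simp: fun_eq_iff contr_def exterior_def)
  then show ?thesis by simp
qed

lemma exterior_contr_lin: 
  assumes "f \<in> exterior V" "v \<in> V" "w \<in> V" "subspace V"
  shows "contr (a *\<^sub>R v + b *\<^sub>R w) f = a *\<^sub>R contr v f + b *\<^sub>R contr w f"
proof
  fix vs
  have "a *\<^sub>R v + b *\<^sub>R w \<in> V" using assms by (simp add: subspace_add subspace_scale)
  show "contr (a *\<^sub>R v + b *\<^sub>R w) f vs = (a *\<^sub>R contr v f + b *\<^sub>R contr w f) vs"
  proof (cases "set vs \<subseteq> V")
    case True
    then show ?thesis
      using exterior_multilinear[of f V "v # vs" 0 v w a b] assms by (simp add: contr_def lincomb_eq)
  next
    case False
    then show ?thesis using assms(1) by (auto simp: contr_def exterior_def)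
  qed
qed

lemma exterior_contr_lincomb:
  assumes "f \<in> exterior V" "v \<in> V" "w \<in> V" "subspace V"
  shows "contr (lincomb a v b w) f = a *\<^sub>R contr v f + b *\<^sub>R contr w f"
  unfolding lincomb_eq using assms by (rule exterior_contr_lin)

lemma exterior_contr_sum:
  assumes "f \<in> exterior V" "subspace V" "\<And>i. i \<in> I \<Longrightarrow> v i \<in> V" "finite I"
  shows "contr (\<Sum>i\<in>I. a i *\<^sub>R v i) f = (\<Sum>i\<in>I. a i *\<^sub>R contr (v i) f)"
  using assms(4,3)
proof (induction I)
  case empty
  have "contr 0 f = 0"
    using exterior_contr_lin[OF assms(1), of 0 0 0 0] assms(2) by (simp add: subspace_0)
  then show ?case by (simp only: sum.empty)
next
  case (insert i I)
  have "(\<Sum>i\<in>I. a i *\<^sub>R v i) \<in> V" using insert assms(2) by (auto intro!: subspace_sum subspace_scale)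
  then have "contr (a i *\<^sub>R v i + 1 *\<^sub>R (\<Sum>i\<in>I. a i *\<^sub>R v i)) f =
      a i *\<^sub>R contr (v i) f + 1 *\<^sub>R contr (\<Sum>i\<in>I. a i *\<^sub>R v i) f"
    using insert assms(2) by (intro exterior_contr_lin[OF assms(1)]) auto
  also have "contr (\<Sum>i\<in>I. a i *\<^sub>R v i) f = (\<Sum>i\<in>I. a i *\<^sub>R contr (v i) f)"
    using insert by blast
  finally show ?case by (simp only: sum.insert[OF insert(1,2)] scaleR_one)
qed

lemma exterior_contr_sq [simp]: "f \<in> exterior V \<Longrightarrow> contr v (contr v f) = 0"
proof 
  fix vs assume f: "f \<in> exterior V"
  then show "contr v (contr v f) vs = 0 vs"
    by (simp add: contr_def exterior_alternating)
qed

text \<open>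
  Polarization of \<open>contr v (contr v f) = 0\<close> at \<open>v + w\<close>.
\<close>

lemma contr_anticommute:
  assumes "f \<in> exterior V" "subspace V" "v \<in> V" "w \<in> V"
  shows "contr v (contr w f) = - contr w (contr v f)"
proof -
  note L = exterior_contr_lin[OF _ assms(3,4,2), of _ 1 1, simplified]
  have "0 = contr (v + w) (contr (v + w) f)" by (simp add: exterior_contr_sq[OF assms(1)])
  also have "\<dots> = contr v (contr w f) + contr w (contr v f)"
    using assms(1) by (simp add: L exterior_contr exterior_contr_sq[OF assms(1)])
  finally show ?thesis by (simp add: eq_neg_iff_add_eq_0)
qed

lemma exterior_grinv [intro]: "f \<in> exterior V \<Longrightarrow> grinv f \<in> exterior V"
  unfolding exterior_def mem_Collect_eq by (simp add: grinv_def algebra_simps)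

lemma exterior_one [intro, simp]: "one_form \<in> exterior V"
  unfolding exterior_def mem_Collect_eq one_form_def by auto

lemma exterior_dpart [intro]: "f \<in> exterior V \<Longrightarrow> dpart k f \<in> exterior V"
  unfolding exterior_def mem_Collect_eq by (simp add: dpart_def)

text \<open>
  Vanishing outside of \<open>V\<close> and multilinearity are inherited along the recursion. For alternation,
  suppose that the head \<open>v\<close> of the list occurs again later. The Leibniz rule shows that contractions
  anticommute on \<open>f \<curlywedge> h\<close>, so \<open>v\<close> can be exchanged with its neighbour; the repetition is then in the
  tail, where the induction hypothesis applies to both Leibniz terms.
\<close>

lemma exterior_shuf [intro]:
  assumes V: "subspace V" and f: "f \<in> exterior V" and h: "h \<in> exterior V"
  shows "f \<curlywedge> h \<in> exterior V"
proof -
  have 1: "(f \<curlywedge> h) vs = 0" if "f \<in> exterior V" "h \<in> exterior V" "\<not> set vs \<subseteq> V" for vs f h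
    using that
  proof (induction vs arbitrary: f h)
    case (Cons v vs)
    show ?case
    proof (cases "v \<in> V")
      case True
      with Cons show ?thesis by (simp add: Cons.IH exterior_contr exterior_grinv)
    next
      case False
      then have "contr v f = 0" "contr v h = 0"
        using Cons.prems by (auto simp: contr_def fun_eq_iff exterior_def)
      then show ?thesis by simp
    qed
  qed simp
  have 2: "(f \<curlywedge> h) (vs[i := lincomb a v b w]) = a * (f \<curlywedge> h) (vs[i := v]) + b * (f \<curlywedge> h) (vs[i := w])"
    if "f \<in> exterior V" "h \<in> exterior V" "i < length vs" "v \<in> V" "w \<in> V" for vs i v w a b f h
    using that
  proof (induction vs arbitrary: f h i)
    case (Cons u us)
    show ?case
    proof (cases i)
      case 0
      then show ?thesis using Cons.prems V
        by (simp add: exterior_contr_lincomb[of _ V] algebra_simps)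
    next
      case (Suc j)
      then show ?thesis using Cons.prems by (simp add: Cons.IH exterior_contr exterior_grinv algebra_simps)
    qed
  qed simp
  have 3: "(f \<curlywedge> h) vs = 0" if "f \<in> exterior V" "h \<in> exterior V" "set vs \<subseteq> V" "\<not> distinct vs" for vs f h
    using that
  proof (induction "length vs" arbitrary: vs f h rule: less_induct)
    case less
    obtain v vs' where vs: "vs = v # vs'" using less.prems by (cases vs) auto
    show ?case
    proof (cases "distinct vs'")
      case False
      then show ?thesis using less vs by (simp add: exterior_contr exterior_grinv)
    next
      case True
      then have "v \<in> set vs'" using less vs by auto
      then obtain w us where vs': "vs' = w # us" by (cases vs') auto
      have vw: "v \<in> V" "w \<in> V" using less.prems vs vs' by auto
      have anti: "contr v (contr w (f \<curlywedge> h)) = - contr w (contr v (f \<curlywedge> h))"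
        by (simp add: contr_shuf contr_grinv contr_anticommute[OF _ V vw] less.prems grinv_shuf)
      show ?thesis
      proof (cases "w = v")
        case True
        have "contr v (contr v (f \<curlywedge> h)) = 0"
          using less.prems by (simp add: contr_shuf contr_grinv)
        then show ?thesis using vs vs' True by (simp add: contr_def fun_eq_iff del: shuf.simps)
      next
        case False
        have "(f \<curlywedge> h) vs = - contr w (f \<curlywedge> h) (v # us)"
          using anti by (simp add: contr_def fun_eq_iff vs vs' del: shuf.simps)
        also have "contr w (f \<curlywedge> h) (v # us) = (contr w f \<curlywedge> h) (v # us) + (grinv f \<curlywedge> contr w h) (v # us)"
          by (simp add: contr_shuf del: shuf.simps)
        also have "\<dots> = 0"
          using less.hyps[of "v # us"] less.prems vs vs' False \<open>v \<in> set vs'\<close>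
          by (simp add: exterior_contr exterior_grinv del: shuf.simps)
        finally show ?thesis by simp
      qed
    qed
  qed
  show ?thesis
    by (rule exteriorI) (simp_all add: 1 2 3 f h)
qed

section \<open>The Clifford product in a frame\<close>

lemma neg_one_power_cong: "even a = even b \<Longrightarrow> (-1::real) ^ a = (-1) ^ b"
  by (simp add: minus_one_power_iff)

text \<open>
  A frame \<open>E\<close> of \<open>V\<close> with dual coframe \<open>th\<close>. The numbers \<open>\<eta> i\<close> are the diagonal entries of a metric
  for which the frame is orthogonal.
\<close>

locale pseudo_frame =
  fixes V :: "('a \<Rightarrow> 'b::real_vector) set" and n :: nat
    and th :: "nat \<Rightarrow> ('a \<Rightarrow> 'b) list \<Rightarrow> real" and E :: "nat \<Rightarrow> 'a \<Rightarrow> 'b" and \<eta> :: "nat \<Rightarrow> real"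
  assumes V: "subspace V"
    and E_in: "\<And>i. i \<in> {1..n} \<Longrightarrow> E i \<in> V"
    and th_in: "\<And>i. i \<in> {1..n} \<Longrightarrow> th i \<in> exterior V"
    and th_homog: "\<And>i. i \<in> {1..n} \<Longrightarrow> homog 1 (th i)"
    and dual: "\<And>i j. i \<in> {1..n} \<Longrightarrow> j \<in> {1..n} \<Longrightarrow> th i [E j] = (if i = j then 1 else 0)"
    and expand: "\<And>v. v \<in> V \<Longrightarrow> v = (\<Sum>i=1..n. th i [v] *\<^sub>R E i)"
begin

abbreviation "\<Lambda> \<equiv> exterior V"
abbreviation "\<iota> i \<equiv> contr (E i)"

lemma ext_shuf: "f \<in> \<Lambda> \<Longrightarrow> h \<in> \<Lambda> \<Longrightarrow> f \<curlywedge> h \<in> \<Lambda>"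
  by (rule exterior_shuf[OF V])

lemma contr_th: "i \<in> {1..n} \<Longrightarrow> contr v (th i) = th i [v] *\<^sub>R one_form"
  using homog_0_eq[OF homog_contr[of 0 "th i" v]] th_homog by (simp add: contr_def)

lemma contr_E_th: "i \<in> {1..n} \<Longrightarrow> j \<in> {1..n} \<Longrightarrow> \<iota> j (th i) = (if i = j then one_form else 0)"
  by (simp add: contr_th dual)

lemma grinv_th: "i \<in> {1..n} \<Longrightarrow> grinv (th i) = - th i"
  using homog_grinv_eq[OF th_homog] by simp

lemma contr_th_shuf: "i \<in> {1..n} \<Longrightarrow> contr v (th i \<curlywedge> f) = th i [v] *\<^sub>R f - th i \<curlywedge> contr v f"
  by (simp add: contr_shuf contr_th grinv_th)

lemma contr_E_th_shuf:
  "i \<in> {1..n} \<Longrightarrow> j \<in> {1..n} \<Longrightarrow> \<iota> j (th i \<curlywedge> f) = (if i = j then f else 0) - th i \<curlywedge> \<iota> j f"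
  by (simp add: contr_th_shuf dual)

lemma contr_expand: "f \<in> \<Lambda> \<Longrightarrow> v \<in> V \<Longrightarrow> contr v f = (\<Sum>i=1..n. th i [v] *\<^sub>R \<iota> i f)"
  using exterior_contr_sum[of f V "{1..n}" E "\<lambda>i. th i [v]"] E_in V expand[of v] by simp

text \<open>
  Expanding the vectors one by one in the frame reduces to lists of frame vectors, among which there
  must be a repetition. The list is split into a part \<open>us\<close> that is already expanded and the rest
  \<open>vs\<close> to make the induction possible.
\<close>

lemma vanish_frame:
  assumes "f \<in> \<Lambda>" "set us \<subseteq> E ` {1..n}" "set vs \<subseteq> V" "length us + length vs > n"
  shows "f (us @ vs) = 0"
  using assms(2-4)
proof (induction vs arbitrary: us)
  case Nil
  have "card (set us) \<le> card (E ` {1..n})" using Nil by (intro card_mono) auto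
  also have "\<dots> \<le> n" using card_image_le[of "{1..n}" E] by simp
  finally have "\<not> distinct us" using Nil distinct_card[of us] by auto
  then show ?case using exterior_alternating[OF assms(1)] by simp
next
  case (Cons v vs)
  \<comment> \<open>\<open>F\<close> is \<open>f\<close> with the vectors \<open>us\<close> inserted, so that expanding \<open>v\<close> is a statement about its first slot.\<close>
  define F where "F = foldl (\<lambda>f u. contr u f) f us"
  have F_in: "foldl (\<lambda>f u. contr u f) f us \<in> \<Lambda>" if "f \<in> \<Lambda>" for f us
    using that by (induction us arbitrary: f) auto
  have F_app: "foldl (\<lambda>f u. contr u f) f us ws = f (us @ ws)" for f us ws
    by (induction us arbitrary: f) (auto simp: contr_def)
  have "f (us @ v # vs) = contr v F vs" by (simp add: F_def F_app contr_apply)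
  also have "\<dots> = (\<Sum>i=1..n. th i [v] * f ((us @ [E i]) @ vs))"
    using Cons.prems F_in[OF assms(1)]
    by (subst contr_expand) (auto simp: F_def sum_fun_apply F_app contr_apply)
  also have "\<dots> = 0"
    using Cons.prems by (intro sum.neutral ballI) (subst Cons.IH, auto)
  finally show ?case .
qed

lemma vanish: "f \<in> \<Lambda> \<Longrightarrow> length vs > n \<Longrightarrow> f vs = 0"
  using vanish_frame[of f "[]" vs] exterior_outside[of f V vs] by (cases "set vs \<subseteq> V") auto

lemma dpart_sum: "f \<in> \<Lambda> \<Longrightarrow> f = (\<Sum>k\<le>n. dpart k f)"
  by (auto simp: fun_eq_iff sum_fun_apply dpart_def vanish not_le)

lemma homog_large_zero: "f \<in> \<Lambda> \<Longrightarrow> homog k f \<Longrightarrow> k > n \<Longrightarrow> f = 0"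
  by (metis homog_def vanish ext zero_fun_apply)

text \<open>
  Contracting the number operator on the left with a vector gives one copy of the contracted form, by
  its expansion in the frame, plus the number operator applied to the contracted form. Hence each
  argument of \<open>f\<close> contributes one. The formula writes forms of positive degree through coframe
  elements and forms of lower degree.
\<close>

lemma euler:
  assumes "f \<in> \<Lambda>" "homog k f"
  shows "(\<Sum>i=1..n. th i \<curlywedge> \<iota> i f) = real k *\<^sub>R f"
proof
  fix vs show "(\<Sum>i=1..n. th i \<curlywedge> \<iota> i f) vs = (real k *\<^sub>R f) vs"
    using assms
  proof (induction vs arbitrary: f k)
    case Nil
    have "(th i \<curlywedge> \<iota> i f) [] = 0" if "i \<in> {1..n}" for i using th_homog[OF that] by (simp add: homog_def)
    then have "(\<Sum>i=1..n. th i \<curlywedge> \<iota> i f) [] = 0" unfolding sum_fun_apply by (intro sum.neutral ballI)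
    then show ?case using Nil by (cases k) (auto simp: homog_def)
  next
    case (Cons v vs)
    show ?case
    proof (cases "v \<in> V")
      case False
      have "f (v # vs) = 0" using Cons.prems False exterior_outside by fastforce
      moreover have "(th i \<curlywedge> \<iota> i f) (v # vs) = 0" if "i \<in> {1..n}" for i
        using exterior_outside[OF ext_shuf[OF th_in[OF that] exterior_contr[OF Cons.prems(1)]], of "v # vs"] False
        by (simp del: shuf.simps)
      ultimately show ?thesis by (simp add: sum_fun_apply del: shuf.simps)
    next
      case True
      have "(\<Sum>i=1..n. th i \<curlywedge> \<iota> i f) (v # vs) = contr v (\<Sum>i=1..n. th i \<curlywedge> \<iota> i f) vs"
        by (simp only: contr_def)
      also have "contr v (\<Sum>i=1..n. th i \<curlywedge> \<iota> i f)
          = (\<Sum>i=1..n. th i [v] *\<^sub>R \<iota> i f) + (\<Sum>i=1..n. th i \<curlywedge> \<iota> i (contr v f))"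
        by (simp add: contr_th_shuf contr_anticommute[OF Cons.prems(1) V True E_in] sum.distrib)
      also have "(\<Sum>i=1..n. th i [v] *\<^sub>R \<iota> i f) = contr v f"
        by (rule contr_expand[OF Cons.prems(1) True, symmetric])
      also have "(contr v f + (\<Sum>i=1..n. th i \<curlywedge> \<iota> i (contr v f))) vs = real k * f (v # vs)"
      proof (cases k)
        case 0
        then show ?thesis using Cons.prems by (simp add: homog_0_contr)
      next
        case (Suc k')
        have "(\<Sum>i=1..n. th i \<curlywedge> \<iota> i (contr v f)) vs = (real k' *\<^sub>R contr v f) vs"
          using Cons.prems Suc by (intro Cons.IH) (auto intro: homog_contr)
        then show ?thesis using Suc unfolding plus_fun_apply by (simp add: contr_apply algebra_simps)
      qed
      finally show ?thesis by simp
    qed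
  qed
qed

text \<open>
  The contracted wedge product with the sign of the Graf product distributed over the \<open>l\<close>
  contractions: each contraction of the first factor is followed by the grade involution. In this
  form the \<open>l\<close>-th product is \<open>(\<curlywedge>) \<circ> D ^^ l\<close> for the operator
  \<open>D = (\<Sum>i. \<eta> i *\<^sub>R ((grinv \<circ> \<iota> i) \<otimes> \<iota> i))\<close>, and \<open>clifford\<close> is
  \<open>(\<curlywedge>) \<circ> exp D\<close>; the exponential series stops at \<open>l = n\<close>.
\<close>

primrec scw :: "nat \<Rightarrow> (('a \<Rightarrow> 'b) list \<Rightarrow> real) \<Rightarrow> (('a \<Rightarrow> 'b) list \<Rightarrow> real) \<Rightarrow> ('a \<Rightarrow> 'b) list \<Rightarrow> real" where
  "scw 0 f h = f \<curlywedge> h"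
| "scw (Suc l) f h = (\<Sum>i=1..n. \<eta> i *\<^sub>R scw l (grinv (\<iota> i f)) (\<iota> i h))"

definition clifford :: "(('a \<Rightarrow> 'b) list \<Rightarrow> real) \<Rightarrow> (('a \<Rightarrow> 'b) list \<Rightarrow> real) \<Rightarrow> ('a \<Rightarrow> 'b) list \<Rightarrow> real" (infixr "\<diamondop>" 72) where
  "f \<diamondop> h = (\<Sum>l\<le>n. (1 / fact l) *\<^sub>R scw l f h)"

lemma linear_scw: "linear (\<lambda>f. scw l f h)" "linear (scw l f)"
proof -
  have "linear (\<lambda>f. scw l f h) \<and> linear (scw l f)" for f h
  proof (induction l arbitrary: f h)
    case 0
    show ?case by (simp add: linear_shuf)
  next
    case (Suc l)
    have "linear (\<lambda>f. \<eta> i *\<^sub>R scw l (grinv (\<iota> i f)) h)" for i h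
      using linear_compose_scale_right[OF linear_compose[OF linear_compose[OF linear_contr linear_grinv] conjunct1[OF Suc]]]
      by (simp add: o_def)
    moreover have "linear (\<lambda>h. \<eta> i *\<^sub>R scw l f (\<iota> i h))" for i f
      using linear_compose_scale_right[OF linear_compose[OF linear_contr conjunct2[OF Suc]]]
      by (simp add: o_def)
    moreover have "scw (Suc l) f = (\<lambda>h. \<Sum>i=1..n. \<eta> i *\<^sub>R scw l (grinv (\<iota> i f)) (\<iota> i h))" by auto
    ultimately show ?case by (auto intro!: linear_compose_sum)
  qed
  then show "linear (\<lambda>f. scw l f h)" "linear (scw l f)" by auto
qed

lemmas scw_linear [simp] =
  linear_add[OF linear_scw(1)] linear_diff[OF linear_scw(1)] linear_cmul[OF linear_scw(1)]
  linear_neg[OF linear_scw(1)] linear_0[OF linear_scw(1)] linear_sum[OF linear_scw(1)]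
  linear_add[OF linear_scw(2)] linear_diff[OF linear_scw(2)] linear_cmul[OF linear_scw(2)]
  linear_neg[OF linear_scw(2)] linear_0[OF linear_scw(2)] linear_sum[OF linear_scw(2)]

lemma linear_clifford: "linear (\<lambda>f. f \<diamondop> h)" "linear ((\<diamondop>) f)"
proof -
  have "(\<diamondop>) f = (\<lambda>h. \<Sum>l\<le>n. (1 / fact l) *\<^sub>R scw l f h)" by (auto simp: clifford_def)
  then show "linear (\<lambda>f. f \<diamondop> h)" "linear ((\<diamondop>) f)"
    unfolding clifford_def by (auto intro!: linear_compose_sum linear_compose_scale_right linear_scw)
qed

lemmas clifford_linear [simp] =
  linear_add[OF linear_clifford(1)] linear_diff[OF linear_clifford(1)] linear_cmul[OF linear_clifford(1)]
  linear_neg[OF linear_clifford(1)] linear_0[OF linear_clifford(1)] linear_sum[OF linear_clifford(1)]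
  linear_add[OF linear_clifford(2)] linear_diff[OF linear_clifford(2)] linear_cmul[OF linear_clifford(2)]
  linear_neg[OF linear_clifford(2)] linear_0[OF linear_clifford(2)] linear_sum[OF linear_clifford(2)]

lemma scw_in: "f \<in> \<Lambda> \<Longrightarrow> h \<in> \<Lambda> \<Longrightarrow> scw l f h \<in> \<Lambda>"
proof (induction l arbitrary: f h)
  case (Suc l)
  show "scw (Suc l) f h \<in> \<Lambda>"
    unfolding scw.simps using Suc
    by (intro exterior_sum exterior_scale Suc.IH exterior_grinv exterior_contr)
qed (simp add: ext_shuf)

lemma clifford_in [intro]: "f \<in> \<Lambda> \<Longrightarrow> h \<in> \<Lambda> \<Longrightarrow> f \<diamondop> h \<in> \<Lambda>"
  by (auto simp: clifford_def intro!: exterior_sum exterior_scale scw_in)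

lemma scw_vanish: "(\<And>vs. length vs \<ge> l \<Longrightarrow> h vs = 0) \<Longrightarrow> scw l f h = 0"
proof (induction l arbitrary: f h)
  case 0
  then have "h = 0" by (auto simp: fun_eq_iff)
  then show "scw 0 f h = 0" by simp
next
  case (Suc l)
  have "scw l (grinv (\<iota> i f)) (\<iota> i h) = 0" for i
    by (rule Suc.IH) (simp add: contr_def Suc.prems)
  then show ?case by simp
qed

lemma grinv_scw: "grinv (scw l f h) = scw l (grinv f) (grinv h)"
  by (induction l arbitrary: f h) (simp_all add: grinv_shuf contr_grinv)

lemma grinv_clifford: "grinv (f \<diamondop> h) = grinv f \<diamondop> grinv h"
  by (simp add: clifford_def grinv_scw)

text \<open>
  \<open>D\<close> commutes with \<open>th i \<curlywedge> _\<close> on the first factor up to the contribution of the contraction that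
  hits \<open>th i\<close>. As the summands of \<open>D\<close> commute with each other, each of the \<open>l\<close> factors of \<open>D ^^ l\<close>
  contributes the same term.
\<close>

lemma scw_th_shuf:
  assumes "i \<in> {1..n}" "f \<in> \<Lambda>" "h \<in> \<Lambda>"
  shows "scw l (th i \<curlywedge> f) h = th i \<curlywedge> scw l f h + (real l * \<eta> i) *\<^sub>R scw (l - 1) (grinv f) (\<iota> i h)"
  using assms(2,3)
proof (induction l arbitrary: f h)
  case 0
  show ?case by (simp add: shuf_assoc)
next
  case (Suc l)
  have *: "scw l (grinv (\<iota> j (th i \<curlywedge> f))) (\<iota> j h) =
      (if i = j then scw l (grinv f) (\<iota> i h) else 0) + th i \<curlywedge> scw l (grinv (\<iota> j f)) (\<iota> j h)
      + (real l * \<eta> i) *\<^sub>R scw (l - 1) (grinv (\<iota> j (grinv f))) (\<iota> j (\<iota> i h))" if j: "j \<in> {1..n}" for j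
  proof -
    have "grinv (\<iota> j (th i \<curlywedge> f)) = (if i = j then grinv f else 0) + th i \<curlywedge> grinv (\<iota> j f)"
      using j assms(1) by (simp add: contr_E_th_shuf grinv_shuf grinv_th)
    moreover have "scw l (th i \<curlywedge> grinv (\<iota> j f)) (\<iota> j h) = th i \<curlywedge> scw l (grinv (\<iota> j f)) (\<iota> j h)
        + (real l * \<eta> i) *\<^sub>R scw (l - 1) (grinv (grinv (\<iota> j f))) (\<iota> i (\<iota> j h))"
      using Suc.prems by (intro Suc.IH) auto
    moreover have "scw (l - 1) (grinv (grinv (\<iota> j f))) (\<iota> i (\<iota> j h)) = scw (l - 1) (grinv (\<iota> j (grinv f))) (\<iota> j (\<iota> i h))"
      using contr_anticommute[OF Suc.prems(2) V E_in E_in, of i j] j assms(1) by (simp add: contr_grinv)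
    ultimately show ?thesis by simp
  qed
  have "scw (Suc l) (th i \<curlywedge> f) h = (\<Sum>j=1..n. (if i = j then \<eta> i *\<^sub>R scw l (grinv f) (\<iota> i h) else 0)
      + th i \<curlywedge> (\<eta> j *\<^sub>R scw l (grinv (\<iota> j f)) (\<iota> j h))
      + (real l * \<eta> i) *\<^sub>R \<eta> j *\<^sub>R scw (l - 1) (grinv (\<iota> j (grinv f))) (\<iota> j (\<iota> i h)))"
    unfolding scw.simps by (rule sum.cong) (auto simp: * scaleR_add_right mult_ac)
  also have "\<dots> = \<eta> i *\<^sub>R scw l (grinv f) (\<iota> i h) + th i \<curlywedge> scw (Suc l) f h
      + (real l * \<eta> i) *\<^sub>R (\<Sum>j=1..n. \<eta> j *\<^sub>R scw (l - 1) (grinv (\<iota> j (grinv f))) (\<iota> j (\<iota> i h)))"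
    using assms(1) by (simp add: sum.distrib scaleR_sum_right)
  also have "(real l * \<eta> i) *\<^sub>R (\<Sum>j=1..n. \<eta> j *\<^sub>R scw (l - 1) (grinv (\<iota> j (grinv f))) (\<iota> j (\<iota> i h))) =
      (real l * \<eta> i) *\<^sub>R scw l (grinv f) (\<iota> i h)"
    by (cases l) simp_all
  finally show ?case by (simp add: algebra_simps scaleR_add_left)
qed

text \<open>
  Contractions anticommute with each other and with the grade involution. In each Leibniz term two
  signs cancel when the contraction is moved past a summand of \<open>D\<close>, so the derivation rule survives
  \<open>D ^^ l\<close>.
\<close>

lemma contr_scw:
  assumes "v \<in> V" "f \<in> \<Lambda>" "h \<in> \<Lambda>"
  shows "contr v (scw l f h) = scw l (contr v f) h + scw l (grinv f) (contr v h)"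
  using assms(2,3)
proof (induction l arbitrary: f h)
  case 0
  show ?case by (simp add: contr_shuf)
next
  case (Suc l)
  have "contr v (scw l (grinv (\<iota> i f)) (\<iota> i h)) =
      scw l (grinv (\<iota> i (contr v f))) (\<iota> i h) + scw l (grinv (\<iota> i (grinv f))) (\<iota> i (contr v h))" if i: "i \<in> {1..n}" for i
  proof -
    have "contr v (scw l (grinv (\<iota> i f)) (\<iota> i h)) =
      scw l (contr v (grinv (\<iota> i f))) (\<iota> i h) + scw l (grinv (grinv (\<iota> i f))) (contr v (\<iota> i h))"
      using Suc.prems by (intro Suc.IH) auto
    then show ?thesis
      using contr_anticommute[OF Suc.prems(1) V assms(1) E_in[OF i]]
        contr_anticommute[OF Suc.prems(2) V assms(1) E_in[OF i]] by (simp add: contr_grinv)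
  qed
  then show ?case by (simp add: scaleR_add_right sum.distrib)
qed

lemma contr_clifford:
  assumes "v \<in> V" "f \<in> \<Lambda>" "h \<in> \<Lambda>"
  shows "contr v (f \<diamondop> h) = contr v f \<diamondop> h + grinv f \<diamondop> contr v h"
  using assms by (simp add: clifford_def contr_scw scaleR_add_right sum.distrib)

text \<open>
  The sum over \<open>l\<close> of the preceding formula for \<open>scw\<close>. The factor \<open>l / fact l\<close> shifts the
  exponential series by one, and the top term that this loses vanishes for reasons of degree.
\<close>

lemma th_shuf_clifford:
  assumes "i \<in> {1..n}" "f \<in> \<Lambda>" "h \<in> \<Lambda>"
  shows "(th i \<curlywedge> f) \<diamondop> h = th i \<curlywedge> (f \<diamondop> h) + \<eta> i *\<^sub>R (grinv f \<diamondop> \<iota> i h)"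
proof -
  let ?g = "\<lambda>l. (1 / fact l) *\<^sub>R scw l (grinv f) (\<iota> i h)"
  have "(\<Sum>l\<le>n. (real l / fact l) *\<^sub>R scw (l - 1) (grinv f) (\<iota> i h)) = (\<Sum>l<n. ?g l)"
  proof -
    have "(\<Sum>l\<le>n. (real l / fact l) *\<^sub>R scw (l - 1) (grinv f) (\<iota> i h))
      = (\<Sum>l<n. (real (Suc l) / fact (Suc l)) *\<^sub>R scw l (grinv f) (\<iota> i h))"
      by (subst sum.atMost_shift) simp
    also have "\<dots> = (\<Sum>l<n. ?g l)" by (rule sum.cong) (simp_all add: divide_simps)
    finally show ?thesis .
  qed
  also have "\<dots> = (\<Sum>l\<le>n. ?g l)"
  proof -
    \<comment> \<open>Here \<open>h\<close> is contracted \<open>n + 1\<close> times, which exceeds the dimension.\<close>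
    have "scw n (grinv f) (\<iota> i h) = 0"
      by (rule scw_vanish) (simp add: contr_def vanish[OF assms(3)])
    then show ?thesis by (simp flip: lessThan_Suc_atMost)
  qed
  finally have *: "(\<Sum>l\<le>n. (real l / fact l) *\<^sub>R scw (l - 1) (grinv f) (\<iota> i h)) = grinv f \<diamondop> \<iota> i h"
    by (simp add: clifford_def)
  have "(th i \<curlywedge> f) \<diamondop> h = th i \<curlywedge> (f \<diamondop> h) + \<eta> i *\<^sub>R (\<Sum>l\<le>n. (real l / fact l) *\<^sub>R scw (l - 1) (grinv f) (\<iota> i h))"
    unfolding clifford_def by (simp add: scw_th_shuf[OF assms] scaleR_add_right sum.distrib scaleR_sum_right mult_ac)
  then show ?thesis unfolding * .
qed

lemma one_clifford [simp]: "one_form \<diamondop> h = h"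
proof -
  have "scw (Suc l) one_form h = 0" for l by simp
  then have "(1 / fact l) *\<^sub>R scw l one_form h = (if l = 0 then h else 0)" for l by (cases l) simp_all
  then show ?thesis by (simp add: clifford_def)
qed

lemma clifford_one [simp]: "h \<diamondop> one_form = h"
proof -
  have "scw (Suc l) h one_form = 0" for l by simp
  then have "(1 / fact l) *\<^sub>R scw l h one_form = (if l = 0 then h else 0)" for l by (cases l) simp_all
  then show ?thesis by (simp add: clifford_def)
qed

lemma th_clifford:
  assumes "i \<in> {1..n}" "h \<in> \<Lambda>"
  shows "th i \<diamondop> h = th i \<curlywedge> h + \<eta> i *\<^sub>R \<iota> i h"
  using th_shuf_clifford[OF assms(1) exterior_one assms(2)] by simp

text \<open>
  Together with \<open>th_clifford\<close> this recovers exterior multiplication and contraction from left and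
  right Clifford multiplication. The contraction changes its sign because it anticommutes with the
  grade involution.
\<close>

lemma clifford_th:
  assumes "i \<in> {1..n}" "f \<in> \<Lambda>"
  shows "grinv f \<diamondop> th i = th i \<curlywedge> f - \<eta> i *\<^sub>R \<iota> i f"
proof -
  have *: "grinv f \<curlywedge> th i = th i \<curlywedge> f" if "f \<in> \<Lambda>" for f
  proof -
    have "grinv (dpart k f) \<curlywedge> th i = th i \<curlywedge> dpart k f" for k
      using shuf_commute[OF homog_dpart th_homog[OF assms(1)], of k f]
      by (simp add: homog_grinv_eq[OF homog_dpart] minus_one_power_iff)
    then have "(\<Sum>k\<le>n. grinv (dpart k f) \<curlywedge> th i) = (\<Sum>k\<le>n. th i \<curlywedge> dpart k f)" by simp
    then have "grinv (\<Sum>k\<le>n. dpart k f) \<curlywedge> th i = th i \<curlywedge> (\<Sum>k\<le>n. dpart k f)" by simp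
    then show ?thesis by (simp only: dpart_sum[OF that, symmetric])
  qed
  have G1: "scw (Suc 0) (grinv f) (th i) = - \<eta> i *\<^sub>R \<iota> i f"
  proof -
    have "scw (Suc 0) (grinv f) (th i) = (\<Sum>j=1..n. if j = i then - \<eta> i *\<^sub>R \<iota> i f else 0)"
      unfolding scw.simps by (rule sum.cong) (use assms in \<open>auto simp: contr_E_th contr_grinv\<close>)
    also have "\<dots> = - \<eta> i *\<^sub>R \<iota> i f" using assms by (subst sum.delta) auto
    finally show ?thesis .
  qed
  have G2: "scw l (grinv f) (th i) = 0" if "l \<ge> 2" for l
    by (rule scw_vanish) (use th_homog[OF assms(1)] that in \<open>auto simp: homog_def\<close>)
  have "grinv f \<diamondop> th i = (\<Sum>l\<in>{0,1}. (1 / fact l) *\<^sub>R scw l (grinv f) (th i))"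
    unfolding clifford_def
  proof (rule sum.mono_neutral_right)
    show "\<forall>l\<in>{..n} - {0, 1}. (1 / fact l) *\<^sub>R scw l (grinv f) (th i) = 0"
    proof
      fix l assume "l \<in> {..n} - {0, 1}"
      then have "l \<ge> 2" by (cases l) auto
      then show "(1 / fact l) *\<^sub>R scw l (grinv f) (th i) = 0" by (simp add: G2)
    qed
  qed (use assms in auto)
  also have "\<dots> = grinv f \<curlywedge> th i + scw (Suc 0) (grinv f) (th i)" by (simp del: scw.simps add: scw.simps(1))
  finally show ?thesis by (simp add: G1 * assms del: scw.simps)
qed

text \<open>
  With \<open>th i \<diamondop> _ = th i \<curlywedge> _ + \<eta> i *\<^sub>R \<iota> i _\<close> both sides are combinations of
  \<open>th i \<curlywedge> (f \<diamondop> h)\<close>, \<open>\<iota> i f \<diamondop> h\<close> and \<open>grinv f \<diamondop> \<iota> i h\<close>; the last one cancels by the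
  derivation rule.
\<close>

lemma th_clifford_assoc:
  assumes "i \<in> {1..n}" "f \<in> \<Lambda>" "h \<in> \<Lambda>"
  shows "(th i \<diamondop> f) \<diamondop> h = th i \<diamondop> (f \<diamondop> h)"
  using assms by (simp add: th_clifford clifford_in th_shuf_clifford contr_clifford E_in algebra_simps scaleR_add_right)

text \<open>
  The coframe generates the exterior algebra under \<open>\<diamondop>\<close>. In Euler's formula \<open>th i \<curlywedge> \<iota> i f\<close> equals
  \<open>th i \<diamondop> \<iota> i f\<close>, because the correction \<open>\<eta> i *\<^sub>R \<iota> i (\<iota> i f)\<close> is zero.
\<close>

lemma ext_induct [consumes 1, case_names one add scale th]:
  assumes "f \<in> \<Lambda>" and one: "P one_form"
    and add: "\<And>f h. f \<in> \<Lambda> \<Longrightarrow> h \<in> \<Lambda> \<Longrightarrow> P f \<Longrightarrow> P h \<Longrightarrow> P (f + h)"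
    and scale: "\<And>a f. f \<in> \<Lambda> \<Longrightarrow> P f \<Longrightarrow> P (a *\<^sub>R f)"
    and th: "\<And>i f. i \<in> {1..n} \<Longrightarrow> f \<in> \<Lambda> \<Longrightarrow> P f \<Longrightarrow> P (th i \<diamondop> f)"
  shows "P f"
proof -
  have 0: "P 0" using scale[OF exterior_one one, of 0] by simp
  have S: "P (sum f I) \<and> sum f I \<in> \<Lambda>" if "\<And>i. i \<in> I \<Longrightarrow> f i \<in> \<Lambda> \<and> P (f i)"
    for f and I :: "nat set"
    using that by (induction I rule: infinite_finite_induct) (auto intro: add simp: 0)
  have "P f" if "f \<in> \<Lambda>" "homog k f" for k f
    using that
  proof (induction k arbitrary: f)
    case 0
    then show ?case using homog_0_eq[OF 0(2)] scale[OF exterior_one one] by metis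
  next
    case (Suc k)
    have "th i \<curlywedge> \<iota> i f = th i \<diamondop> \<iota> i f" if "i \<in> {1..n}" for i
      using that Suc.prems by (simp add: th_clifford exterior_contr exterior_contr_sq[of f V])
    then have "f = (1 / real (Suc k)) *\<^sub>R (\<Sum>i=1..n. th i \<diamondop> \<iota> i f)"
      using euler[OF Suc.prems] by simp
    moreover have "P (\<Sum>i=1..n. th i \<diamondop> \<iota> i f) \<and> (\<Sum>i=1..n. th i \<diamondop> \<iota> i f) \<in> \<Lambda>"
    proof (rule S)
      fix i assume i: "i \<in> {1..n}"
      have "\<iota> i f \<in> \<Lambda>" "P (\<iota> i f)"
        using Suc.prems by (auto intro!: Suc.IH intro: homog_contr)
      then show "th i \<diamondop> \<iota> i f \<in> \<Lambda> \<and> P (th i \<diamondop> \<iota> i f)"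
        using i th clifford_in th_in by blast
    qed
    ultimately show ?case using scale by metis
  qed
  then have "P (\<Sum>k\<le>n. dpart k f)" using S[of "{..n}" "\<lambda>k. dpart k f"] assms(1) exterior_dpart homog_dpart by blast
  then show ?thesis using dpart_sum[OF assms(1)] by simp
qed

text \<open>
  The forms \<open>f\<close> that associate with all \<open>h\<close> and \<open>k\<close> are closed under left multiplication by
  generators.
\<close>

lemma clifford_assoc:
  assumes "f \<in> \<Lambda>" "h \<in> \<Lambda>" "k \<in> \<Lambda>"
  shows "(f \<diamondop> h) \<diamondop> k = f \<diamondop> (h \<diamondop> k)"
  using assms(1)
proof (induction f rule: ext_induct)
  case one
  show "(one_form \<diamondop> h) \<diamondop> k = one_form \<diamondop> (h \<diamondop> k)" by simp
next
  case (add f g)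
  then show "((f + g) \<diamondop> h) \<diamondop> k = (f + g) \<diamondop> (h \<diamondop> k)" by simp
next
  case (scale a f)
  then show "((a *\<^sub>R f) \<diamondop> h) \<diamondop> k = (a *\<^sub>R f) \<diamondop> (h \<diamondop> k)" by simp
next
  case (th i f)
  then show "((th i \<diamondop> f) \<diamondop> h) \<diamondop> k = (th i \<diamondop> f) \<diamondop> (h \<diamondop> k)"
    using assms by (simp add: th_clifford_assoc clifford_in)
qed


section \<open>The volume element\<close>

definition wedge_list :: "nat list \<Rightarrow> ('a \<Rightarrow> 'b) list \<Rightarrow> real" where
  "wedge_list is = foldr (\<curlywedge>) (map th is) one_form"

definition vol :: "('a \<Rightarrow> 'b) list \<Rightarrow> real" where
  "vol = wedge_list [1..<Suc n]"

lemma wedge_list_simps [simp]: "wedge_list [] = one_form" "wedge_list (i # is) = th i \<curlywedge> wedge_list is"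
  by (simp_all add: wedge_list_def)

lemma wedge_list_in: "set is \<subseteq> {1..n} \<Longrightarrow> wedge_list is \<in> \<Lambda>"
  by (induction "is") (simp_all add: ext_shuf th_in)

lemma wedge_list_homog: "set is \<subseteq> {1..n} \<Longrightarrow> homog (length is) (wedge_list is)"
proof (induction "is")
  case (Cons i "is")
  then show "homog (length (i # is)) (wedge_list (i # is))"
    using homog_shuf[OF th_homog[of i], of "length is" "wedge_list is"] by simp
qed simp

lemma contr_wedge_list: "set is \<subseteq> {1..n} \<Longrightarrow> j \<in> {1..n} \<Longrightarrow> j \<notin> set is \<Longrightarrow> \<iota> j (wedge_list is) = 0"
proof (induction "is")
  case (Cons i "is")
  have "\<iota> j (wedge_list is) = 0" by (rule Cons.IH) (use Cons.prems in auto)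
  then show "\<iota> j (wedge_list (i # is)) = 0" using Cons.prems by (simp add: contr_E_th_shuf)
qed simp

lemma th_clifford_th: "i \<in> {1..n} \<Longrightarrow> th i \<diamondop> th i = \<eta> i *\<^sub>R one_form"
proof -
  assume i: "i \<in> {1..n}"
  have "th i \<curlywedge> th i = - (th i \<curlywedge> th i)"
    using shuf_commute[OF th_homog[OF i] th_homog[OF i]] by simp
  then have "th i \<curlywedge> th i = 0" by (simp add: fun_eq_iff)
  then show ?thesis using i by (simp add: th_clifford th_in contr_E_th)
qed

text \<open>
  A product of distinct coframe elements commutes with a further one up to the sign
  \<open>(-1) ^ length is\<close>, so the two copies of \<open>th i\<close> can be brought together, where they give \<open>\<eta> i\<close>.
\<close>

lemma wedge_list_sq:
  assumes "distinct is" "set is \<subseteq> {1..n}"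
  shows "wedge_list is \<diamondop> wedge_list is = ((-1) ^ (length is * (length is - 1) div 2) * (\<Prod>i\<in>set is. \<eta> i)) *\<^sub>R one_form"
  using assms
proof (induction "is")
  case Nil
  show "wedge_list [] \<diamondop> wedge_list [] = ((-1) ^ (length [] * (length [] - 1) div 2) * (\<Prod>i\<in>set []. \<eta> i)) *\<^sub>R one_form"
    by simp
next
  case (Cons i "is")
  define w where "w = wedge_list is"
  define c where "c = (-1) ^ (length is * (length is - 1) div 2) * (\<Prod>i\<in>set is. \<eta> i)"
  have i: "i \<in> {1..n}" and w: "w \<in> \<Lambda>" and iw: "\<iota> i w = 0" and hw: "homog (length is) w"
    using Cons.prems by (simp_all add: w_def wedge_list_in contr_wedge_list wedge_list_homog)
  have th: "th i \<in> \<Lambda>" using i by (rule th_in)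
  have IH: "w \<diamondop> w = c *\<^sub>R one_form"
    unfolding w_def c_def by (rule Cons.IH) (use Cons.prems in auto)
  have 1: "wedge_list (i # is) = th i \<diamondop> w" using i w by (simp add: th_clifford iw flip: w_def)
  have 2: "w \<diamondop> th i = (-1) ^ length is *\<^sub>R (th i \<diamondop> w)"
    using clifford_th[OF i exterior_grinv[OF w]] i w by (simp add: homog_grinv_eq[OF hw] iw th_clifford)
  have "wedge_list (i # is) \<diamondop> wedge_list (i # is) = th i \<diamondop> ((w \<diamondop> th i) \<diamondop> w)"
    unfolding 1 using th w by (simp add: clifford_assoc clifford_in)
  also have "\<dots> = (-1) ^ length is *\<^sub>R (th i \<diamondop> (th i \<diamondop> (w \<diamondop> w)))"
    unfolding 2 using th w by (simp add: clifford_assoc clifford_in)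
  also have "\<dots> = ((-1) ^ length is * c * \<eta> i) *\<^sub>R one_form"
    unfolding IH using i by (simp add: th_clifford_th)
  also have "(-1) ^ length is * c * \<eta> i =
      (-1) ^ (length (i # is) * (length (i # is) - 1) div 2) * (\<Prod>i\<in>set (i # is). \<eta> i)"
  proof -
    have "length (i # is) * (length (i # is) - 1) = length is * (length is - 1) + 2 * length is"
      by (cases "length is") simp_all
    then have "length (i # is) * (length (i # is) - 1) div 2 = length is * (length is - 1) div 2 + length is"
      by simp
    then show ?thesis using Cons.prems by (simp add: c_def power_add)
  qed
  finally show "wedge_list (i # is) \<diamondop> wedge_list (i # is) = ((-1) ^ (length (i # is) * (length (i # is) - 1) div 2)
      * (\<Prod>i\<in>set (i # is). \<eta> i)) *\<^sub>R one_form" .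
qed

lemma vol_in: "vol \<in> \<Lambda>" unfolding vol_def by (rule wedge_list_in) auto

lemma vol_homog: "homog n vol" 
  using wedge_list_homog[of "[1..<Suc n]"] by (simp del: upt_Suc add: vol_def atLeastLessThanSuc_atLeastAtMost)

lemma th_shuf_vol: "i \<in> {1..n} \<Longrightarrow> th i \<curlywedge> vol = 0"
  using homog_large_zero[of "th i \<curlywedge> vol" "1 + n"] homog_shuf[OF th_homog vol_homog] ext_shuf[OF th_in vol_in]
  by simp

lemma th_clifford_vol: "odd n \<Longrightarrow> i \<in> {1..n} \<Longrightarrow> th i \<diamondop> vol = vol \<diamondop> th i"
  using clifford_th[OF _ exterior_grinv[OF vol_in], of i] vol_in
  by (simp add: th_clifford homog_grinv_eq[OF vol_homog] th_shuf_vol exterior_grinv)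

text \<open>
  In odd dimension the volume element commutes with each coframe element: both products are
  \<open>\<eta> i *\<^sub>R \<iota> i vol\<close>, as \<open>th i \<curlywedge> vol\<close> exceeds the top degree. The coframe generates.
\<close>

lemma vol_central:
  assumes "odd n" "f \<in> \<Lambda>" shows "f \<diamondop> vol = vol \<diamondop> f"
  using assms(2)
proof (induction f rule: ext_induct)
  case one
  show "one_form \<diamondop> vol = vol \<diamondop> one_form" by simp
next
  case (add f g)
  then show "(f + g) \<diamondop> vol = vol \<diamondop> (f + g)" by simp
next
  case (scale a f)
  then show "(a *\<^sub>R f) \<diamondop> vol = vol \<diamondop> (a *\<^sub>R f)" by simp
next
  case (th i f)
  have "(th i \<diamondop> f) \<diamondop> vol = th i \<diamondop> (vol \<diamondop> f)"
    using th by (simp add: clifford_assoc th_in vol_in)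
  also have "\<dots> = (vol \<diamondop> th i) \<diamondop> f"
    using th by (simp add: clifford_assoc[symmetric] th_in vol_in th_clifford_vol assms(1))
  also have "\<dots> = vol \<diamondop> (th i \<diamondop> f)"
    using th by (simp add: clifford_assoc th_in vol_in)
  finally show "(th i \<diamondop> f) \<diamondop> vol = vol \<diamondop> (th i \<diamondop> f)" .
qed

text \<open>
  The exterior multiplication by \<open>th i\<close> is the mean of \<open>th i \<diamondop> _\<close> and \<open>grinv _ \<diamondop> th i\<close>, while half
  of their difference is \<open>\<eta> i *\<^sub>R \<iota> i\<close>. Multiplication by the central and odd element \<open>vol\<close>
  anticommutes with \<open>grinv\<close>, so it exchanges the mean with half of the difference.
\<close>

lemma th_shuf_clifford_vol:
  assumes n: "odd n" and i: "i \<in> {1..n}" and f: "f \<in> \<Lambda>"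
  shows "(th i \<curlywedge> f) \<diamondop> vol = \<eta> i *\<^sub>R \<iota> i (f \<diamondop> vol)"
proof -
  note T = th_in[OF i] vol_in f
  have gv: "grinv vol = - vol" using n by (simp add: homog_grinv_eq[OF vol_homog])
  have "2 *\<^sub>R (th i \<curlywedge> f) = th i \<diamondop> f + grinv f \<diamondop> th i"
    by (simp add: th_clifford[OF i f] clifford_th[OF i f] scaleR_2)
  then have "2 *\<^sub>R ((th i \<curlywedge> f) \<diamondop> vol) = (th i \<diamondop> f + grinv f \<diamondop> th i) \<diamondop> vol"
    by (metis linear_cmul[OF linear_clifford(1)])
  also have "\<dots> = th i \<diamondop> (f \<diamondop> vol) + (grinv f \<diamondop> vol) \<diamondop> th i"
    using T by (simp add: clifford_assoc exterior_grinv th_clifford_vol[OF n i])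
  also have "grinv f \<diamondop> vol = - grinv (f \<diamondop> vol)"
    by (simp add: grinv_clifford gv)
  also have "th i \<diamondop> (f \<diamondop> vol) + (- grinv (f \<diamondop> vol)) \<diamondop> th i = 2 *\<^sub>R (\<eta> i *\<^sub>R \<iota> i (f \<diamondop> vol))"
    using th_clifford[OF i clifford_in[OF T(3,2)]] clifford_th[OF i clifford_in[OF T(3,2)]] by (simp add: fun_eq_iff)
  finally show ?thesis unfolding scaleR_cancel_left by simp
qed

text \<open>
  Hodge duality of degrees: a form of degree \<open>k\<close> arises from scalars by \<open>k\<close> exterior multiplications,
  and the preceding lemma turns each of them into a contraction applied to \<open>vol\<close>.
\<close>

lemma clifford_vol_homog:
  assumes n: "odd n" and "f \<in> \<Lambda>" "homog k f" "k \<le> n"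
  shows "homog (n - k) (f \<diamondop> vol)"
  using assms(2-)
proof (induction k arbitrary: f)
  case 0
  have "f \<diamondop> vol = f [] *\<^sub>R vol"
    by (subst homog_0_eq[OF 0(2)]) simp
  then show "homog (n - 0) (f \<diamondop> vol)" using vol_homog by (simp add: homog_lin)
next
  case (Suc k)
  have "(1 / real (Suc k)) *\<^sub>R (\<Sum>i=1..n. th i \<curlywedge> \<iota> i f) = f"
    using euler[OF Suc.prems(1,2)] by simp
  then have "f \<diamondop> vol = ((1 / real (Suc k)) *\<^sub>R (\<Sum>i=1..n. th i \<curlywedge> \<iota> i f)) \<diamondop> vol"
    by (simp only:)
  also have "\<dots> = (1 / real (Suc k)) *\<^sub>R (\<Sum>i=1..n. (th i \<curlywedge> \<iota> i f) \<diamondop> vol)"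
    by (simp only: linear_cmul[OF linear_clifford(1)] linear_sum[OF linear_clifford(1)])
  also have "(\<Sum>i=1..n. (th i \<curlywedge> \<iota> i f) \<diamondop> vol) = (\<Sum>i=1..n. \<eta> i *\<^sub>R \<iota> i (\<iota> i f \<diamondop> vol))"
    by (rule sum.cong) (use Suc.prems in \<open>auto intro!: th_shuf_clifford_vol n\<close>)
  finally have e: "f \<diamondop> vol = (1 / real (Suc k)) *\<^sub>R (\<Sum>i=1..n. \<eta> i *\<^sub>R \<iota> i (\<iota> i f \<diamondop> vol))" .
  show "homog (n - Suc k) (f \<diamondop> vol)"
    unfolding e
  proof (intro homog_lin(2) homog_sum homog_contr)
    fix i assume "i \<in> {1..n}"
    have "homog (n - k) (\<iota> i f \<diamondop> vol)"
      using Suc.prems by (intro Suc.IH) (auto intro: homog_contr)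
    then show "homog (Suc (n - Suc k)) (\<iota> i f \<diamondop> vol)" using Suc.prems by (simp add: Suc_diff_Suc)
  qed
qed

lemma clifford_vol_apply:
  assumes "odd n" "f \<in> \<Lambda>" "length vs \<le> n"
  shows "(f \<diamondop> vol) vs = (dpart (n - length vs) f \<diamondop> vol) vs"
proof -
  have "(f \<diamondop> vol) = (\<Sum>k\<le>n. dpart k f) \<diamondop> vol" using dpart_sum[OF assms(2)] by simp
  also have "\<dots> = (\<Sum>k\<le>n. dpart k f \<diamondop> vol)" by simp
  finally have "(f \<diamondop> vol) vs = (\<Sum>k\<le>n. (dpart k f \<diamondop> vol) vs)" by (simp add: sum_fun_apply)
  also have "\<dots> = (\<Sum>k\<le>n. if k = n - length vs then (dpart (n - length vs) f \<diamondop> vol) vs else 0)"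
  proof (rule sum.cong)
    fix k assume k: "k \<in> {..n}"
    have "homog (n - k) (dpart k f \<diamondop> vol)"
      using k assms by (intro clifford_vol_homog exterior_dpart) auto
    then show "(dpart k f \<diamondop> vol) vs = (if k = n - length vs then (dpart (n - length vs) f \<diamondop> vol) vs else 0)"
      using k assms(3) unfolding homog_def by auto
  qed simp
  also have "\<dots> = (dpart (n - length vs) f \<diamondop> vol) vs" by simp
  finally show ?thesis .
qed

lemma clifford_vol_low:
  assumes "odd n" "f \<in> \<Lambda>" "\<And>vs. length vs > n div 2 \<Longrightarrow> f vs = 0" "length vs \<le> n div 2"
  shows "(f \<diamondop> vol) vs = 0"
proof -
  have "dpart (n - length vs) f = 0"
    using assms(1,3,4) by (auto simp: dpart_def fun_eq_iff elim!: oddE)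
  then show ?thesis using clifford_vol_apply[OF assms(1,2), of vs] assms(4) by simp
qed

lemma clifford_vol_high:
  assumes "odd n" "f \<in> \<Lambda>" "\<And>vs. length vs \<le> n div 2 \<Longrightarrow> f vs = 0" "length vs > n div 2"
  shows "(f \<diamondop> vol) vs = 0"
proof (cases "length vs \<le> n")
  case True
  have "dpart (n - length vs) f = 0"
    using assms(1,3,4) True by (auto simp: dpart_def fun_eq_iff elim!: oddE)
  then show ?thesis using clifford_vol_apply[OF assms(1,2), of vs] True by simp
next
  case False
  then show ?thesis using vanish[OF clifford_in[OF assms(2) vol_in], of vs] by simp
qed

section \<open>Equality of the Graf product and the Clifford product\<close>

text \<open>
  The contracted wedge product and the two cases of the Graf product as in their definition, without
  the sign twist of \<open>scw\<close>.
\<close>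

primrec cw :: "nat \<Rightarrow> (('a \<Rightarrow> 'b) list \<Rightarrow> real) \<Rightarrow> (('a \<Rightarrow> 'b) list \<Rightarrow> real) \<Rightarrow> ('a \<Rightarrow> 'b) list \<Rightarrow> real" where
  "cw 0 f h = f \<curlywedge> h"
| "cw (Suc l) f h = (\<Sum>i=1..n. \<eta> i *\<^sub>R cw l (\<iota> i f) (\<iota> i h))"

definition graf_deg :: "nat \<Rightarrow> nat \<Rightarrow> (('a \<Rightarrow> 'b) list \<Rightarrow> real) \<Rightarrow> (('a \<Rightarrow> 'b) list \<Rightarrow> real) \<Rightarrow> ('a \<Rightarrow> 'b) list \<Rightarrow> real" where
  "graf_deg r s f h = (if r \<le> s then (\<Sum>l=0..r. ((-1) ^ (l * (r - l) + l div 2) / fact l) *\<^sub>R cw l f h)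
     else (-1) ^ (s * r) *\<^sub>R (\<Sum>l=0..s. ((-1) ^ (l * (s - l + 1) + l div 2) / fact l) *\<^sub>R cw l h f))"

lemma cw_commute:
  assumes "homog (l + a) f" "homog (l + b) h"
  shows "cw l f h = (-1) ^ (a * b) *\<^sub>R cw l h f"
  using assms
proof (induction l arbitrary: f h)
  case 0
  then show "cw 0 f h = (-1) ^ (a * b) *\<^sub>R cw 0 h f" by (simp add: shuf_commute[of a f b h])
next
  case (Suc l)
  have "cw l (\<iota> i f) (\<iota> i h) = (-1) ^ (a * b) *\<^sub>R cw l (\<iota> i h) (\<iota> i f)" for i
    using Suc.prems by (intro Suc.IH homog_contr) auto
  then show "cw (Suc l) f h = (-1) ^ (a * b) *\<^sub>R cw (Suc l) h f"
    by (simp add: scaleR_sum_right mult.commute)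
qed

text \<open>
  The grade involutions act on degrees \<open>l + a - 1, \<dots>, a\<close> one after the other. The sign
  \<open>(-1) ^ (l * a + l * (l - 1) div 2)\<close> that they produce is the one of the Graf product because
  \<open>l * (l - 1) div 2\<close> and \<open>l div 2\<close> have the same parity.
\<close>

lemma scw_eq_cw:
  assumes "homog (l + a) f"
  shows "scw l f h = (-1) ^ (l * a + l div 2) *\<^sub>R cw l f h"
  using assms
proof (induction l arbitrary: f h)
  case 0
  show "scw 0 f h = (-1) ^ (0 * a + 0 div 2) *\<^sub>R cw 0 f h" by simp
next
  case (Suc l)
  have h: "homog (l + a) (\<iota> i f)" for i using Suc.prems by (intro homog_contr) simp
  have par: "even (l + a + (l * a + l div 2)) = even (Suc l * a + Suc l div 2)"
  proof (cases "even l")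
    case True
    then obtain m where "l = 2 * m" by (elim evenE)
    then show ?thesis by auto
  next
    case False
    then obtain m where "l = 2 * m + 1" by (elim oddE)
    then show ?thesis by auto
  qed
  have s: "(-1::real) ^ (l + a) * (-1) ^ (l * a + l div 2) = (-1) ^ (Suc l * a + Suc l div 2)"
    unfolding power_add[symmetric] by (rule neg_one_power_cong[OF par])
  have "scw l (grinv (\<iota> i f)) (\<iota> i h) = (-1) ^ (Suc l * a + Suc l div 2) *\<^sub>R cw l (\<iota> i f) (\<iota> i h)" for i
  proof -
    have "scw l (\<iota> i f) (\<iota> i h) = (-1) ^ (l * a + l div 2) *\<^sub>R cw l (\<iota> i f) (\<iota> i h)"
      by (rule Suc.IH[OF h])
    then show ?thesis unfolding homog_grinv_eq[OF h] s[symmetric] by simp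
  qed
  then show "scw (Suc l) f h = (-1) ^ (Suc l * a + Suc l div 2) *\<^sub>R cw (Suc l) f h"
    by (simp add: scaleR_sum_right mult.commute)
qed

lemma scw_homog_zero: "homog r f \<Longrightarrow> r < l \<Longrightarrow> scw l f h = 0"
proof (induction l arbitrary: f h r)
  case (Suc l)
  have "scw l (grinv (\<iota> i f)) (\<iota> i h) = 0" for i
  proof (cases r)
    case 0
    then show ?thesis using Suc.prems by (simp add: homog_0_contr)
  next
    case (Suc r')
    then show ?thesis using Suc.prems by (intro Suc.IH[of r'] homog_grinv homog_contr) auto
  qed
  then show "scw (Suc l) f h = 0" by simp
qed simp

text \<open>
  The second case of the Graf product is the first one with the factors of each contracted wedge
  product interchanged; the signs match by graded commutativity.
\<close>

lemma graf_deg_eq_clifford: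
  assumes f: "homog r f" and h: "homog s h" and rs: "r \<le> n" "s \<le> n"
  shows "graf_deg r s f h = f \<diamondop> h"
proof (cases "r \<le> s")
  case True
  have "f \<diamondop> h = (\<Sum>l\<in>{0..r}. (1 / fact l) *\<^sub>R scw l f h)"
    unfolding clifford_def
    by (rule sum.mono_neutral_right) (use rs in \<open>auto simp: scw_homog_zero[OF f]\<close>)
  also have "\<dots> = graf_deg r s f h"
  proof -
    have "scw l f h = (-1) ^ (l * (r - l) + l div 2) *\<^sub>R cw l f h" if "l \<in> {0..r}" for l
      using scw_eq_cw[of l "r - l" f h] f that by simp
    then show ?thesis unfolding graf_deg_def using True by simp
  qed
  finally show ?thesis by simp
next
  case False
  have z: "scw l f h = 0" if "l > s" for l
    by (rule scw_vanish) (use h that in \<open>auto simp: homog_def\<close>)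
  have "f \<diamondop> h = (\<Sum>l\<in>{0..s}. (1 / fact l) *\<^sub>R scw l f h)"
    unfolding clifford_def
    by (rule sum.mono_neutral_right) (use rs in \<open>auto simp: z\<close>)
  also have "\<dots> = (\<Sum>l=0..s. (-1) ^ (s * r) *\<^sub>R ((-1) ^ (l * (s - l + 1) + l div 2) / fact l) *\<^sub>R cw l h f)"
  proof (rule sum.cong)
    fix l assume "l \<in> {0..s}"
    then obtain a b where ab: "r = l + a" "s = l + b" using False by (metis atLeastAtMost_iff le_Suc_ex nat_le_linear order_trans)
    have par: "even (l * a + l div 2 + a * b) = even ((l + b) * (l + a) + (l * (b + 1) + l div 2))"
      by auto
    have "(-1::real) ^ (l * a + l div 2) * (-1) ^ (a * b) = (-1) ^ (s * r) * (-1) ^ (l * (s - l + 1) + l div 2)"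
      unfolding ab add_diff_cancel_left' power_add[symmetric] by (rule neg_one_power_cong[OF par])
    then show "(1 / fact l) *\<^sub>R scw l f h = (-1) ^ (s * r) *\<^sub>R ((-1) ^ (l * (s - l + 1) + l div 2) / fact l) *\<^sub>R cw l h f"
      using scw_eq_cw[of l a f h] cw_commute[of l a f b h] f h ab by simp
  qed simp
  finally show ?thesis using False by (simp add: graf_deg_def scaleR_sum_right)
qed

lemma sum_graf_deg_eq_clifford:
  assumes "f \<in> \<Lambda>" "h \<in> \<Lambda>"
  shows "(\<Sum>r=0..n. \<Sum>s=0..n. graf_deg r s (dpart r f) (dpart s h)) = f \<diamondop> h"
proof -
  have "(\<Sum>r=0..n. \<Sum>s=0..n. graf_deg r s (dpart r f) (dpart s h)) = (\<Sum>r\<le>n. \<Sum>s\<le>n. dpart r f \<diamondop> dpart s h)"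
    by (auto simp: atMost_atLeast0 intro!: sum.cong graf_deg_eq_clifford)
  also have "\<dots> = (\<Sum>r\<le>n. dpart r f) \<diamondop> (\<Sum>s\<le>n. dpart s h)"
    by (simp only: linear_sum[OF linear_clifford(1)] linear_sum[OF linear_clifford(2)]) (rule sum.swap)
  also have "\<dots> = f \<diamondop> h" using dpart_sum assms by metis
  finally show ?thesis .
qed

section \<open>The splitting by the volume element\<close>

text \<open>
  The idempotent \<open>p\<^sub>\<plusminus>\<close> at a point, for \<open>\<epsilon> = 1\<close> and \<open>\<epsilon> = -1\<close>.
\<close>

definition hproj :: "real \<Rightarrow> ('a \<Rightarrow> 'b) list \<Rightarrow> real" where
  "hproj \<epsilon> = (1/2) *\<^sub>R (one_form + \<epsilon> *\<^sub>R vol)"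

definition low :: "(('a \<Rightarrow> 'b) list \<Rightarrow> real) \<Rightarrow> ('a \<Rightarrow> 'b) list \<Rightarrow> real" where
  "low f = (\<lambda>vs. if length vs \<le> n div 2 then f vs else 0)"

lemma low_in: "f \<in> \<Lambda> \<Longrightarrow> low f \<in> \<Lambda>"
  unfolding exterior_def low_def by simp

lemma hproj_in: "hproj \<epsilon> \<in> \<Lambda>"
  unfolding hproj_def by (intro exterior_scale exterior_add exterior_one vol_in)

lemma hproj_central: "odd n \<Longrightarrow> f \<in> \<Lambda> \<Longrightarrow> f \<diamondop> hproj \<epsilon> = hproj \<epsilon> \<diamondop> f"
  by (simp add: hproj_def vol_central)

lemma clifford_hproj: "f \<diamondop> hproj \<epsilon> = (1/2) *\<^sub>R (f + \<epsilon> *\<^sub>R (f \<diamondop> vol))"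
  by (simp add: hproj_def)

context
  fixes \<epsilon> :: real
  assumes n: "odd n" and vol_sq: "vol \<diamondop> vol = one_form" and eps: "\<epsilon> * \<epsilon> = 1"
begin

lemma hproj_vol: "hproj \<epsilon> \<diamondop> vol = \<epsilon> *\<^sub>R hproj \<epsilon>"
  using eps by (simp add: hproj_def vol_sq scaleR_add_right add.commute)

lemma hproj_idem: "hproj \<epsilon> \<diamondop> hproj \<epsilon> = hproj \<epsilon>"
  unfolding clifford_hproj hproj_vol using eps by (simp add: scaleR_2[symmetric])

lemma hproj_mult:
  assumes "f \<in> \<Lambda>" "h \<in> \<Lambda>"
  shows "(f \<diamondop> hproj \<epsilon>) \<diamondop> (h \<diamondop> hproj \<epsilon>) = (f \<diamondop> h) \<diamondop> hproj \<epsilon>"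
proof -
  note T = assms hproj_in[of \<epsilon>]
  have "(f \<diamondop> hproj \<epsilon>) \<diamondop> (h \<diamondop> hproj \<epsilon>) = f \<diamondop> ((hproj \<epsilon> \<diamondop> h) \<diamondop> hproj \<epsilon>)"
    using T by (simp add: clifford_assoc clifford_in)
  also have "hproj \<epsilon> \<diamondop> h = h \<diamondop> hproj \<epsilon>" using T by (simp add: hproj_central n)
  also have "f \<diamondop> ((h \<diamondop> hproj \<epsilon>) \<diamondop> hproj \<epsilon>) = (f \<diamondop> h) \<diamondop> hproj \<epsilon>"
    using T by (simp add: clifford_assoc clifford_in hproj_idem)
  finally show ?thesis .
qed

text \<open>
  The multiplication by \<open>vol\<close> exchanges the degrees \<open>k\<close> and \<open>n - k\<close>. As \<open>n\<close> is odd, it moves a form of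
  degrees at most \<open>n div 2\<close> entirely above \<open>n div 2\<close>, so that the truncation of \<open>f \<diamondop> hproj \<epsilon>\<close> sees
  only the summand \<open>(1/2) *\<^sub>R f\<close>.
\<close>

lemma low_hproj:
  assumes "f \<in> \<Lambda>" "low f = f"
  shows "2 *\<^sub>R low (f \<diamondop> hproj \<epsilon>) = f"
proof
  fix vs
  have z: "length vs > n div 2 \<Longrightarrow> f vs = 0" for vs
    using fun_cong[OF assms(2), of vs] by (simp add: low_def)
  then show "(2 *\<^sub>R low (f \<diamondop> hproj \<epsilon>)) vs = f vs"
    using clifford_vol_low[OF n assms(1) z, of vs] by (simp add: low_def clifford_hproj)
qed

text \<open>
  A form \<open>w\<close> in the image of the projection is an eigenvector of the multiplication by \<open>vol\<close>. Since
  the latter exchanges lower and upper halves, the upper half of \<open>w\<close> is \<open>\<epsilon>\<close> times the image of its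
  lower half, and \<open>w\<close> can be recovered from the lower half.
\<close>

lemma hproj_low:
  assumes w: "w \<in> \<Lambda>" and fix_w: "w \<diamondop> hproj \<epsilon> = w"
  shows "(2 *\<^sub>R low w) \<diamondop> hproj \<epsilon> = w"
proof -
  define H where "H = w - low w"
  have L: "low w \<in> \<Lambda>" and H: "H \<in> \<Lambda>"
    using low_in[OF w] subspace_diff[OF subspace_exterior w low_in[OF w]] by (simp_all add: H_def)
  have "w \<diamondop> vol = (w \<diamondop> hproj \<epsilon>) \<diamondop> vol" by (simp add: fix_w)
  also have "\<dots> = w \<diamondop> (hproj \<epsilon> \<diamondop> vol)" by (rule clifford_assoc[OF w hproj_in vol_in])
  also have "\<dots> = \<epsilon> *\<^sub>R w" by (simp add: hproj_vol fix_w)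
  finally have wv: "w \<diamondop> vol = \<epsilon> *\<^sub>R w" .
  have Lv: "low w \<diamondop> vol = \<epsilon> *\<^sub>R H"
  proof
    fix vs show "(low w \<diamondop> vol) vs = (\<epsilon> *\<^sub>R H) vs"
    proof (cases "length vs \<le> n div 2")
      case True
      then show ?thesis
        using clifford_vol_low[OF n L, of vs] by (simp add: low_def H_def)
    next
      case False
      have "(low w \<diamondop> vol) vs = (w \<diamondop> vol) vs - (H \<diamondop> vol) vs"
        by (simp add: H_def)
      also have "(H \<diamondop> vol) vs = 0"
        by (rule clifford_vol_high[OF n H]) (use False in \<open>auto simp: H_def low_def\<close>)
      finally show ?thesis using False by (simp add: wv H_def low_def)
    qed
  qed
  show ?thesis
  proof -
    have "\<epsilon> * (2 * \<epsilon>) = 2" using eps by simp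
    then have "(2 *\<^sub>R low w) \<diamondop> hproj \<epsilon> = (1/2) *\<^sub>R (2 *\<^sub>R low w + 2 *\<^sub>R (w - low w))"
      by (simp add: clifford_hproj Lv H_def)
    then show ?thesis by (simp add: fun_eq_iff)
  qed
qed

end

end

section \<open>Smooth functions\<close>

text \<open>
  \<open>Ck_on\<close> refers to derivatives at points of \<open>S\<close> in the whole space, so changing a function outside
  of \<open>S\<close> is harmless only for open \<open>S\<close>.
\<close>

lemma Ck_on_cong:
  assumes "open S" "\<And>x. x \<in> S \<Longrightarrow> f x = g x"
  shows "Ck_on k S f \<longleftrightarrow> Ck_on k S g"
proof -
  have "Ck_on k S g" if "\<And>x. x \<in> S \<Longrightarrow> f x = g x" "Ck_on k S f" for f g
    using that
  proof (induction k arbitrary: f g)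
    case 0
    then show "Ck_on 0 S g" using continuous_on_cong[of S S f g] by simp
  next
    case (Suc k)
    have d: "f differentiable (at x)" if "x \<in> S" for x using Suc.prems that by simp
    then have "g differentiable (at x)" if "x \<in> S" for x
      using that d[OF that] has_derivative_transform_within_open[OF _ assms(1) that, of f _ UNIV g] Suc.prems(1)
      unfolding differentiable_def by blast
    moreover have "Ck_on k S (\<lambda>x. frechet_derivative g (at x) (axis j 1))" for j
    proof (rule Suc.IH)
      show "Ck_on k S (\<lambda>x. frechet_derivative f (at x) (axis j 1))" using Suc.prems by simp
      show "frechet_derivative f (at x) (axis j 1) = frechet_derivative g (at x) (axis j 1)" if "x \<in> S" for x
        using frechet_derivative_transform_within_open[OF d[OF that] assms(1) that] Suc.prems(1) by simp
    qed
    ultimately show "Ck_on (Suc k) S g" by simp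
  qed
  from this[of f g] this[of g f] assms show ?thesis by auto
qed

lemma Ck_on_mono: "Ck_on (Suc k) S f \<Longrightarrow> Ck_on k S f"
proof (induction k arbitrary: f)
  case 0
  then show "Ck_on 0 S f"
    by (auto intro!: differentiable_imp_continuous_on differentiable_at_imp_differentiable_on)
next
  case (Suc k)
  have "Ck_on k S (\<lambda>x. frechet_derivative f (at x) (axis j 1))" for j
    by (rule Suc.IH) (use Suc.prems in simp)
  then show "Ck_on (Suc k) S f" using Suc.prems by simp
qed

lemma Ck_on_const: "Ck_on k S (\<lambda>x. c)"
  by (induction k arbitrary: c) simp_all

lemma Ck_on_add:
  assumes "open S" shows "Ck_on k S f \<Longrightarrow> Ck_on k S g \<Longrightarrow> Ck_on k S (\<lambda>x. f x + g x)"
proof (induction k arbitrary: f g)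
  case 0
  then show "Ck_on 0 S (\<lambda>x. f x + g x)" by (simp add: continuous_on_add)
next
  case (Suc k)
  have "frechet_derivative (\<lambda>x. f x + g x) (at x) (axis j 1) =
      frechet_derivative f (at x) (axis j 1) + frechet_derivative g (at x) (axis j 1)" if "x \<in> S" for x j
  proof -
    have "((\<lambda>x. f x + g x) has_derivative (\<lambda>h. frechet_derivative f (at x) h + frechet_derivative g (at x) h)) (at x)"
      using Suc.prems that by (intro has_derivative_add) (simp_all add: frechet_derivative_works[symmetric])
    from frechet_derivative_at[OF this, symmetric] show ?thesis by simp
  qed
  moreover have "Ck_on k S (\<lambda>x. frechet_derivative f (at x) (axis j 1) + frechet_derivative g (at x) (axis j 1))" for j
    using Suc.prems by (intro Suc.IH) auto
  ultimately have "Ck_on k S (\<lambda>x. frechet_derivative (\<lambda>x. f x + g x) (at x) (axis j 1))" for j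
    using Ck_on_cong[OF assms] by (metis (mono_tags, lifting))
  then show "Ck_on (Suc k) S (\<lambda>x. f x + g x)" using Suc.prems by (simp add: differentiable_add)
qed

lemma Ck_on_mult:
  assumes "open S" shows "Ck_on k S f \<Longrightarrow> Ck_on k S g \<Longrightarrow> Ck_on k S (\<lambda>x. f x * g x)"
proof (induction k arbitrary: f g)
  case 0
  then show "Ck_on 0 S (\<lambda>x. f x * g x)" by (simp add: continuous_on_mult)
next
  case (Suc k)
  have "frechet_derivative (\<lambda>x. f x * g x) (at x) (axis j 1) =
      f x * frechet_derivative g (at x) (axis j 1) + frechet_derivative f (at x) (axis j 1) * g x" if "x \<in> S" for x j
  proof -
    have "((\<lambda>x. f x * g x) has_derivative (\<lambda>h. f x * frechet_derivative g (at x) h + frechet_derivative f (at x) h * g x)) (at x)"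
      using Suc.prems that by (intro has_derivative_mult) (simp_all add: frechet_derivative_works[symmetric])
    from frechet_derivative_at[OF this, symmetric] show ?thesis by simp
  qed
  moreover have "Ck_on k S (\<lambda>x. f x * frechet_derivative g (at x) (axis j 1) + frechet_derivative f (at x) (axis j 1) * g x)" for j
    using Suc.prems Ck_on_mono[OF Suc.prems(1)] Ck_on_mono[OF Suc.prems(2)]
    by (intro Ck_on_add[OF assms] Suc.IH) auto
  ultimately have "Ck_on k S (\<lambda>x. frechet_derivative (\<lambda>x. f x * g x) (at x) (axis j 1))" for j
    using Ck_on_cong[OF assms] by (metis (mono_tags, lifting))
  then show "Ck_on (Suc k) S (\<lambda>x. f x * g x)" using Suc.prems by (simp add: differentiable_mult)
qed

text \<open>
  The derivative of the inverse is a polynomial in the inverse and the derivative of \<open>f\<close>, which gives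
  a bootstrap over \<open>k\<close>.
\<close>

lemma Ck_on_inverse:
  assumes "open S" "\<And>x. x \<in> S \<Longrightarrow> f x \<noteq> 0" "\<And>k. Ck_on k S f"
  shows "Ck_on k S (\<lambda>x. inverse (f x))"
proof (induction k)
  case 0
  show "Ck_on 0 S (\<lambda>x. inverse (f x))" using assms(2) assms(3)[of 0] by (simp add: continuous_on_inverse)
next
  case (Suc k)
  have dv: "((\<lambda>x. inverse (f x)) has_derivative (\<lambda>h. - (inverse (f x) * frechet_derivative f (at x) h * inverse (f x)))) (at x)"
    if "x \<in> S" for x
    using assms(2)[OF that] assms(3)[of "Suc 0"] that
    by (intro Deriv.has_derivative_inverse) (simp_all add: frechet_derivative_works[symmetric])
  then have "frechet_derivative (\<lambda>x. inverse (f x)) (at x) (axis j 1) =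
      (-1) * (inverse (f x) * frechet_derivative f (at x) (axis j 1) * inverse (f x))" if "x \<in> S" for x j
    using frechet_derivative_at[OF dv[OF that], symmetric] by simp
  moreover have "Ck_on k S (\<lambda>x. (-1) * (inverse (f x) * frechet_derivative f (at x) (axis j 1) * inverse (f x)))" for j
    using assms(3)[of "Suc k"] by (intro Ck_on_mult[OF assms(1)] Ck_on_const Suc) auto
  ultimately have "Ck_on k S (\<lambda>x. frechet_derivative (\<lambda>x. inverse (f x)) (at x) (axis j 1))" for j
    using Ck_on_cong[OF assms(1)] by (metis (mono_tags, lifting))
  then show "Ck_on (Suc k) S (\<lambda>x. inverse (f x))" using dv by (auto simp: differentiable_def)
qed

lemma smooth_on_cong:
  "open S \<Longrightarrow> (\<And>x. x \<in> S \<Longrightarrow> f x = g x) \<Longrightarrow> smooth_on S f \<longleftrightarrow> smooth_on S g"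
  unfolding smooth_on_def using Ck_on_cong by blast

lemma smooth_on_const [simp]: "smooth_on S (\<lambda>x. c)"
  by (simp add: smooth_on_def Ck_on_const)

lemma smooth_on_add: "open S \<Longrightarrow> smooth_on S f \<Longrightarrow> smooth_on S g \<Longrightarrow> smooth_on S (\<lambda>x. f x + g x)"
  by (simp add: smooth_on_def Ck_on_add)

lemma smooth_on_mult: "open S \<Longrightarrow> smooth_on S f \<Longrightarrow> smooth_on S g \<Longrightarrow> smooth_on S (\<lambda>x. f x * g x)"
  by (simp add: smooth_on_def Ck_on_mult)

lemma smooth_on_inverse:
  "open S \<Longrightarrow> (\<And>x. x \<in> S \<Longrightarrow> f x \<noteq> 0) \<Longrightarrow> smooth_on S f \<Longrightarrow> smooth_on S (\<lambda>x. inverse (f x))"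
  by (simp add: smooth_on_def Ck_on_inverse)

lemma smooth_on_minus: "open S \<Longrightarrow> smooth_on S f \<Longrightarrow> smooth_on S (\<lambda>x. - f x)"
  using smooth_on_mult[of S "\<lambda>x. -1" f] by simp

lemma smooth_on_sum:
  "open S \<Longrightarrow> (\<And>i. i \<in> I \<Longrightarrow> smooth_on S (f i)) \<Longrightarrow> smooth_on S (\<lambda>x. \<Sum>i\<in>I. f i x)"
  by (induction I rule: infinite_finite_induct) (auto intro!: smooth_on_add)

lemma smooth_on_prod:
  "open S \<Longrightarrow> (\<And>i. i \<in> I \<Longrightarrow> smooth_on S (f i)) \<Longrightarrow> smooth_on S (\<lambda>x. \<Prod>i\<in>I. f i x)"
  by (induction I rule: infinite_finite_induct) (auto intro!: smooth_on_mult)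

lemma smooth_on_det:
  fixes M :: "real ^ 'n::finite \<Rightarrow> real ^ 'k::finite ^ 'k"
  assumes "open S" "\<And>i j. smooth_on S (\<lambda>x. M x $ i $ j)"
  shows "smooth_on S (\<lambda>x. det (M x))"
  unfolding det_def by (intro smooth_on_sum smooth_on_mult smooth_on_prod smooth_on_const assms)

lemma smooth_on_differentiable: "smooth_on S f \<Longrightarrow> x \<in> S \<Longrightarrow> f differentiable (at x)"
  unfolding smooth_on_def by (metis Ck_on.simps(2))

section \<open>Charts and tangent spaces\<close>

context
  fixes X :: "'m topology" and A :: "('m, 'n::finite) chart set"
  assumes M: "smooth_manifold X A"
begin

lemma chart_domain: "c \<in> A \<Longrightarrow> fst c \<subseteq> topspace X"
  using M by (auto simp: smooth_manifold_def is_chart_def dest: openin_subset)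

lemma chart_inj: assumes "c \<in> A" shows "inj_on (snd c) (fst c)"
proof -
  have "homeomorphic_map (subtopology X (fst c)) (top_of_set (snd c ` fst c)) (snd c)"
    using M assms by (simp add: smooth_manifold_def is_chart_def)
  then have "inj_on (snd c) (topspace (subtopology X (fst c)))"
    by (simp add: homeomorphic_eq_everything_map)
  then show ?thesis using chart_domain[OF assms] by (simp add: Int_absorb1)
qed

lemma chart_inv_left [simp]: "c \<in> A \<Longrightarrow> x \<in> fst c \<Longrightarrow> chart_inv c (snd c x) = x"
  unfolding chart_inv_def using chart_inj by (rule inv_into_f_f)

lemma chart_open_image:
  assumes "c \<in> A" "openin X W" shows "open (snd c ` (fst c \<inter> W))"
proof -
  have h: "homeomorphic_map (subtopology X (fst c)) (top_of_set (snd c ` fst c)) (snd c)" "open (snd c ` fst c)"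
    using M assms by (simp_all add: smooth_manifold_def is_chart_def)
  then have "open_map (subtopology X (fst c)) (top_of_set (snd c ` fst c)) (snd c)"
    by (simp add: homeomorphic_imp_open_map)
  moreover have "openin (subtopology X (fst c)) (fst c \<inter> W)"
    using assms(2) by (auto simp: openin_subtopology)
  ultimately have "openin (top_of_set (snd c ` fst c)) (snd c ` (fst c \<inter> W))"
    by (simp add: open_map_def)
  then show ?thesis using h(2) by (simp add: openin_open_eq)
qed

lemma chart_openin: "c \<in> A \<Longrightarrow> openin X (fst c)"
  using M by (simp add: smooth_manifold_def is_chart_def)

lemma transition_differentiable:
  assumes "c \<in> charts_at A x" "d \<in> charts_at A x"
  shows "transition c d differentiable (at (snd c x))"
proof -
  have "smooth_on (snd c ` (fst c \<inter> fst d)) (\<lambda>y. transition c d y $ i)" for i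
    using M assms by (simp add: smooth_manifold_def charts_at_def)
  moreover have "snd c x \<in> snd c ` (fst c \<inter> fst d)" using assms by (auto simp: charts_at_def)
  ultimately have d: "(\<lambda>y. transition c d y $ i) differentiable (at (snd c x))" for i
    by (rule smooth_on_differentiable)
  show ?thesis
  proof (subst differentiable_componentwise_within, intro ballI)
    fix b :: "real ^ 'n" assume "b \<in> Basis"
    then obtain i where "b = axis i 1" by (auto simp: Basis_vec_def)
    then show "(\<lambda>y. transition c d y \<bullet> b) differentiable (at (snd c x))"
      using d[of i] by (simp add: inner_axis)
  qed
qed

lemma transition_chain:
  assumes "c \<in> charts_at A x" "d \<in> charts_at A x" "d' \<in> charts_at A x"
  shows "frechet_derivative (transition c d') (at (snd c x)) v =
    frechet_derivative (transition d d') (at (snd d x)) (frechet_derivative (transition c d) (at (snd c x)) v)"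
proof -
  have A: "c \<in> A" "d \<in> A" "d' \<in> A" "x \<in> fst c" "x \<in> fst d" "x \<in> fst d'" using assms by (auto simp: charts_at_def)
  have t: "transition c d (snd c x) = snd d x" using A by (simp add: transition_def)
  have "frechet_derivative (transition c d') (at (snd c x)) =
      frechet_derivative (transition d d' \<circ> transition c d) (at (snd c x))"
  proof (rule frechet_derivative_transform_within_open)
    show "transition c d' differentiable at (snd c x)" by (rule transition_differentiable[OF assms(1,3)])
    show "open (snd c ` (fst c \<inter> fst d))" using A by (intro chart_open_image chart_openin)
    show "snd c x \<in> snd c ` (fst c \<inter> fst d)" using A by auto
    show "transition c d' y = (transition d d' \<circ> transition c d) y" if "y \<in> snd c ` (fst c \<inter> fst d)" for y
      using that A by (auto simp: transition_def)
  qed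
  also have "\<dots> = frechet_derivative (transition d d') (at (snd d x)) \<circ> frechet_derivative (transition c d) (at (snd c x))"
    using frechet_derivative_compose[of "transition c d" "snd c x" "transition d d'"]
      transition_differentiable assms by (simp add: t)
  finally show ?thesis by simp
qed

lemma linear_transition:
  "c \<in> charts_at A x \<Longrightarrow> d \<in> charts_at A x \<Longrightarrow> linear (frechet_derivative (transition c d) (at (snd c x)))"
  by (intro linear_frechet_derivative transition_differentiable)

lemma tangent_zero: "v \<in> tangent_space A x \<Longrightarrow> c \<notin> charts_at A x \<Longrightarrow> v c = 0"
  unfolding tangent_space_def by blast

lemma tangent_transition:
  assumes "v \<in> tangent_space A x" "c \<in> charts_at A x" "d \<in> charts_at A x"
  shows "frechet_derivative (transition c d) (at (snd c x)) (v c) = v d"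
proof -
  have "v d = frechet_derivative (transition c d) (at (snd c x)) (v c)"
    using assms unfolding tangent_space_def by blast
  then show ?thesis by (rule sym)
qed

lemma subspace_tangent_space: "subspace (tangent_space A x)"
proof -
  have I: "v \<in> tangent_space A x" if "\<And>c. c \<notin> charts_at A x \<Longrightarrow> v c = 0"
    "\<And>c d. c \<in> charts_at A x \<Longrightarrow> d \<in> charts_at A x \<Longrightarrow>
      frechet_derivative (transition c d) (at (snd c x)) (v c) = v d" for v
    using that unfolding tangent_space_def by simp
  show ?thesis
    by (intro subspaceI I)
      (simp_all add: tangent_zero tangent_transition linear_0[OF linear_transition]
        linear_add[OF linear_transition] linear_cmul[OF linear_transition])
qed

lemma coord_vec_in: "c \<in> charts_at A x \<Longrightarrow> coord_vec A c x j \<in> tangent_space A x"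
  unfolding tangent_space_def coord_vec_def by (auto intro: transition_chain)

text \<open>
  In the chart \<open>d\<close> this is the linearity of the derivative of the transition map from \<open>c\<close> to \<open>d\<close>.
\<close>

lemma tangent_expand:
  assumes "c \<in> charts_at A x" "v \<in> tangent_space A x"
  shows "v = (\<Sum>k\<in>UNIV. (v c $ k) *\<^sub>R coord_vec A c x k)"
proof
  fix d
  show "v d = (\<Sum>k\<in>UNIV. (v c $ k) *\<^sub>R coord_vec A c x k) d"
  proof (cases "d \<in> charts_at A x")
    case True
    have "v d = frechet_derivative (transition c d) (at (snd c x)) (v c)"
      by (rule tangent_transition[OF assms(2,1) True, symmetric])
    also have "v c = (\<Sum>k\<in>UNIV. (v c $ k) *\<^sub>R axis k 1)"
      using basis_expansion[of "v c"] by (simp add: scalar_mult_eq_scaleR)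
    also have "frechet_derivative (transition c d) (at (snd c x)) (\<Sum>k\<in>UNIV. (v c $ k) *\<^sub>R axis k 1)
        = (\<Sum>k\<in>UNIV. (v c $ k) *\<^sub>R frechet_derivative (transition c d) (at (snd c x)) (axis k 1))"
      using linear_transition[OF assms(1) True] by (simp add: linear_sum linear_cmul)
    finally show ?thesis using True by (simp add: sum_fun_apply coord_vec_def)
  next
    case False
    then show ?thesis using tangent_zero[OF assms(2)] by (simp add: sum_fun_apply coord_vec_def)
  qed
qed

end

section \<open>Orthonormal coframes and their dual frames\<close>

locale coframe_domain =
  fixes X :: "'m topology" and A :: "('m, 'n::finite) chart set" and g :: "('m, 'n) metric"
    and U :: "'m set" and e :: "nat \<Rightarrow> ('m, 'n) form" and p q :: nat
  assumes manifold: "pseudo_riemannian_manifold X A g p q"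
    and open_U: "openin X U"
    and coframe: "orthonormal_coframe A g p U e"
begin

abbreviation "T \<equiv> tangent_space A"
abbreviation "E \<equiv> dual_frame A e"
abbreviation "\<eta> \<equiv> (\<lambda>i. eta p i i)"

lemma smooth: "smooth_manifold X A"
  using manifold by (simp add: pseudo_riemannian_manifold_def)

lemmas T_subspace = subspace_tangent_space[OF smooth]

lemma U_topspace: "x \<in> U \<Longrightarrow> x \<in> topspace X"
  using openin_subset[OF open_U] by auto

lemma dimension: "p + q = CARD('n)"
  using manifold by (simp add: pseudo_riemannian_manifold_def pseudo_riemannian_metric_def)

lemma eta_sq: "eta p i i * eta p i i = 1"
  by (simp add: eta_def)

lemma metric_at:
  assumes "x \<in> U"
  shows "\<And>v w. v \<in> T x \<Longrightarrow> w \<in> T x \<Longrightarrow> g x v w = g x w v"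
    and "\<And>u v w a b. u \<in> T x \<Longrightarrow> v \<in> T x \<Longrightarrow> w \<in> T x \<Longrightarrow> g x (a *\<^sub>R u + b *\<^sub>R v) w = a * g x u w + b * g x v w"
    and "\<And>v. v \<in> T x \<Longrightarrow> (\<And>w. w \<in> T x \<Longrightarrow> g x v w = 0) \<Longrightarrow> v = 0"
    and "\<exists>b. is_basis (T x) CARD('n) b \<and> (\<forall>i\<in>{1..CARD('n)}. \<forall>j\<in>{1..CARD('n)}. g x (b i) (b j) = eta p i j)"
proof -
  have P: "pseudo_riemannian_metric A g (topspace X) p q"
    using manifold by (simp add: pseudo_riemannian_manifold_def)
  have x: "x \<in> topspace X" using assms by (rule U_topspace)
  show "\<And>v w. v \<in> T x \<Longrightarrow> w \<in> T x \<Longrightarrow> g x v w = g x w v"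
    and "\<And>u v w a b. u \<in> T x \<Longrightarrow> v \<in> T x \<Longrightarrow> w \<in> T x \<Longrightarrow> g x (a *\<^sub>R u + b *\<^sub>R v) w = a * g x u w + b * g x v w"
    and "\<And>v. v \<in> T x \<Longrightarrow> (\<And>w. w \<in> T x \<Longrightarrow> g x v w = 0) \<Longrightarrow> v = 0"
    using P x unfolding pseudo_riemannian_metric_def Let_def lincomb_eq zero_fun_def by blast+
  show "\<exists>b. is_basis (T x) CARD('n) b \<and> (\<forall>i\<in>{1..CARD('n)}. \<forall>j\<in>{1..CARD('n)}. g x (b i) (b j) = eta p i j)"
    using P x unfolding pseudo_riemannian_metric_def Let_def dimension by blast
qed

lemma metric_sum:
  assumes "x \<in> U" "finite I" "\<And>i. i \<in> I \<Longrightarrow> v i \<in> T x" "w \<in> T x"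
  shows "g x (\<Sum>i\<in>I. a i *\<^sub>R v i) w = (\<Sum>i\<in>I. a i * g x (v i) w)"
  using assms(2,3)
proof (induction I)
  case empty
  have "g x (0 *\<^sub>R w + 0 *\<^sub>R w) w = 0"
    using metric_at(2)[OF assms(1,4,4,4), of 0 0] by simp
  then show "g x (\<Sum>i\<in>{}. a i *\<^sub>R v i) w = (\<Sum>i\<in>{}. a i * g x (v i) w)" by simp
next
  case (insert i I)
  have "(\<Sum>i\<in>I. a i *\<^sub>R v i) \<in> T x"
    using insert.prems by (intro subspace_sum[OF T_subspace] subspace_scale[OF T_subspace]) auto
  then have "g x (a i *\<^sub>R v i + 1 *\<^sub>R (\<Sum>i\<in>I. a i *\<^sub>R v i)) w = a i * g x (v i) w + 1 * g x (\<Sum>i\<in>I. a i *\<^sub>R v i) w"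
    using insert.prems assms by (intro metric_at(2)) auto
  also have "g x (\<Sum>i\<in>I. a i *\<^sub>R v i) w = (\<Sum>i\<in>I. a i * g x (v i) w)"
    by (rule insert.IH) (use insert.prems in auto)
  finally show "g x (\<Sum>i\<in>insert i I. a i *\<^sub>R v i) w = (\<Sum>i\<in>insert i I. a i * g x (v i) w)"
    by (simp only: sum.insert[OF insert.hyps] scaleR_one mult_1)
qed

lemma functional_sum:
  assumes "\<alpha> \<in> exterior (T x)" "finite I" "\<And>i. i \<in> I \<Longrightarrow> v i \<in> T x"
  shows "\<alpha> [\<Sum>i\<in>I. a i *\<^sub>R v i] = (\<Sum>i\<in>I. a i * \<alpha> [v i])"
proof -
  have "\<alpha> [\<Sum>i\<in>I. a i *\<^sub>R v i] = contr (\<Sum>i\<in>I. a i *\<^sub>R v i) \<alpha> []" by (simp only: contr_def)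
  also have "\<dots> = (\<Sum>i\<in>I. a i * \<alpha> [v i])"
    by (subst exterior_contr_sum[OF assms(1) T_subspace assms(3,2)]) (simp_all add: sum_fun_apply contr_def)
  finally show ?thesis .
qed

lemma basis_expand:
  assumes "is_basis V m b" "v \<in> V"
  obtains a where "v = (\<Sum>i=1..m. a i *\<^sub>R b i)"
proof -
  obtain a where "v = (\<lambda>t. \<Sum>i=1..m. a i *\<^sub>R b i t)"
    using assms unfolding is_basis_def by blast
  then have "v = (\<Sum>i=1..m. a i *\<^sub>R b i)" by (simp only: fun_eq_iff sum_fun_apply scaleR_fun_apply) simp
  then show ?thesis by (rule that)
qed

text \<open>
  In an orthonormal basis \<open>b\<close> of the tangent space, the vector that represents \<open>\<alpha>\<close> is
  \<open>\<Sum>i. \<eta> i * \<alpha> [b i] *\<^sub>R b i\<close>. It is unique as the metric is nondegenerate.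
\<close>

lemma sharp_at:
  assumes x: "x \<in> U" and \<alpha>: "\<alpha> \<in> exterior (T x)"
  shows "sharp A g x \<alpha> \<in> T x" "\<And>w. w \<in> T x \<Longrightarrow> g x (sharp A g x \<alpha>) w = \<alpha> [w]"
proof -
  obtain b where b: "is_basis (T x) CARD('n) b" and gb: "\<And>i j. i \<in> {1..CARD('n)} \<Longrightarrow> j \<in> {1..CARD('n)} \<Longrightarrow> g x (b i) (b j) = eta p i j"
    using metric_at(4)[OF x] by blast
  have bT: "b i \<in> T x" if "i \<in> {1..CARD('n)}" for i using b that by (simp add: is_basis_def)
  define v where "v = (\<Sum>i=1..CARD('n). (eta p i i * \<alpha> [b i]) *\<^sub>R b i)"
  have v: "v \<in> T x" unfolding v_def
    by (intro subspace_sum[OF T_subspace] subspace_scale[OF T_subspace] bT)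
  have gv: "g x v (b j) = \<alpha> [b j]" if j: "j \<in> {1..CARD('n)}" for j
  proof -
    have "g x v (b j) = (\<Sum>i=1..CARD('n). (eta p i i * \<alpha> [b i]) * g x (b i) (b j))"
      unfolding v_def by (rule metric_sum[OF x]) (use bT j in auto)
    also have "\<dots> = (\<Sum>i=1..CARD('n). if i = j then \<alpha> [b j] else 0)"
      by (rule sum.cong) (use gb j eta_sq in \<open>auto simp: eta_def\<close>)
    also have "\<dots> = \<alpha> [b j]" using j by simp
    finally show ?thesis .
  qed
  have v': "g x v w = \<alpha> [w]" if w: "w \<in> T x" for w
  proof -
    obtain a where a: "w = (\<Sum>i=1..CARD('n). a i *\<^sub>R b i)" using basis_expand[OF b w] by blast
    have "g x v w = g x w v" by (rule metric_at(1)[OF x v w])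
    also have "\<dots> = (\<Sum>i=1..CARD('n). a i * g x (b i) v)"
      unfolding a by (rule metric_sum[OF x]) (use bT v in auto)
    also have "\<dots> = (\<Sum>i=1..CARD('n). a i * \<alpha> [b i])"
      by (rule sum.cong) (use gv metric_at(1)[OF x v] bT in auto)
    also have "\<dots> = \<alpha> [w]" unfolding a by (rule functional_sum[OF \<alpha>, symmetric]) (use bT in auto)
    finally show ?thesis .
  qed
  have "sharp A g x \<alpha> \<in> T x \<and> (\<forall>w\<in>T x. g x (sharp A g x \<alpha>) w = \<alpha> [w])"
    unfolding sharp_def
  proof (rule theI[where P = "\<lambda>u. u \<in> T x \<and> (\<forall>w\<in>T x. g x u w = \<alpha> [w])" and a = v])
    show "v \<in> T x \<and> (\<forall>w\<in>T x. g x v w = \<alpha> [w])" using v v' by blast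
    fix u assume u: "u \<in> T x \<and> (\<forall>w\<in>T x. g x u w = \<alpha> [w])"
    have "1 *\<^sub>R u + (-1) *\<^sub>R v = 0"
    proof (rule metric_at(3)[OF x])
      show "1 *\<^sub>R u + (-1) *\<^sub>R v \<in> T x"
        using u v by (intro subspace_add[OF T_subspace] subspace_scale[OF T_subspace]) auto
      show "g x (1 *\<^sub>R u + (-1) *\<^sub>R v) w = 0" if "w \<in> T x" for w
        by (subst metric_at(2)[OF x]) (use u v v' that in auto)
    qed
    then show "u = v" by simp
  qed
  then show "sharp A g x \<alpha> \<in> T x" "\<And>w. w \<in> T x \<Longrightarrow> g x (sharp A g x \<alpha>) w = \<alpha> [w]" by auto
qed

lemma e_form: "i \<in> {1..CARD('n)} \<Longrightarrow> e i \<in> forms A U"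
  using coframe by (simp add: orthonormal_coframe_def coframe_def)

lemma e_at:
  assumes "x \<in> U" "i \<in> {1..CARD('n)}"
  shows "e i x \<in> exterior (T x)" "homog 1 (e i x)"
proof -
  have "e i x \<in> cotangent_space A x"
    using coframe assms by (simp add: orthonormal_coframe_def coframe_def is_basis_def)
  then show "e i x \<in> exterior (T x)" "homog 1 (e i x)"
    by (auto simp: cotangent_space_def homog_def)
qed

lemma e_metric: "x \<in> U \<Longrightarrow> i \<in> {1..CARD('n)} \<Longrightarrow> j \<in> {1..CARD('n)} \<Longrightarrow> cometric A g x (e i x) (e j x) = eta p i j"
  using coframe by (simp add: orthonormal_coframe_def)

text \<open>
  The coframe spans the cotangent space, so a vector that it annihilates is annihilated by all
  functionals \<open>g x _ w\<close>.
\<close>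

lemma coframe_separates:
  assumes x: "x \<in> U" and v: "v \<in> T x" and z: "\<And>j. j \<in> {1..CARD('n)} \<Longrightarrow> e j x [v] = 0"
  shows "v = 0"
proof (rule metric_at(3)[OF x v])
  fix w assume w: "w \<in> T x"
  \<comment> \<open>The functional \<open>g x _ w\<close>, extended by zero to the lists that forms of degree one ignore.\<close>
  define \<alpha> where "\<alpha> = (\<lambda>vs. if length vs = 1 \<and> set vs \<subseteq> T x then g x (hd vs) w else 0)"
  have "\<alpha> \<in> exterior (T x)"
  proof (rule exteriorI)
    fix vs i and u u' and a b :: real
    assume as: "set vs \<subseteq> T x" "i < length vs" "u \<in> T x" "u' \<in> T x"
    show "\<alpha> (vs[i := lincomb a u b u']) = a * \<alpha> (vs[i := u]) + b * \<alpha> (vs[i := u'])"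
    proof (cases "length vs = 1")
      case True
      then obtain y where "vs = [y]" by (auto simp: length_Suc_conv)
      moreover have "a *\<^sub>R u + b *\<^sub>R u' \<in> T x"
        using as by (intro subspace_add[OF T_subspace] subspace_scale[OF T_subspace])
      ultimately show ?thesis
        using as metric_at(2)[OF x as(3,4) w, of a b] by (simp add: \<alpha>_def lincomb_eq)
    qed (simp add: \<alpha>_def)
  next
    fix vs :: "('m, 'n) tvec list" assume "\<not> distinct vs"
    then show "\<alpha> vs = 0" by (auto simp: \<alpha>_def length_Suc_conv)
  qed (auto simp: \<alpha>_def)
  then have "\<alpha> \<in> cotangent_space A x" by (auto simp: cotangent_space_def \<alpha>_def)
  moreover have "is_basis (cotangent_space A x) CARD('n) (\<lambda>i. e i x)"
    using coframe x by (simp add: orthonormal_coframe_def coframe_def)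
  ultimately obtain a where a: "\<alpha> = (\<Sum>i=1..CARD('n). a i *\<^sub>R e i x)" using basis_expand by blast
  have "\<alpha> [v] = 0" unfolding a using z by (simp add: sum_fun_apply)
  then show "g x v w = 0" using v by (simp add: \<alpha>_def)
qed

lemma coframe_cancel:
  assumes x: "x \<in> U" and v: "v \<in> T x" and w: "w \<in> T x" and z: "\<And>j. j \<in> {1..CARD('n)} \<Longrightarrow> e j x [v] = e j x [w]"
  shows "v = w"
proof -
  have "1 *\<^sub>R v + (-1) *\<^sub>R w = 0"
  proof (rule coframe_separates[OF x])
    show "1 *\<^sub>R v + (-1) *\<^sub>R w \<in> T x"
      using v w by (intro subspace_add[OF T_subspace] subspace_scale[OF T_subspace])
    fix j assume j: "j \<in> {1..CARD('n)}"
    have "contr (1 *\<^sub>R v + (-1) *\<^sub>R w) (e j x) = 1 *\<^sub>R contr v (e j x) + (-1) *\<^sub>R contr w (e j x)"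
      by (rule exterior_contr_lin[OF e_at(1)[OF x j] v w T_subspace])
    from fun_cong[OF this, of "[]"] show "e j x [1 *\<^sub>R v + (-1) *\<^sub>R w] = 0"
      using z[OF j] by (simp add: contr_def)
  qed
  then show ?thesis by simp
qed

text \<open>
  For an orthonormal coframe the dual frame is obtained by raising indices:
  \<open>E i = \<eta> i *\<^sub>R sharp (e i)\<close>.
\<close>

lemma dual_frame_at:
  assumes x: "x \<in> U" and i: "i \<in> {1..CARD('n)}"
  shows "E i x \<in> T x" "\<And>j. j \<in> {1..CARD('n)} \<Longrightarrow> e j x [E i x] = (if j = i then 1 else 0)"
proof -
  define v where "v = eta p i i *\<^sub>R sharp A g x (e i x)"
  have sh: "sharp A g x (e j x) \<in> T x" if "j \<in> {1..CARD('n)}" for j by (rule sharp_at(1)[OF x e_at(1)[OF x that]])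
  have v: "v \<in> T x" unfolding v_def by (intro subspace_scale[OF T_subspace] sh i)
  have ev: "e j x [v] = (if i = j then 1 else 0)" if j: "j \<in> {1..CARD('n)}" for j
  proof -
    have "e j x [v] = g x (sharp A g x (e j x)) v"
      by (rule sharp_at(2)[OF x e_at(1)[OF x j] v, symmetric])
    also have "\<dots> = g x v (sharp A g x (e j x))" by (rule metric_at(1)[OF x sh[OF j] v])
    also have "\<dots> = eta p i i * cometric A g x (e i x) (e j x)"
      using metric_at(2)[OF x sh[OF i] sh[OF i] sh[OF j], of "eta p i i" 0] by (simp add: v_def cometric_def)
    also have "\<dots> = (if i = j then 1 else 0)"
      using e_metric[OF x i j] eta_sq by (auto simp: eta_def)
    finally show ?thesis .
  qed
  have "E i x \<in> T x \<and> (\<forall>j\<in>{1..CARD('n)}. e j x [E i x] = (if i = j then 1 else 0))"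
    unfolding dual_frame_def
  proof (rule theI[where P = "\<lambda>u. u \<in> T x \<and> (\<forall>j\<in>{1..CARD('n)}. e j x [u] = (if i = j then 1 else 0))" and a = v])
    show "v \<in> T x \<and> (\<forall>j\<in>{1..CARD('n)}. e j x [v] = (if i = j then 1 else 0))" using v ev by blast
    show "u = v" if "u \<in> T x \<and> (\<forall>j\<in>{1..CARD('n)}. e j x [u] = (if i = j then 1 else 0))" for u
      by (rule coframe_cancel[OF x _ v]) (use that ev in auto)
  qed
  then show "E i x \<in> T x" "\<And>j. j \<in> {1..CARD('n)} \<Longrightarrow> e j x [E i x] = (if j = i then 1 else 0)" by auto
qed

lemma pseudo_frame_at:
  assumes x: "x \<in> U"
  shows "pseudo_frame (T x) CARD('n) (\<lambda>i. e i x) (\<lambda>i. E i x)"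
proof
  show "subspace (T x)" by (rule T_subspace)
  show "v = (\<Sum>i=1..CARD('n). e i x [v] *\<^sub>R E i x)" if v: "v \<in> T x" for v
  proof (rule coframe_cancel[OF x v])
    show "(\<Sum>i=1..CARD('n). e i x [v] *\<^sub>R E i x) \<in> T x"
      by (intro subspace_sum[OF T_subspace] subspace_scale[OF T_subspace] dual_frame_at(1)[OF x])
    fix j assume j: "j \<in> {1..CARD('n)}"
    have "e j x [\<Sum>i=1..CARD('n). e i x [v] *\<^sub>R E i x] = (\<Sum>i=1..CARD('n). e i x [v] * e j x [E i x])"
      by (rule functional_sum[OF e_at(1)[OF x j]]) (use dual_frame_at(1)[OF x] in auto)
    also have "\<dots> = (\<Sum>i=1..CARD('n). if j = i then e j x [v] else 0)"
      by (rule sum.cong) (use dual_frame_at(2)[OF x _ j] in auto)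
    also have "\<dots> = e j x [v]" using j by simp
    finally show "e j x [v] = e j x [\<Sum>i=1..CARD('n). e i x [v] *\<^sub>R E i x]" by simp
  qed
qed (use x in \<open>auto intro: e_at dual_frame_at(1) simp: dual_frame_at(2) simp del: One_nat_def\<close>)

abbreviation "img c \<equiv> snd c ` (fst c \<inter> U)"

lemma open_img: "c \<in> A \<Longrightarrow> open (img c)"
  by (rule chart_open_image[OF smooth _ open_U])

lemma img_point:
  assumes "c \<in> A" "y \<in> img c"
  shows "chart_inv c y \<in> U" "c \<in> charts_at A (chart_inv c y)"
  using assms chart_inv_left[OF smooth assms(1)] by (auto simp: charts_at_def)

lemma forms_smooth:
  "f \<in> forms A U \<Longrightarrow> c \<in> A \<Longrightarrow>
    smooth_on (img c) (\<lambda>y. f (chart_inv c y) (map (coord_vec A c (chart_inv c y)) js))"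
  unfolding forms_def Let_def by blast

lemma forms_at: "f \<in> forms A U \<Longrightarrow> x \<in> U \<Longrightarrow> f x \<in> exterior (T x)"
  unfolding forms_def by blast

lemma forms_off: "f \<in> forms A U \<Longrightarrow> x \<notin> U \<Longrightarrow> f x = 0"
  unfolding forms_def zero_fun_def by blast

lemma formsI:
  assumes "\<And>x. x \<notin> U \<Longrightarrow> f x = 0" "\<And>x. x \<in> U \<Longrightarrow> f x \<in> exterior (T x)"
    "\<And>c js. c \<in> A \<Longrightarrow> smooth_on (img c) (\<lambda>y. f (chart_inv c y) (map (coord_vec A c (chart_inv c y)) js))"
  shows "f \<in> forms A U"
  using assms unfolding forms_def Let_def zero_fun_def by blast

text \<open>
  In a chart, the coordinate vector of \<open>E i\<close> solves the linear system whose matrix \<open>B\<close> consists of the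
  smooth components of the coframe. Cramer's rule expresses the solution as a quotient of
  determinants.
\<close>

lemma dual_frame_smooth:
  assumes c: "c \<in> A" and i: "i \<in> {1..CARD('n)}"
  shows "smooth_on (img c) (\<lambda>y. E i (chart_inv c y) c $ k)"
proof -
  obtain \<beta> :: "'n \<Rightarrow> nat" where \<beta>: "bij_betw \<beta> UNIV {1..CARD('n)}"
    using finite_same_card_bij[of "UNIV :: 'n set" "{1..CARD('n)}"] by auto
  have \<beta>_in: "\<beta> j \<in> {1..CARD('n)}" for j using \<beta> by (auto simp: bij_betw_def)
  have \<beta>_eq: "\<beta> j = \<beta> k \<longleftrightarrow> j = k" for j k using \<beta> by (auto simp: bij_betw_def inj_on_def)
  define B :: "real ^ 'n \<Rightarrow> real ^ 'n ^ 'n" where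
    "B y = (\<chi> j k. e (\<beta> j) (chart_inv c y) [coord_vec A c (chart_inv c y) k])" for y
  define d :: "real ^ 'n" where "d = (\<chi> j. if \<beta> j = i then 1 else 0)"
  \<comment> \<open>The matrix \<open>B y\<close> with column \<open>k\<close> replaced by the right-hand side \<open>d\<close>.\<close>
  define C where "C y k = (\<chi> i' j. if j = k then d $ i' else B y $ i' $ j)" for y k
  have B_smooth: "smooth_on (img c) (\<lambda>y. B y $ j $ k)" for j k
    using forms_smooth[OF e_form[OF \<beta>_in] c, of j "[k]"] by (simp add: B_def)
  have B_E: "B y *v (E i' (chart_inv c y) c) = (\<chi> j. if \<beta> j = i' then 1 else 0)"
    if y: "y \<in> img c" and i': "i' \<in> {1..CARD('n)}" for y i'
  proof -
    let ?x = "chart_inv c y"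
    have x: "?x \<in> U" "c \<in> charts_at A ?x" using img_point[OF c y] by auto
    have "(B y *v (E i' ?x c)) $ j = (if \<beta> j = i' then 1 else 0)" for j
    proof -
      have "(B y *v (E i' ?x c)) $ j = (\<Sum>k\<in>UNIV. (E i' ?x c $ k) * e (\<beta> j) ?x [coord_vec A c ?x k])"
        by (simp add: matrix_vector_mult_def B_def mult.commute)
      also have "\<dots> = e (\<beta> j) ?x [\<Sum>k\<in>UNIV. (E i' ?x c $ k) *\<^sub>R coord_vec A c ?x k]"
        by (rule functional_sum[OF e_at(1)[OF x(1) \<beta>_in], symmetric])
          (use coord_vec_in[OF smooth x(2)] in auto)
      also have "(\<Sum>k\<in>UNIV. (E i' ?x c $ k) *\<^sub>R coord_vec A c ?x k) = E i' ?x"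
        by (rule tangent_expand[OF smooth x(2) dual_frame_at(1)[OF x(1) i'], symmetric])
      also have "e (\<beta> j) ?x [E i' ?x] = (if \<beta> j = i' then 1 else 0)"
        by (rule dual_frame_at(2)[OF x(1) i' \<beta>_in])
      finally show ?thesis .
    qed
    then show ?thesis by (simp add: vec_eq_iff)
  qed
  have det_B: "det (B y) \<noteq> 0" if y: "y \<in> img c" for y
  proof -
    define F :: "real ^ 'n ^ 'n" where "F = (\<chi> k j. E (\<beta> j) (chart_inv c y) c $ k)"
    have "(B y ** F) $ l $ j = mat 1 $ l $ j" for l j
    proof -
      have "(B y ** F) $ l $ j = (B y *v (E (\<beta> j) (chart_inv c y) c)) $ l"
        by (simp add: matrix_matrix_mult_def matrix_vector_mult_def F_def)
      then show ?thesis by (simp add: B_E[OF y \<beta>_in] \<beta>_eq mat_def)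
    qed
    then have "B y ** F = mat 1" by (simp add: vec_eq_iff)
    then have "det (B y) * det F = 1" by (metis det_mul det_I)
    then show ?thesis by auto
  qed
  have "E i (chart_inv c y) c $ k = det (C y k) * inverse (det (B y))" if y: "y \<in> img c" for y
  proof -
    have "B y *v (E i (chart_inv c y) c) = d" using B_E[OF y i] by (simp add: d_def)
    then have "E i (chart_inv c y) c = (\<chi> k. det (C y k) / det (B y))"
      unfolding cramer[OF det_B[OF y]] C_def .
    then show ?thesis by (simp add: divide_inverse)
  qed
  moreover have "smooth_on (img c) (\<lambda>y. det (C y k) * inverse (det (B y)))"
  proof -
    have "smooth_on (img c) (\<lambda>y. C y k $ i $ j)" for i j
      by (cases "j = k") (simp_all add: C_def B_smooth)
    then show ?thesis using det_B B_smooth open_img[OF c]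
      by (intro smooth_on_mult smooth_on_inverse smooth_on_det) auto
  qed
  ultimately show ?thesis using smooth_on_cong[OF open_img[OF c]] by (metis (mono_tags, lifting))
qed

end

section \<open>Smooth forms under the Graf product\<close>

text \<open>
  The subsets of positions that contain the first position give the Leibniz term in which \<open>f\<close> is
  contracted. For the other ones, the sign of the shuffle changes by \<open>(-1) ^ card S\<close>, which is the
  grade involution of \<open>f\<close>.
\<close>

lemma shuffle_sum_eq_shuf:
  "(\<Sum>S\<in>Pow {..<length vs}. shuffle_sign (length vs) S * f (nths vs S) * h (nths vs (- S))) = (f \<curlywedge> h) vs"
proof (induction vs arbitrary: f h)
  case Nil
  show ?case by (simp add: shuffle_sign_def)
next
  case (Cons v vs)
  let ?k = "length vs"
  define t where "t S = shuffle_sign (Suc ?k) S * f (nths (v # vs) S) * h (nths (v # vs) (- S))" for S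
  have a: "t (insert 0 (Suc ` S)) = shuffle_sign ?k S * contr v f (nths vs S) * h (nths vs (- S))" for S
  proof -
    have "{j. Suc j \<in> insert 0 (Suc ` S)} = S" "{j. Suc j \<in> - insert 0 (Suc ` S)} = - S" by auto
    then show ?thesis by (simp add: t_def nths_Cons shuffle_sign_insert_0 contr_def)
  qed
  have b: "t (Suc ` S) = shuffle_sign ?k S * grinv f (nths vs S) * contr v h (nths vs (- S))"
    if "S \<in> Pow {..<?k}" for S
  proof -
    have "{j. Suc j \<in> Suc ` S} = S" "{j. Suc j \<in> - (Suc ` S)} = - S" by auto
    then show ?thesis using that
      by (simp add: t_def nths_Cons shuffle_sign_Suc image_iff contr_def grinv_def length_nths_eq_card)
  qed
  have "(\<Sum>S\<in>Pow {..<Suc ?k}. t S) =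
      (\<Sum>S\<in>Pow {..<?k}. t (insert 0 (Suc ` S))) + (\<Sum>S\<in>Pow {..<?k}. t (Suc ` S))"
    by (rule sum_Pow_lessThan_Suc)
  also have "(\<Sum>S\<in>Pow {..<?k}. t (insert 0 (Suc ` S))) = (contr v f \<curlywedge> h) vs"
    unfolding a by (rule Cons.IH)
  also have "(\<Sum>S\<in>Pow {..<?k}. t (Suc ` S)) = (grinv f \<curlywedge> contr v h) vs"
    unfolding Cons.IH[symmetric] by (rule sum.cong) (simp_all add: b)
  finally show ?case by (simp add: t_def)
qed

lemma wedge_at: "wedge f h x = f x \<curlywedge> h x"
  by (simp add: fun_eq_iff wedge_def shuffle_sum_eq_shuf)

lemma contraction_at: "contraction V f x = contr (V x) (f x)"
  by (simp add: contraction_def contr_def)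

lemma degree_part_at: "degree_part k f x = dpart k (f x)"
  by (simp add: degree_part_def dpart_def)

context coframe_domain
begin

lemma smooth_functionD:
  assumes "a \<in> carrier (smooth_functions A U)"
  shows "x \<notin> U \<Longrightarrow> a x = 0" "c \<in> A \<Longrightarrow> smooth_on (img c) (\<lambda>y. a (chart_inv c y))"
  using assms by (simp_all add: smooth_functions_def o_def)

lemma forms_smult:
  assumes a: "a \<in> carrier (smooth_functions A U)" and f: "f \<in> forms A U"
  shows "(\<lambda>x. a x *\<^sub>R f x) \<in> forms A U"
proof (rule formsI)
  fix c js assume "c \<in> A"
  then show "smooth_on (img c) (\<lambda>y. (a (chart_inv c y) *\<^sub>R f (chart_inv c y)) (map (coord_vec A c (chart_inv c y)) js))"
    using smooth_on_mult[OF open_img smooth_functionD(2)[OF a] forms_smooth[OF f]] by simp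
qed (use f in \<open>auto simp: forms_off intro: forms_at\<close>)

lemma subspace_forms: "subspace (forms A U)"
proof (rule subspaceI)
  show "0 \<in> forms A U" by (rule formsI) auto
next
  fix f h :: "('m, 'n) form" assume fh: "f \<in> forms A U" "h \<in> forms A U"
  show "f + h \<in> forms A U"
  proof (rule formsI)
    fix c js assume "c \<in> A"
    then show "smooth_on (img c) (\<lambda>y. (f + h) (chart_inv c y) (map (coord_vec A c (chart_inv c y)) js))"
      using smooth_on_add[OF open_img forms_smooth[OF fh(1)] forms_smooth[OF fh(2)]] by simp
  qed (use fh in \<open>auto simp: forms_off intro: forms_at\<close>)
next
  fix r :: real and f :: "('m, 'n) form" assume f: "f \<in> forms A U"
  show "r *\<^sub>R f \<in> forms A U"
  proof (rule formsI)
    fix c js assume "c \<in> A"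
    then show "smooth_on (img c) (\<lambda>y. (r *\<^sub>R f) (chart_inv c y) (map (coord_vec A c (chart_inv c y)) js))"
      using smooth_on_mult[OF open_img smooth_on_const forms_smooth[OF f]] by simp
  qed (use f in \<open>auto simp: forms_off intro: forms_at\<close>)
qed

lemmas forms_add = subspace_add[OF subspace_forms]
lemmas forms_scale = subspace_scale[OF subspace_forms]
lemmas forms_sum = subspace_sum[OF subspace_forms]
lemmas forms_zero = subspace_0[OF subspace_forms]

lemma forms_eqI:
  "f \<in> forms A U \<Longrightarrow> h \<in> forms A U \<Longrightarrow> (\<And>x. x \<in> U \<Longrightarrow> f x = h x) \<Longrightarrow> f = h"
  using forms_off by (metis ext)

lemma forms_wedge:
  assumes f: "f \<in> forms A U" and h: "h \<in> forms A U"
  shows "wedge f h \<in> forms A U"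
proof (rule formsI)
  fix c js assume c: "c \<in> A"
  show "smooth_on (img c) (\<lambda>y. wedge f h (chart_inv c y) (map (coord_vec A c (chart_inv c y)) js))"
    unfolding wedge_def length_map nths_map
    by (intro smooth_on_sum smooth_on_mult smooth_on_const forms_smooth f h c open_img)
next
  show "wedge f h x = 0" if "x \<notin> U" for x
    unfolding wedge_at forms_off[OF f that] by (rule shuf_linear)
  show "wedge f h x \<in> exterior (T x)" if "x \<in> U" for x
    unfolding wedge_at by (intro exterior_shuf T_subspace forms_at f h that)
qed

text \<open>
  The contraction involves the component functions of the dual frame, which is where its smoothness
  enters.
\<close>

lemma forms_contraction:
  assumes i: "i \<in> {1..CARD('n)}" and f: "f \<in> forms A U"
  shows "contraction (E i) f \<in> forms A U"
proof (rule formsI)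
  fix c js assume c: "c \<in> A"
  have "contraction (E i) f (chart_inv c y) (map (coord_vec A c (chart_inv c y)) js) =
    (\<Sum>k\<in>UNIV. (E i (chart_inv c y) c $ k) * f (chart_inv c y) (map (coord_vec A c (chart_inv c y)) (k # js)))"
    if y: "y \<in> img c" for y
  proof -
    let ?x = "chart_inv c y"
    have x: "?x \<in> U" "c \<in> charts_at A ?x" using img_point[OF c y] by auto
    have "contraction (E i) f ?x = contr (\<Sum>k\<in>UNIV. (E i ?x c $ k) *\<^sub>R coord_vec A c ?x k) (f ?x)"
      unfolding contraction_at using tangent_expand[OF smooth x(2) dual_frame_at(1)[OF x(1) i]] by simp
    also have "\<dots> = (\<Sum>k\<in>UNIV. (E i ?x c $ k) *\<^sub>R contr (coord_vec A c ?x k) (f ?x))"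
      by (rule exterior_contr_sum[OF forms_at[OF f x(1)] T_subspace])
        (use coord_vec_in[OF smooth x(2)] in auto)
    finally show ?thesis by (simp add: sum_fun_apply contr_def)
  qed
  moreover have "smooth_on (img c) (\<lambda>y. \<Sum>k\<in>UNIV. (E i (chart_inv c y) c $ k) *
      f (chart_inv c y) (map (coord_vec A c (chart_inv c y)) (k # js)))"
    by (intro smooth_on_sum smooth_on_mult dual_frame_smooth forms_smooth f c i open_img)
  ultimately show "smooth_on (img c) (\<lambda>y. contraction (E i) f (chart_inv c y) (map (coord_vec A c (chart_inv c y)) js))"
    using smooth_on_cong[OF open_img[OF c]] by (metis (mono_tags, lifting))
next
  show "contraction (E i) f x = 0" if "x \<notin> U" for x
    unfolding contraction_at forms_off[OF f that] by (rule contr_linear)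
  show "contraction (E i) f x \<in> exterior (T x)" if "x \<in> U" for x
    unfolding contraction_at by (intro exterior_contr forms_at f that)
qed

lemma forms_degree_part:
  assumes f: "f \<in> forms A U" shows "degree_part k f \<in> forms A U"
proof (rule formsI)
  fix c js assume "c \<in> A"
  then show "smooth_on (img c) (\<lambda>y. degree_part k f (chart_inv c y) (map (coord_vec A c (chart_inv c y)) js))"
    by (cases "length js = k") (simp_all add: degree_part_def forms_smooth[OF f])
next
  show "degree_part k f x = 0" if "x \<notin> U" for x
    unfolding degree_part_at forms_off[OF f that] by (rule linear_0[OF linear_dpart])
  show "degree_part k f x \<in> exterior (T x)" if "x \<in> U" for x
    unfolding degree_part_at by (intro exterior_dpart forms_at f that)
qed

lemma forms_P_low: "f \<in> forms A U \<Longrightarrow> P_low f \<in> forms A U"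
proof (rule formsI)
  fix c js assume "f \<in> forms A U" "c \<in> A"
  then show "smooth_on (img c) (\<lambda>y. P_low f (chart_inv c y) (map (coord_vec A c (chart_inv c y)) js))"
    by (cases "length js \<le> CARD('n) div 2") (simp_all add: P_low_def forms_smooth)
next
  fix x assume f: "f \<in> forms A U" and x: "x \<in> U"
  interpret F: pseudo_frame "T x" "CARD('n)" "\<lambda>i. e i x" "\<lambda>i. E i x" \<eta> by (rule pseudo_frame_at[OF x])
  show "P_low f x \<in> exterior (T x)"
    using F.low_in[OF forms_at[OF f x]] by (simp add: F.low_def P_low_def)
qed (auto simp: P_low_def forms_off)

lemma unit_form_at: "x \<in> U \<Longrightarrow> unit_form U x = one_form"
  by (simp add: unit_form_def one_form_def fun_eq_iff)

lemma forms_unit: "unit_form U \<in> forms A U"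
proof (rule formsI)
  fix c :: "('m, 'n) chart" and js assume c: "c \<in> A"
  have "unit_form U (chart_inv c y) (map (coord_vec A c (chart_inv c y)) js) = (if js = [] then 1 else 0)"
    if "y \<in> img c" for y
    using img_point[OF c that] by (simp add: unit_form_def)
  then show "smooth_on (img c) (\<lambda>y. unit_form U (chart_inv c y) (map (coord_vec A c (chart_inv c y)) js))"
    using smooth_on_cong[OF open_img[OF c]] smooth_on_const by (metis (mono_tags, lifting))
next
  show "unit_form U x = 0" if "x \<notin> U" for x
    using that by (simp add: unit_form_def zero_fun_def)
  show "unit_form U x \<in> exterior (T x)" if "x \<in> U" for x
    unfolding unit_form_at[OF that] by (rule exterior_one)
qed

lemma volume_at:
  "x \<in> U \<Longrightarrow> volume U e x = pseudo_frame.vol CARD('n) (\<lambda>i. e i x)"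
proof -
  assume x: "x \<in> U"
  interpret F: pseudo_frame "T x" "CARD('n)" "\<lambda>i. e i x" "\<lambda>i. E i x" \<eta> by (rule pseudo_frame_at[OF x])
  have "foldr wedge (map e is) (unit_form U) x = foldr (\<curlywedge>) (map (\<lambda>i. e i x) is) one_form" for "is"
    by (induction "is") (simp_all add: unit_form_at x wedge_at)
  then show ?thesis unfolding volume_def F.vol_def F.wedge_list_def .
qed

lemma forms_volume: "volume U e \<in> forms A U"
proof -
  have "foldr wedge (map e is) (unit_form U) \<in> forms A U" if "set is \<subseteq> {1..CARD('n)}" for "is"
    using that
  proof (induction "is")
    case (Cons i "is")
    have "wedge (e i) (foldr wedge (map e is) (unit_form U)) \<in> forms A U"
      by (intro forms_wedge e_form Cons.IH) (use Cons.prems in auto)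
    then show "foldr wedge (map e (i # is)) (unit_form U) \<in> forms A U" by simp
  qed (simp add: forms_unit)
  then show ?thesis unfolding volume_def by (simp add: atLeastLessThanSuc_atLeastAtMost del: upt_Suc)
qed

lemma p_sgn_eq: "p_sgn U e \<epsilon> = (1/2) *\<^sub>R (unit_form U + \<epsilon> *\<^sub>R volume U e)"
  by (simp add: p_sgn_def fun_eq_iff)

lemma forms_p_sgn: "p_sgn U e \<epsilon> \<in> forms A U"
  unfolding p_sgn_eq by (intro forms_scale forms_add forms_unit forms_volume)

lemma p_sgn_at: "x \<in> U \<Longrightarrow> p_sgn U e \<epsilon> x = pseudo_frame.hproj CARD('n) (\<lambda>i. e i x) \<epsilon>"
proof -
  assume x: "x \<in> U"
  interpret F: pseudo_frame "T x" "CARD('n)" "\<lambda>i. e i x" "\<lambda>i. E i x" \<eta> by (rule pseudo_frame_at[OF x])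
  show ?thesis by (simp add: p_sgn_eq F.hproj_def unit_form_at volume_at x)
qed

lemma contracted_wedge_at:
  assumes x: "x \<in> U"
  shows "contracted_wedge A g e l f h x = pseudo_frame.cw CARD('n) (\<lambda>i. E i x) \<eta> l (f x) (h x)"
proof -
  interpret F: pseudo_frame "T x" "CARD('n)" "\<lambda>i. e i x" "\<lambda>i. E i x" \<eta> by (rule pseudo_frame_at[OF x])
  show ?thesis
  proof (induction l arbitrary: f h)
    case 0
    show "contracted_wedge A g e 0 f h x = F.cw 0 (f x) (h x)" by (simp add: wedge_at)
  next
    case (Suc l)
    show "contracted_wedge A g e (Suc l) f h x = F.cw (Suc l) (f x) (h x)"
    proof
      fix vs
      have "contracted_wedge A g e (Suc l) f h x vs = (\<Sum>i=1..CARD('n). \<Sum>j=1..CARD('n).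
          if j = i then eta p i i * F.cw l (contr (E i x) (f x)) (contr (E i x) (h x)) vs else 0)"
        unfolding contracted_wedge.simps Suc.IH contraction_at
        by (intro sum.cong refl) (use x in \<open>auto simp: e_metric eta_def\<close>)
      also have "\<dots> = F.cw (Suc l) (f x) (h x) vs" by (simp add: sum_fun_apply)
      finally show "contracted_wedge A g e (Suc l) f h x vs = F.cw (Suc l) (f x) (h x) vs" .
    qed
  qed
qed

text \<open>
  Everything about the Graf product at a point \<open>x\<close> is reduced to the Clifford product on the exterior
  algebra of the tangent space at \<open>x\<close>.
\<close>

lemma graf_at:
  assumes x: "x \<in> U" and f: "f x \<in> exterior (T x)" and h: "h x \<in> exterior (T x)"
  shows "graf A g e f h x = pseudo_frame.clifford CARD('n) (\<lambda>i. E i x) \<eta> (f x) (h x)"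
proof -
  interpret F: pseudo_frame "T x" "CARD('n)" "\<lambda>i. e i x" "\<lambda>i. E i x" \<eta> by (rule pseudo_frame_at[OF x])
  have gh: "graf_homogeneous A g e r s f h x = F.graf_deg r s (f x) (h x)" for r s f h
    by (simp add: fun_eq_iff graf_homogeneous_def F.graf_deg_def contracted_wedge_at[OF x] sum_fun_apply)
  have "graf A g e f h x = (\<Sum>r=0..CARD('n). \<Sum>s=0..CARD('n). F.graf_deg r s (dpart r (f x)) (dpart s (h x)))"
    by (simp add: fun_eq_iff graf_def gh degree_part_at sum_fun_apply)
  then show ?thesis using F.sum_graf_deg_eq_clifford[OF f h] by simp
qed

text \<open>
  The coefficients \<open>cometric A g x (e i x) (e j x)\<close> are the constants \<open>eta p i j\<close> on \<open>U\<close> only; outside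
  of \<open>U\<close> they are multiplied by zero.
\<close>

lemma forms_contracted_wedge:
  "f \<in> forms A U \<Longrightarrow> h \<in> forms A U \<Longrightarrow> contracted_wedge A g e l f h \<in> forms A U"
proof (induction l arbitrary: f h)
  case 0
  then show "contracted_wedge A g e 0 f h \<in> forms A U" by (simp add: forms_wedge)
next
  case (Suc l)
  let ?t = "\<lambda>i j. contracted_wedge A g e l (contraction (E i) f) (contraction (E j) h)"
  have t: "?t i j \<in> forms A U" if "i \<in> {1..CARD('n)}" "j \<in> {1..CARD('n)}" for i j
    by (intro Suc.IH forms_contraction that Suc.prems)
  have "contracted_wedge A g e (Suc l) f h = (\<Sum>i=1..CARD('n). \<Sum>j=1..CARD('n). eta p i j *\<^sub>R ?t i j)"
  proof (intro ext)
    fix x vs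
    show "contracted_wedge A g e (Suc l) f h x vs = (\<Sum>i=1..CARD('n). \<Sum>j=1..CARD('n). eta p i j *\<^sub>R ?t i j) x vs"
      unfolding contracted_wedge.simps sum_fun_apply scaleR_fun_apply
    proof (intro sum.cong refl)
      fix i j assume ij: "i \<in> {1..CARD('n)}" "j \<in> {1..CARD('n)}"
      show "cometric A g x (e i x) (e j x) * ?t i j x vs = eta p i j *\<^sub>R ?t i j x vs"
        using ij forms_off[OF t[OF ij]] e_metric by (cases "x \<in> U") auto
    qed
  qed
  also have "\<dots> \<in> forms A U" by (intro forms_sum forms_scale t)
  finally show "contracted_wedge A g e (Suc l) f h \<in> forms A U" .
qed

lemma forms_graf:
  assumes "f \<in> forms A U" "h \<in> forms A U"
  shows "graf A g e f h \<in> forms A U"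
proof -
  have gh: "graf_homogeneous A g e r s f h \<in> forms A U" if "f \<in> forms A U" "h \<in> forms A U" for r s f h
  proof (cases "r \<le> s")
    case True
    then have "graf_homogeneous A g e r s f h =
        (\<Sum>l=0..r. ((-1) ^ (l * (r - l) + l div 2) / fact l) *\<^sub>R contracted_wedge A g e l f h)"
      by (simp add: fun_eq_iff graf_homogeneous_def sum_fun_apply)
    also have "\<dots> \<in> forms A U" by (intro forms_sum forms_scale forms_contracted_wedge that)
    finally show ?thesis .
  next
    case False
    then have "graf_homogeneous A g e r s f h = (-1) ^ (s * r) *\<^sub>R
        (\<Sum>l=0..s. ((-1) ^ (l * (s - l + 1) + l div 2) / fact l) *\<^sub>R contracted_wedge A g e l h f)"
      by (simp add: fun_eq_iff graf_homogeneous_def sum_fun_apply)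
    also have "\<dots> \<in> forms A U" by (intro forms_sum forms_scale forms_contracted_wedge that)
    finally show ?thesis .
  qed
  have "graf A g e f h = (\<Sum>r=0..CARD('n). \<Sum>s=0..CARD('n).
      graf_homogeneous A g e r s (degree_part r f) (degree_part s h))"
    by (simp add: fun_eq_iff graf_def sum_fun_apply)
  also have "\<dots> \<in> forms A U" by (intro forms_sum gh forms_degree_part assms)
  finally show ?thesis .
qed

lemma graf_bilinear:
  assumes "f \<in> forms A U" "h \<in> forms A U" "k \<in> forms A U"
  shows "graf A g e (f + h) k = graf A g e f k + graf A g e h k"
    and "graf A g e k (f + h) = graf A g e k f + graf A g e k h"
proof -
  note I = assms forms_at[OF assms(1)] forms_at[OF assms(2)] forms_at[OF assms(3)]
  have "graf A g e (f + h) k x = graf A g e f k x + graf A g e h k x"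
    "graf A g e k (f + h) x = graf A g e k f x + graf A g e k h x" if x: "x \<in> U" for x
  proof -
    interpret F: pseudo_frame "T x" "CARD('n)" "\<lambda>i. e i x" "\<lambda>i. E i x" \<eta> by (rule pseudo_frame_at[OF x])
    show "graf A g e (f + h) k x = graf A g e f k x + graf A g e h k x"
      "graf A g e k (f + h) x = graf A g e k f x + graf A g e k h x"
      using x I by (simp_all add: graf_at exterior_add)
  qed
  then show "graf A g e (f + h) k = graf A g e f k + graf A g e h k"
    "graf A g e k (f + h) = graf A g e k f + graf A g e k h"
    using I by (auto intro!: forms_eqI forms_graf forms_add)
qed

lemma graf_smult:
  assumes a: "a \<in> carrier (smooth_functions A U)" and "f \<in> forms A U" "h \<in> forms A U"
  shows "graf A g e (\<lambda>x. a x *\<^sub>R f x) h = (\<lambda>x. a x *\<^sub>R graf A g e f h x)"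
    and "graf A g e h (\<lambda>x. a x *\<^sub>R f x) = (\<lambda>x. a x *\<^sub>R graf A g e h f x)"
proof -
  note I = assms forms_at[OF assms(2)] forms_at[OF assms(3)]
  have "graf A g e (\<lambda>x. a x *\<^sub>R f x) h x = a x *\<^sub>R graf A g e f h x"
    "graf A g e h (\<lambda>x. a x *\<^sub>R f x) x = a x *\<^sub>R graf A g e h f x" if x: "x \<in> U" for x
  proof -
    interpret F: pseudo_frame "T x" "CARD('n)" "\<lambda>i. e i x" "\<lambda>i. E i x" \<eta> by (rule pseudo_frame_at[OF x])
    show "graf A g e (\<lambda>x. a x *\<^sub>R f x) h x = a x *\<^sub>R graf A g e f h x"
      "graf A g e h (\<lambda>x. a x *\<^sub>R f x) x = a x *\<^sub>R graf A g e h f x"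
      using x I by (simp_all add: graf_at exterior_scale)
  qed
  then show "graf A g e (\<lambda>x. a x *\<^sub>R f x) h = (\<lambda>x. a x *\<^sub>R graf A g e f h x)"
    "graf A g e h (\<lambda>x. a x *\<^sub>R f x) = (\<lambda>x. a x *\<^sub>R graf A g e h f x)"
    using I by (auto intro!: forms_eqI forms_graf forms_smult)
qed

lemma graf_assoc:
  assumes "f \<in> forms A U" "h \<in> forms A U" "k \<in> forms A U"
  shows "graf A g e (graf A g e f h) k = graf A g e f (graf A g e h k)"
proof (intro forms_eqI forms_graf assms)
  fix x assume x: "x \<in> U"
  interpret F: pseudo_frame "T x" "CARD('n)" "\<lambda>i. e i x" "\<lambda>i. E i x" \<eta> by (rule pseudo_frame_at[OF x])
  note I = forms_at[OF assms(1) x] forms_at[OF assms(2) x] forms_at[OF assms(3) x]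
  show "graf A g e (graf A g e f h) k x = graf A g e f (graf A g e h k) x"
    using x I by (simp add: graf_at F.clifford_in F.clifford_assoc)
qed


lemma graf_unit:
  assumes "f \<in> forms A U"
  shows "graf A g e (unit_form U) f = f" "graf A g e f (unit_form U) = f"
proof -
  have "graf A g e (unit_form U) f x = f x" "graf A g e f (unit_form U) x = f x" if x: "x \<in> U" for x
  proof -
    interpret F: pseudo_frame "T x" "CARD('n)" "\<lambda>i. e i x" "\<lambda>i. E i x" \<eta> by (rule pseudo_frame_at[OF x])
    show "graf A g e (unit_form U) f x = f x" "graf A g e f (unit_form U) x = f x"
      using forms_at[OF assms x] x by (simp_all add: graf_at unit_form_at)
  qed
  then show "graf A g e (unit_form U) f = f" "graf A g e f (unit_form U) = f"
    using assms by (auto intro!: forms_eqI forms_graf forms_unit)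
qed

lemma P_low_linear: "P_low (f + h) = P_low f + P_low h" "P_low (r *\<^sub>R f) = r *\<^sub>R P_low f" "P_low 0 = 0"
  by (simp_all add: P_low_def fun_eq_iff)

lemma Gamma_low_iff: "f \<in> Gamma_low A U \<longleftrightarrow> f \<in> forms A U \<and> P_low f = f"
  unfolding Gamma_low_def degree_part_def P_low_def fun_eq_iff mem_Collect_eq
  by (metis not_le)

lemma cring_smooth_functions: "cring (smooth_functions A U)"
proof (rule cringI)
  let ?R = "smooth_functions A U"
  have car: "a \<in> carrier ?R \<longleftrightarrow> (\<forall>x. x \<notin> U \<longrightarrow> a x = 0) \<and> (\<forall>c\<in>A. smooth_on (img c) (\<lambda>y. a (chart_inv c y)))" for a
    by (simp add: smooth_functions_def o_def)
  have add: "(\<lambda>x. a x + b x) \<in> carrier ?R" and mult: "(\<lambda>x. a x * b x) \<in> carrier ?R"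
    if "a \<in> carrier ?R" "b \<in> carrier ?R" for a b
    using that by (simp_all add: car smooth_on_add smooth_on_mult open_img)
  have neg: "(\<lambda>x. - a x) \<in> carrier ?R" if "a \<in> carrier ?R" for a
    using that by (simp add: car smooth_on_minus open_img)
  have zero: "(\<lambda>x. 0) \<in> carrier ?R" by (simp add: car)
  have one: "(\<lambda>x. if x \<in> U then 1 else 0) \<in> carrier ?R"
  proof -
    have "smooth_on (img c) (\<lambda>y. if chart_inv c y \<in> U then 1 else 0)" if c: "c \<in> A" for c
      using smooth_on_cong[OF open_img[OF c], of "\<lambda>y. if chart_inv c y \<in> U then 1 else 0" "\<lambda>y. 1"]
        img_point(1)[OF c] by simp
    then show ?thesis by (simp add: car)
  qed
  have sel: "a \<oplus>\<^bsub>?R\<^esub> b = (\<lambda>x. a x + b x)" "a \<otimes>\<^bsub>?R\<^esub> b = (\<lambda>x. a x * b x)"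
    "\<zero>\<^bsub>?R\<^esub> = (\<lambda>x. 0)" "\<one>\<^bsub>?R\<^esub> = (\<lambda>x. if x \<in> U then 1 else 0)" for a b
    by (simp_all add: smooth_functions_def)
  show "abelian_group ?R"
  proof (rule abelian_groupI)
    show "\<exists>b\<in>carrier ?R. b \<oplus>\<^bsub>?R\<^esub> a = \<zero>\<^bsub>?R\<^esub>" if "a \<in> carrier ?R" for a
      using neg[OF that] by (intro bexI[of _ "\<lambda>x. - a x"]) (simp_all add: sel)
  qed (auto simp: sel add zero algebra_simps)
  show "comm_monoid ?R"
  proof (rule comm_monoidI)
    show "\<one>\<^bsub>?R\<^esub> \<otimes>\<^bsub>?R\<^esub> a = a" if "a \<in> carrier ?R" for a
      using that by (auto simp: sel car fun_eq_iff)
  qed (auto simp: sel mult one algebra_simps)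
  show "(a \<oplus>\<^bsub>?R\<^esub> b) \<otimes>\<^bsub>?R\<^esub> c = a \<otimes>\<^bsub>?R\<^esub> c \<oplus>\<^bsub>?R\<^esub> b \<otimes>\<^bsub>?R\<^esub> c" for a b c
    by (simp add: sel algebra_simps)
qed

lemma form_algebra_sel:
  "carrier (form_algebra C prd u) = C"
  "f \<oplus>\<^bsub>form_algebra C prd u\<^esub> h = f + h"
  "f \<otimes>\<^bsub>form_algebra C prd u\<^esub> h = prd f h"
  "\<zero>\<^bsub>form_algebra C prd u\<^esub> = 0"
  "\<one>\<^bsub>form_algebra C prd u\<^esub> = u"
  "a \<odot>\<^bsub>form_algebra C prd u\<^esub> f = (\<lambda>x. a x *\<^sub>R f x)"
  by (simp_all add: form_algebra_def fun_eq_iff)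

lemma form_assoc_algebra:
  fixes C prd u
  assumes C: "C \<subseteq> forms A U" "subspace C"
    and smult: "\<And>a f. a \<in> carrier (smooth_functions A U) \<Longrightarrow> f \<in> C \<Longrightarrow> (\<lambda>x. a x *\<^sub>R f x) \<in> C"
    and closed: "\<And>f h. f \<in> C \<Longrightarrow> h \<in> C \<Longrightarrow> prd f h \<in> C"
    and assoc: "\<And>f h k. f \<in> C \<Longrightarrow> h \<in> C \<Longrightarrow> k \<in> C \<Longrightarrow> prd (prd f h) k = prd f (prd h k)"
    and u: "u \<in> C" and unit: "\<And>f. f \<in> C \<Longrightarrow> prd u f = f" "\<And>f. f \<in> C \<Longrightarrow> prd f u = f"
    and distrib: "\<And>f h k. f \<in> C \<Longrightarrow> h \<in> C \<Longrightarrow> k \<in> C \<Longrightarrow> prd (f + h) k = prd f k + prd h k"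
      "\<And>f h k. f \<in> C \<Longrightarrow> h \<in> C \<Longrightarrow> k \<in> C \<Longrightarrow> prd k (f + h) = prd k f + prd k h"
    and prd_smult: "\<And>a f h. a \<in> carrier (smooth_functions A U) \<Longrightarrow> f \<in> C \<Longrightarrow> h \<in> C \<Longrightarrow>
        prd (\<lambda>x. a x *\<^sub>R f x) h = (\<lambda>x. a x *\<^sub>R prd f h x)"
      "\<And>a f h. a \<in> carrier (smooth_functions A U) \<Longrightarrow> f \<in> C \<Longrightarrow> h \<in> C \<Longrightarrow>
        prd h (\<lambda>x. a x *\<^sub>R f x) = (\<lambda>x. a x *\<^sub>R prd h f x)"
  shows "assoc_algebra (smooth_functions A U) (form_algebra C prd u)"
proof -
  let ?R = "smooth_functions A U" and ?M = "form_algebra C prd u"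
  have ab: "abelian_group ?M"
  proof (rule abelian_groupI)
    show "\<exists>h\<in>carrier ?M. h \<oplus>\<^bsub>?M\<^esub> f = \<zero>\<^bsub>?M\<^esub>" if "f \<in> carrier ?M" for f
      using subspace_neg[OF C(2)] that by (intro bexI[of _ "- f"]) (simp_all add: form_algebra_sel)
  qed (simp_all add: form_algebra_sel add_ac subspace_add[OF C(2)] subspace_0[OF C(2)])
  have ring: "Ring.ring ?M"
  proof (rule ringI)
    show "monoid ?M"
      by (rule monoidI) (simp_all add: form_algebra_sel closed assoc u unit)
    show "(f \<oplus>\<^bsub>?M\<^esub> h) \<otimes>\<^bsub>?M\<^esub> k = f \<otimes>\<^bsub>?M\<^esub> k \<oplus>\<^bsub>?M\<^esub> h \<otimes>\<^bsub>?M\<^esub> k"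
      "k \<otimes>\<^bsub>?M\<^esub> (f \<oplus>\<^bsub>?M\<^esub> h) = k \<otimes>\<^bsub>?M\<^esub> f \<oplus>\<^bsub>?M\<^esub> k \<otimes>\<^bsub>?M\<^esub> h"
      if "f \<in> carrier ?M" "h \<in> carrier ?M" "k \<in> carrier ?M" for f h k
      using that unfolding form_algebra_sel by (rule distrib)+
  qed (rule ab)
  have mod: "Module.module ?R ?M"
  proof (rule moduleI)
    show "(a \<oplus>\<^bsub>?R\<^esub> b) \<odot>\<^bsub>?M\<^esub> f = a \<odot>\<^bsub>?M\<^esub> f \<oplus>\<^bsub>?M\<^esub> b \<odot>\<^bsub>?M\<^esub> f" for a b f
      by (simp add: form_algebra_sel) (simp add: smooth_functions_def fun_eq_iff algebra_simps)
    show "a \<odot>\<^bsub>?M\<^esub> (f \<oplus>\<^bsub>?M\<^esub> h) = a \<odot>\<^bsub>?M\<^esub> f \<oplus>\<^bsub>?M\<^esub> a \<odot>\<^bsub>?M\<^esub> h" for a f h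
      by (simp add: form_algebra_sel fun_eq_iff algebra_simps)
    show "(a \<otimes>\<^bsub>?R\<^esub> b) \<odot>\<^bsub>?M\<^esub> f = a \<odot>\<^bsub>?M\<^esub> (b \<odot>\<^bsub>?M\<^esub> f)" for a b f
      by (simp add: form_algebra_sel) (simp add: smooth_functions_def fun_eq_iff)
    show "\<one>\<^bsub>?R\<^esub> \<odot>\<^bsub>?M\<^esub> f = f" if "f \<in> carrier ?M" for f
    proof
      fix x
      have "f \<in> forms A U" using that C(1) by (auto simp: form_algebra_sel)
      then show "(\<one>\<^bsub>?R\<^esub> \<odot>\<^bsub>?M\<^esub> f) x = f x"
        using forms_off[of f x] unfolding form_algebra_sel by (simp add: smooth_functions_def)
    qed
  qed (simp_all add: form_algebra_sel ab smult cring_smooth_functions)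
  show ?thesis
    unfolding assoc_algebra_def form_algebra_sel using ring mod prd_smult by blast
qed

text \<open>
  The square of the volume element is \<open>(-1) ^ (n * (n - 1) div 2 + q)\<close>. For odd \<open>n\<close> the condition on
  the signature says that \<open>p - q = 4 * k + 1\<close>, that is \<open>n = 2 * m + 1\<close> with \<open>m = q + 2 * k\<close>; then
  \<open>n * (n - 1) div 2 = (2 * m + 1) * m\<close> has the parity of \<open>q\<close>.
\<close>

lemma volume_square:
  assumes "odd CARD('n)" "(int p - int q) mod 8 \<in> {0, 1, 4, 5}" "x \<in> U"
  shows "pseudo_frame.clifford CARD('n) (\<lambda>i. E i x) \<eta> (pseudo_frame.vol CARD('n) (\<lambda>i. e i x))
    (pseudo_frame.vol CARD('n) (\<lambda>i. e i x)) = one_form"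
proof -
  interpret F: pseudo_frame "T x" "CARD('n)" "\<lambda>i. e i x" "\<lambda>i. E i x" \<eta> by (rule pseudo_frame_at[OF assms(3)])
  let ?n = "CARD('n)"
  have "?n - p = q" using dimension by linarith
  then have c: "(\<Prod>i\<in>{p<..?n}. -1) = (-1::real) ^ q" by simp
  have "(\<Prod>i\<in>{1..?n}. eta p i i) = (\<Prod>i\<in>{p<..?n}. -1)"
    by (rule prod.mono_neutral_cong_right) (auto simp: eta_def)
  also note c
  finally have prod: "(\<Prod>i\<in>{1..?n}. eta p i i) = (-1) ^ q" .
  have "even (?n * (?n - 1) div 2 + q)"
  proof -
    have "odd (int p - int q)" using assms(1) dimension by (metis even_of_nat odd_add of_nat_add even_diff)
    then have "odd ((int p - int q) mod 8)" by (simp add: dvd_mod_iff)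
    then have "(int p - int q) mod 8 mod 4 = 1" using assms(2) by auto
    then have "(int p - int q) mod 4 = 1" by (simp add: mod_mod_cancel)
    then obtain k where k: "int p - int q = 4 * k + 1" by (metis mult.commute div_mult_mod_eq)
    have "int ?n * (int ?n - 1) = 2 * ((2 * (int q + 2 * k) + 1) * (int q + 2 * k))"
      using k dimension[symmetric] by (simp add: algebra_simps)
    moreover have "int (?n * (?n - 1)) = int ?n * (int ?n - 1)" using assms(1) by (simp add: of_nat_diff)
    ultimately have "int (?n * (?n - 1) div 2) = (2 * (int q + 2 * k) + 1) * (int q + 2 * k)"
      by (simp add: zdiv_int)
    then have "even (int (?n * (?n - 1) div 2) + int q)" by simp
    then show ?thesis by presburger
  qed
  then have "(-1::real) ^ (?n * (?n - 1) div 2) * (-1) ^ q = 1" by (simp flip: power_add)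
  then show ?thesis
    using F.wedge_list_sq[of "[1..<Suc ?n]"] prod
    by (simp add: F.vol_def atLeastLessThanSuc_atLeastAtMost del: upt_Suc One_nat_def)
qed

end

section \<open>The isomorphism\<close>

text \<open>
  Under the conditions on dimension and signature the volume element is a central involution, so that
  the forms split into its two eigenspaces.
\<close>

locale volume_involution_domain = coframe_domain X A g U e p q
  for X :: "'m topology" and A :: "('m, 'n::finite) chart set" and g :: "('m, 'n) metric"
    and U :: "'m set" and e :: "nat \<Rightarrow> ('m, 'n) form" and p q :: nat +
  fixes \<epsilon> :: real
  assumes odd_dim: "odd CARD('n)" and signature: "(int p - int q) mod 8 \<in> {0, 1, 4, 5}"
    and sign: "\<epsilon> \<in> {1, -1}"
begin

abbreviation "graf_prod \<equiv> graf A g e"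
abbreviation "pr \<equiv> p_sgn U e \<epsilon>"
abbreviation "P \<equiv> P_sgn A g U e \<epsilon>"
abbreviation "Low w \<equiv> 2 *\<^sub>R P_low w"

lemma eps_sq: "\<epsilon> * \<epsilon> = 1" using sign by auto

lemma pr_mult:
  assumes "f \<in> forms A U" "h \<in> forms A U"
  shows "graf_prod (P f) (P h) = P (graf_prod f h)"
  unfolding P_sgn_def
proof (intro forms_eqI forms_graf forms_p_sgn assms)
  fix x assume x: "x \<in> U"
  interpret F: pseudo_frame "T x" "CARD('n)" "\<lambda>i. e i x" "\<lambda>i. E i x" \<eta> by (rule pseudo_frame_at[OF x])
  show "graf_prod (graf_prod f pr) (graf_prod h pr) x = graf_prod (graf_prod f h) pr x"
    using forms_at[OF assms(1) x] forms_at[OF assms(2) x] x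
      F.hproj_mult[OF odd_dim volume_square[OF odd_dim signature x] eps_sq]
    by (simp add: graf_at F.clifford_in p_sgn_at F.hproj_in)
qed

lemma pr_central: "f \<in> forms A U \<Longrightarrow> graf_prod pr f = graf_prod f pr"
proof (intro forms_eqI forms_graf forms_p_sgn)
  fix x assume f: "f \<in> forms A U" and x: "x \<in> U"
  interpret F: pseudo_frame "T x" "CARD('n)" "\<lambda>i. e i x" "\<lambda>i. E i x" \<eta> by (rule pseudo_frame_at[OF x])
  show "graf_prod pr f x = graf_prod f pr x"
    using forms_at[OF f x] x F.hproj_central[OF odd_dim]
    by (simp add: graf_at F.clifford_in p_sgn_at F.hproj_in)
qed

lemma P_form: "f \<in> forms A U \<Longrightarrow> P f \<in> forms A U"
  unfolding P_sgn_def by (intro forms_graf forms_p_sgn)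

lemma P_unit: "P (unit_form U) = pr"
  unfolding P_sgn_def by (rule graf_unit(1)[OF forms_p_sgn])

lemma graf_pr: "f \<in> forms A U \<Longrightarrow> graf_prod (P f) pr = P f"
  using pr_mult[OF _ forms_unit, of f] by (simp add: P_unit graf_unit)

lemma P_idem: "f \<in> forms A U \<Longrightarrow> P (P f) = P f"
  using graf_pr by (simp add: P_sgn_def[of _ _ _ _ _ "P f"])

lemma Gamma_sgn_iff: "w \<in> Gamma_sgn A g U e \<epsilon> \<longleftrightarrow> w \<in> forms A U \<and> P w = w"
proof
  assume "w \<in> Gamma_sgn A g U e \<epsilon>"
  then obtain f where "f \<in> forms A U" "w = P f" unfolding Gamma_sgn_def by blast
  then show "w \<in> forms A U \<and> P w = w" by (simp add: P_form P_idem)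
next
  assume "w \<in> forms A U \<and> P w = w"
  then show "w \<in> Gamma_sgn A g U e \<epsilon>"
    unfolding Gamma_sgn_def using image_eqI[of w P w "forms A U"] by simp
qed

lemma Low_P: 
  assumes "f \<in> Gamma_low A U" shows "Low (P f) = f"
proof (rule forms_eqI)
  have f: "f \<in> forms A U" "P_low f = f" using assms by (simp_all add: Gamma_low_iff)
  show "f \<in> forms A U" "Low (P f) \<in> forms A U" using f by (simp_all add: forms_scale forms_P_low P_form)
  fix x assume x: "x \<in> U"
  interpret F: pseudo_frame "T x" "CARD('n)" "\<lambda>i. e i x" "\<lambda>i. E i x" \<eta> by (rule pseudo_frame_at[OF x])
  have L: "P_low k x = F.low (k x)" for k by (simp add: P_low_def F.low_def)
  have "2 *\<^sub>R F.low (F.clifford (f x) (F.hproj \<epsilon>)) = f x"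
    by (rule F.low_hproj[OF odd_dim volume_square[OF odd_dim signature x] eps_sq forms_at[OF f(1) x]])
      (simp add: f(2) flip: L)
  then show "Low (P f) x = f x"
    using forms_at[OF f(1) x] x by (simp add: L P_sgn_def graf_at p_sgn_at F.hproj_in)
qed

lemma P_Low:
  assumes w: "w \<in> forms A U" "P w = w" shows "P (Low w) = w"
proof (rule forms_eqI)
  show "w \<in> forms A U" "P (Low w) \<in> forms A U" using w by (simp_all add: forms_scale forms_P_low P_form)
  fix x assume x: "x \<in> U"
  interpret F: pseudo_frame "T x" "CARD('n)" "\<lambda>i. e i x" "\<lambda>i. E i x" \<eta> by (rule pseudo_frame_at[OF x])
  have L: "P_low k x = F.low (k x)" for k by (simp add: P_low_def F.low_def)
  have at: "P k x = F.clifford (k x) (F.hproj \<epsilon>)" if "k \<in> forms A U" for k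
    using forms_at[OF that x] x by (simp add: P_sgn_def graf_at p_sgn_at F.hproj_in)
  have "F.clifford (w x) (F.hproj \<epsilon>) = w x" using at[OF w(1)] w(2) by simp
  then have "F.clifford (2 *\<^sub>R F.low (w x)) (F.hproj \<epsilon>) = w x"
    by (rule F.hproj_low[OF odd_dim volume_square[OF odd_dim signature x] eps_sq forms_at[OF w(1) x]])
  then show "P (Low w) x = w x"
    using w by (subst at) (simp_all add: forms_scale forms_P_low L)
qed

lemma Low_in: "f \<in> forms A U \<Longrightarrow> Low f \<in> Gamma_low A U"
  unfolding Gamma_low_iff by (simp add: forms_scale forms_P_low) (simp add: P_low_def fun_eq_iff)

lemma P_add: "f \<in> forms A U \<Longrightarrow> h \<in> forms A U \<Longrightarrow> P (f + h) = P f + P h"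
  unfolding P_sgn_def by (intro graf_bilinear forms_p_sgn)

lemma P_smult: "a \<in> carrier (smooth_functions A U) \<Longrightarrow> f \<in> forms A U \<Longrightarrow>
    P (\<lambda>x. a x *\<^sub>R f x) = (\<lambda>x. a x *\<^sub>R P f x)"
  unfolding P_sgn_def by (intro graf_smult forms_p_sgn)

lemma P_scale: "f \<in> forms A U \<Longrightarrow> P (r *\<^sub>R f) = r *\<^sub>R P f"
proof (intro forms_eqI P_form forms_scale)
  fix x assume f: "f \<in> forms A U" and x: "x \<in> U"
  interpret F: pseudo_frame "T x" "CARD('n)" "\<lambda>i. e i x" "\<lambda>i. E i x" \<eta> by (rule pseudo_frame_at[OF x])
  show "P (r *\<^sub>R f) x = (r *\<^sub>R P f) x"
    using forms_at[OF f x] x by (simp add: P_sgn_def graf_at p_sgn_at F.hproj_in exterior_scale)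
qed

lemma truncated_eq: "truncated_graf A g U e \<epsilon> f h = Low (graf_prod (P f) (P h))"
  by (simp add: truncated_graf_def fun_eq_iff)

text \<open>
  The product of two elements in the image of \<open>P\<close> lies in the image again, where \<open>P\<close> inverts the
  truncation. Thus \<open>P\<close> turns the truncated product into the Graf product.
\<close>

lemma P_truncated:
  assumes "f \<in> forms A U" "h \<in> forms A U"
  shows "P (truncated_graf A g U e \<epsilon> f h) = graf_prod (P f) (P h)"
  unfolding truncated_eq using assms by (intro P_Low forms_graf P_form) (simp_all add: pr_mult P_idem forms_graf)

lemma subspace_low: "subspace (Gamma_low A U)"
  by (rule subspaceI) (simp_all add: Gamma_low_iff forms_zero forms_add forms_scale P_low_linear)

lemma subspace_sgn: "subspace (Gamma_sgn A g U e \<epsilon>)"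
proof (rule subspaceI)
  show "0 \<in> Gamma_sgn A g U e \<epsilon>" using P_scale[OF forms_zero, of 0] by (simp add: Gamma_sgn_iff forms_zero)
qed (simp_all add: Gamma_sgn_iff forms_add forms_scale P_add P_scale)

lemma graf_sgn_assoc_algebra: "assoc_algebra (smooth_functions A U) (graf_sgn_algebra A g U e \<epsilon>)"
  unfolding graf_sgn_algebra_def
proof (rule form_assoc_algebra)
  show "Gamma_sgn A g U e \<epsilon> \<subseteq> forms A U" by (auto simp: Gamma_sgn_iff)
  show "graf_prod f h \<in> Gamma_sgn A g U e \<epsilon>" if "f \<in> Gamma_sgn A g U e \<epsilon>" "h \<in> Gamma_sgn A g U e \<epsilon>" for f h
    using that pr_mult[of f h] by (simp add: Gamma_sgn_iff forms_graf)
  show "pr \<in> Gamma_sgn A g U e \<epsilon>"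
    using P_idem[OF forms_unit] by (simp add: Gamma_sgn_iff forms_p_sgn P_unit)
  show "graf_prod f pr = f" if "f \<in> Gamma_sgn A g U e \<epsilon>" for f
    using that graf_pr[of f] by (simp add: Gamma_sgn_iff)
  then show "graf_prod pr f = f" if "f \<in> Gamma_sgn A g U e \<epsilon>" for f
    using that by (simp add: pr_central Gamma_sgn_iff)
qed (simp_all add: Gamma_sgn_iff subspace_sgn graf_assoc graf_bilinear graf_smult forms_smult P_smult)

lemma Low_add: "Low (f + h) = Low f + Low h"
  by (simp add: fun_eq_iff P_low_def)

lemma Low_smult: "Low (\<lambda>x. a x *\<^sub>R f x) = (\<lambda>x. a x *\<^sub>R Low f x)"
  by (simp add: fun_eq_iff P_low_def)

lemma truncated_assoc_algebra: "assoc_algebra (smooth_functions A U) (truncated_algebra A g U e \<epsilon>)"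
  unfolding truncated_algebra_def
proof (rule form_assoc_algebra)
  let ?t = "truncated_graf A g U e \<epsilon>"
  show "Gamma_low A U \<subseteq> forms A U" by (auto simp: Gamma_low_iff)
  then have F: "f \<in> Gamma_low A U \<Longrightarrow> f \<in> forms A U" for f by auto
  show "subspace (Gamma_low A U)" by (rule subspace_low)
  show "(\<lambda>x. a x *\<^sub>R f x) \<in> Gamma_low A U"
    if "a \<in> carrier (smooth_functions A U)" "f \<in> Gamma_low A U" for a f
  proof -
    have f: "f \<in> forms A U" "P_low f = f" using that by (simp_all add: Gamma_low_iff)
    have "P_low (\<lambda>x. a x *\<^sub>R f x) = (\<lambda>x. a x *\<^sub>R P_low f x)" by (simp add: fun_eq_iff P_low_def)
    then show ?thesis using forms_smult[OF that(1) f(1)] f(2) by (simp add: Gamma_low_iff)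
  qed
  show "?t f h \<in> Gamma_low A U" if "f \<in> Gamma_low A U" "h \<in> Gamma_low A U" for f h
    unfolding truncated_eq by (intro Low_in forms_graf P_form F that)
  show "?t (?t f h) k = ?t f (?t h k)"
    if "f \<in> Gamma_low A U" "h \<in> Gamma_low A U" "k \<in> Gamma_low A U" for f h k
    unfolding truncated_eq[of "?t f h"] truncated_eq[of f "?t h k"]
    using that by (simp add: P_truncated graf_assoc P_form F)
  show "unit_form U \<in> Gamma_low A U"
    unfolding Gamma_low_iff by (rule conjI[OF forms_unit]) (auto simp: fun_eq_iff P_low_def unit_form_def)
  show "?t (unit_form U) f = f" "?t f (unit_form U) = f" if "f \<in> Gamma_low A U" for f
    using F[OF that] Low_P[OF that] unfolding truncated_eq P_unit
    by (simp_all add: graf_pr pr_central[OF P_form])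
  show "?t (f + h) k = ?t f k + ?t h k" "?t k (f + h) = ?t k f + ?t k h"
    if "f \<in> Gamma_low A U" "h \<in> Gamma_low A U" "k \<in> Gamma_low A U" for f h k
    unfolding truncated_eq Low_add[symmetric] using that by (simp_all add: P_add graf_bilinear P_form F)
  show "?t (\<lambda>x. a x *\<^sub>R f x) h = (\<lambda>x. a x *\<^sub>R ?t f h x)" "?t h (\<lambda>x. a x *\<^sub>R f x) = (\<lambda>x. a x *\<^sub>R ?t h f x)"
    if "a \<in> carrier (smooth_functions A U)" "f \<in> Gamma_low A U" "h \<in> Gamma_low A U" for a f h
    unfolding truncated_eq Low_smult[symmetric] using that by (simp_all add: P_smult graf_smult P_form F)
qed

text \<open>
  The isomorphism is \<open>P\<close>, restricted to the lower half of the degrees, with inverse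
  \<open>\<lambda>w. 2 *\<^sub>R P_low w\<close>.
\<close>

lemma truncated_isomorphic:
  "algebra_isomorphic (smooth_functions A U) (truncated_algebra A g U e \<epsilon>) (graf_sgn_algebra A g U e \<epsilon>)"
proof -
  have F: "f \<in> Gamma_low A U \<Longrightarrow> f \<in> forms A U" for f by (simp add: Gamma_low_iff)
  let ?M = "truncated_algebra A g U e \<epsilon>" and ?N = "graf_sgn_algebra A g U e \<epsilon>"
  have "P \<in> ring_iso ?M ?N"
    unfolding ring_iso_def mem_Collect_eq
  proof
    show "P \<in> ring_hom ?M ?N"
      unfolding truncated_algebra_def graf_sgn_algebra_def
      by (rule ring_hom_memI)
        (simp_all add: form_algebra_sel Gamma_sgn_iff P_form F P_idem P_truncated P_add P_unit)
    have "bij_betw P (Gamma_low A U) (Gamma_sgn A g U e \<epsilon>)"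
      by (rule bij_betw_byWitness[of _ "\<lambda>w. Low w"])
        (auto simp: Low_P P_Low Gamma_sgn_iff P_form F P_idem intro: Low_in)
    then show "bij_betw P (carrier ?M) (carrier ?N)"
      unfolding truncated_algebra_def graf_sgn_algebra_def form_algebra_sel .
  qed
  moreover have "P (a \<odot>\<^bsub>?M\<^esub> f) = a \<odot>\<^bsub>?N\<^esub> P f"
    if "a \<in> carrier (smooth_functions A U)" "f \<in> carrier ?M" for a f
    using that unfolding truncated_algebra_def graf_sgn_algebra_def form_algebra_sel by (simp add: P_smult F)
  ultimately show ?thesis
    unfolding algebra_isomorphic_def using truncated_assoc_algebra graf_sgn_assoc_algebra by blast
qed

end

theorem proposition3p18:
  fixes X :: "'m topology" and A :: "('m, 'n::finite) chart set" and g :: "('m, 'n) metric"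
    and U :: "'m set" and e :: "nat \<Rightarrow> ('m, 'n) form" and p q :: nat and \<epsilon> :: real
  assumes "pseudo_riemannian_manifold X A g p q"
    and "paracompact_space X"
    and "connected_space X"
    and "openin X U"
    and "orthonormal_coframe A g p U e"
    and "odd CARD('n)"
    and "(int p - int q) mod 8 \<in> {0, 1, 4, 5}"
    and "\<epsilon> \<in> {1, -1}"
  shows "algebra_isomorphic (smooth_functions A U)
           (truncated_algebra A g U e \<epsilon>) (graf_sgn_algebra A g U e \<epsilon>)"
proof -
  interpret volume_involution_domain X A g U e p q \<epsilon>
    using assms by unfold_locales
  show ?thesis by (rule truncated_isomorphic)
qed

end
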